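(* Let ${\rm p}$ be an umbilic point on a regular analytic surface $M\subset\mathbb R^3_1$ and suppose that the distance squared function $d^2_{{\bf v}_0}$ has a $D_4^{\pm}$-singularity at ${\rm p}$ for some ${\bf v}_0\in\mathbb R^3_1$. Then $m_u({\rm p})=1$ if, and only if, the family of distance squared functions $d^2$ is an $\mathcal R^+$-versal deformation of the singularity of $d^2_{{\bf v}_0}$ at ${\rm p}$.
   Context: $\mathbb R^3_1$ is $\mathbb R^3$ with the pseudo-scalar product $\langle u,v\rangle=u_0v_0+u_1v_1-u_2v_2$; $\langle u\times v,w\rangle=\det(u,v,w)$. For a local parametrisation $\mathbf x(u,v)$ of $M$, put $E=\langle \mathbf x_u,\mathbf x_u\rangle$, $F=\langle \mathbf x_u,\mathbf x_v\rangle$, $G=\langle \mathbf x_v,\mathbf x_v\rangle$, $\bar l=\langle \mathbf x_u\times \mathbf x_v,\mathbf x_{uu}\rangle$, $\bar m=\langle \mathbf x_u\times \mathbf x_v,\mathbf x_{uv}\rangle$, $\bar n=\langle \mathbf x_u\times \mathbf x_v,\mathbf x_{vv}\rangle$, $\mathfrak a=F\bar n-G\bar m$, $\mathfrak b=E\bar n-G\bar l$, $\mathfrak c=E\bar m-F\bar l$. A point ${\rm p}=\mathbf x(q)$ is an umbilic point if $\mathfrak a(q)=\mathfrak b(q)=\mathfrak c(q)=0$ (the induced metric at ${\rm p}$ may be Riemannian, Lorentzian or degenerate). Multiplicity: with $\mathcal O_2$ the ring of germs (at $q$) of holomorphic functions in two variables and $m(h,k)=\dim_{\mathbb C}\mathcal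 O_2/\langle h,k\rangle$ (real analytic germs complexified), $m_u({\rm p})=m(\mathfrak b,\mathfrak c)$ if $E(q)\neq0$, $m(\mathfrak a,\mathfrak c)$ if $F(q)\ne 0$, $m(\mathfrak a,\mathfrak b)$ if $G(q)\neq 0$ (at least one of these holds). The family of distance squared functions is $d^2:M\times\mathbb R^3_1\to\mathbb R$, $d^2({\rm p},{\bf v})=\langle {\rm p}-{\bf v},{\rm p}-{\bf v}\rangle$, and $d^2_{\bf v}({\rm p})=d^2({\rm p},{\bf v})$. A function germ (minus its value at the point) has a $D_4^\pm$-singularity if it is $\mathcal R$-equivalent, i.e. equal after composition with a germ of a diffeomorphism of the source, to $x^2y\pm y^3$. The family $d^2$ is an $\mathcal R^+$-versal deformation of $d^2_{{\bf v}_0}$ at ${\rm p}$ if, in local coordinates $(x,y)$ of $M$ centred at ${\rm p}$ and with ${\bf v}=(v_0,v_1,v_2)$, $$\mathcal E_2\Big\langle \frac{\partial d^2_{{\bf v}_0}}{\partial x},\frac{\partial d^2_{{\bf v}_0}}{\partial y}\Big\rangle+\mathbb R\cdot\Big\{1,\ \frac{\partial d^2}{\partial v_0}(\cdot,{\bf v}_0),\ \frac{\partial d^2}{\partial v_1}(\cdot,{\bf v}_0),\ \frac{\partial d^2}{\partial v_2}(\cdot,{\bf v}_0)\Big\}=\mathcal E_2,$$ where $\mathcal E_2$ is the ring of germs at the origin of real functions (smooth, or equivalently here analytic) in $(x,y)$. *)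

theory Defs
  imports
    "HOL-Analysis.Analysis"
    "HOL-Library.Extended_Nat"
    "HOL-Algebra.Embedded_Algebras"
    "HOL-Algebra.QuotRing"
begin

section \<open>Minkowski 3-space\<close>

text \<open>Minkowski 3-space is \<^typ>\<open>real^3\<close>, the coordinates with index 0, 1, 2 being the components
  \<open>$1\<close>, \<open>$2\<close>, \<open>$3\<close>. In particular the timelike coordinate is \<open>$3\<close>.\<close>

definition lorentz :: "real^3 \<Rightarrow> real^3 \<Rightarrow> real" where
  "lorentz u v = u$1 * v$1 + u$2 * v$2 - u$3 * v$3"

definition lorentz_cross :: "real^3 \<Rightarrow> real^3 \<Rightarrow> real^3" where
  "lorentz_cross u v = vector [cross3 u v $ 1, cross3 u v $ 2, - (cross3 u v $ 3)]"

lemma lorentz_cross_det: "lorentz (lorentz_cross u v) w = det (vector [u, v, w])"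
  by (simp add: lorentz_def lorentz_cross_def cross3_simps)

lemma lorentz_cross_unique:
  assumes "\<And>w. lorentz n w = det (vector [u, v, w])"
  shows "n = lorentz_cross u v"
proof -
  have "lorentz n (axis i 1) = lorentz (lorentz_cross u v) (axis i 1)" for i
    by (simp add: assms lorentz_cross_det)
  from this[of 1] this[of 2] this[of 3] show ?thesis
    by (simp add: lorentz_def axis_def vec_eq_iff forall_3)
qed


section \<open>Regularity of functions of two variables\<close>

definition pd :: "(real \<times> real \<Rightarrow> 'a::real_normed_vector) \<Rightarrow> real \<times> real \<Rightarrow> real \<times> real \<Rightarrow> 'a" where
  "pd f h z = frechet_derivative f (at z) h"

abbreviation pd1 :: "(real \<times> real \<Rightarrow> 'a::real_normed_vector) \<Rightarrow> real \<times> real \<Rightarrow> 'a" where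
  "pd1 f \<equiv> pd f (1, 0)"

abbreviation pd2 :: "(real \<times> real \<Rightarrow> 'a::real_normed_vector) \<Rightarrow> real \<times> real \<Rightarrow> 'a" where
  "pd2 f \<equiv> pd f (0, 1)"

definition real_analytic_at :: "(real \<times> real \<Rightarrow> real) \<Rightarrow> real \<times> real \<Rightarrow> bool" where
  "real_analytic_at f q \<longleftrightarrow>
     (\<exists>(c :: nat \<Rightarrow> nat \<Rightarrow> real) r. r > 0 \<and>
        (\<forall>u v. \<bar>u - fst q\<bar> < r \<and> \<bar>v - snd q\<bar> < r \<longrightarrow>
           ((\<lambda>(i, j). c i j * (u - fst q) ^ i * (v - snd q) ^ j) has_sum f (u, v)) UNIV))"

primrec Ck_on :: "nat \<Rightarrow> 'a::real_normed_vector set \<Rightarrow> ('a \<Rightarrow> 'b::real_normed_vector) \<Rightarrow> bool" where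
  "Ck_on 0 S f \<longleftrightarrow> continuous_on S f"
| "Ck_on (Suc k) S f \<longleftrightarrow>
     (\<forall>x\<in>S. f differentiable (at x)) \<and> (\<forall>v. Ck_on k S (\<lambda>x. frechet_derivative f (at x) v))"

definition smooth_at :: "('a::real_normed_vector \<Rightarrow> 'b::real_normed_vector) \<Rightarrow> 'a \<Rightarrow> bool" where
  "smooth_at f p \<longleftrightarrow> (\<exists>U. open U \<and> p \<in> U \<and> (\<forall>k. Ck_on k U f))"

definition holomorphic2_at :: "(complex \<times> complex \<Rightarrow> complex) \<Rightarrow> complex \<times> complex \<Rightarrow> bool" where
  "holomorphic2_at f q \<longleftrightarrow>
     (\<exists>U. open U \<and> q \<in> U \<and>
        (\<forall>z\<in>U. \<exists>a b. (f has_derivative (\<lambda>h. a * fst h + b * snd h)) (at z)))"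


section \<open>Germs and the multiplicity of a pair of analytic germs\<close>

definition germ :: "'a::topological_space \<Rightarrow> ('a \<Rightarrow> 'b) \<Rightarrow> ('a \<Rightarrow> 'b) set" where
  "germ q f = {g. eventually (\<lambda>z. g z = f z) (nhds q)}"

definition hol_germs ::
  "complex \<times> complex \<Rightarrow> (complex \<times> complex \<Rightarrow> complex) set ring" where
  "hol_germs q =
     \<lparr> carrier = germ q ` {f. holomorphic2_at f q},
       mult = (\<lambda>A B. \<Union>f\<in>A. \<Union>g\<in>B. germ q (\<lambda>z. f z * g z)),
       one = germ q (\<lambda>_. 1),
       zero = germ q (\<lambda>_. 0),
       add = (\<lambda>A B. \<Union>f\<in>A. \<Union>g\<in>B. germ q (\<lambda>z. f z + g z)) \<rparr>"

definition complex_point :: "real \<times> real \<Rightarrow> complex \<times> complex" where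
  "complex_point z = (of_real (fst z), of_real (snd z))"

text \<open>For \<open>h\<close> real analytic at \<open>q\<close>, all holomorphic extensions of \<open>h\<close> have the same germ,
  and the set of these extensions is that germ.\<close>

definition complexification ::
  "real \<times> real \<Rightarrow> (real \<times> real \<Rightarrow> real) \<Rightarrow> (complex \<times> complex \<Rightarrow> complex) set" where
  "complexification q h =
     {H. holomorphic2_at H (complex_point q) \<and>
         eventually (\<lambda>z. H (complex_point z) = of_real (h z)) (nhds q)}"

definition local_algebra ::
  "real \<times> real \<Rightarrow> (real \<times> real \<Rightarrow> real) \<Rightarrow> (real \<times> real \<Rightarrow> real)
     \<Rightarrow> (complex \<times> complex \<Rightarrow> complex) set set ring" where
  "local_algebra q h k =
     hol_germs (complex_point q) Quot
       (genideal (hol_germs (complex_point q)) {complexification q h, complexification q k})"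

text \<open>The image of the field of complex numbers in the local algebra.\<close>

definition local_algebra_consts ::
  "real \<times> real \<Rightarrow> (real \<times> real \<Rightarrow> real) \<Rightarrow> (real \<times> real \<Rightarrow> real)
     \<Rightarrow> (complex \<times> complex \<Rightarrow> complex) set set set" where
  "local_algebra_consts q h k =
     (\<lambda>c. a_r_coset (hol_germs (complex_point q))
            (genideal (hol_germs (complex_point q)) {complexification q h, complexification q k})
            (germ (complex_point q) (\<lambda>_. c))) ` UNIV"

definition multiplicity_at ::
  "real \<times> real \<Rightarrow> (real \<times> real \<Rightarrow> real) \<Rightarrow> (real \<times> real \<Rightarrow> real) \<Rightarrow> enat" where
  "multiplicity_at q h k =
     (let is_dim = (\<lambda>n. ring.dimension (local_algebra q h k) n (local_algebra_consts q h k)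
                          (carrier (local_algebra q h k)))
      in if \<exists>n. is_dim n then enat (THE n. is_dim n) else \<infinity>)"


section \<open>Regular analytic surfaces and umbilic points\<close>

definition analytic_parametrisation ::
  "(real^3) set \<Rightarrow> (real \<times> real) set \<Rightarrow> (real \<times> real \<Rightarrow> real^3) \<Rightarrow> bool" where
  "analytic_parametrisation M U x \<longleftrightarrow>
     open U \<and>
     (\<forall>z\<in>U. \<forall>i. real_analytic_at (\<lambda>w. x w $ i) z) \<and>
     (\<forall>z\<in>U. inj (frechet_derivative x (at z))) \<and>
     openin (top_of_set M) (x ` U) \<and>
     (\<exists>y. homeomorphism U (x ` U) x y)"

definition regular_analytic_surface :: "(real^3) set \<Rightarrow> bool" where
  "regular_analytic_surface M \<longleftrightarrow>
     (\<forall>p\<in>M. \<exists>U x. analytic_parametrisation M U x \<and> p \<in> x ` U)"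

context
  fixes x :: "real \<times> real \<Rightarrow> real^3"
begin

definition ff_E :: "real \<times> real \<Rightarrow> real" where
  "ff_E z = lorentz (pd1 x z) (pd1 x z)"

definition ff_F :: "real \<times> real \<Rightarrow> real" where
  "ff_F z = lorentz (pd1 x z) (pd2 x z)"

definition ff_G :: "real \<times> real \<Rightarrow> real" where
  "ff_G z = lorentz (pd2 x z) (pd2 x z)"

definition sf_l :: "real \<times> real \<Rightarrow> real" where
  "sf_l z = lorentz (lorentz_cross (pd1 x z) (pd2 x z)) (pd1 (pd1 x) z)"

definition sf_m :: "real \<times> real \<Rightarrow> real" where
  "sf_m z = lorentz (lorentz_cross (pd1 x z) (pd2 x z)) (pd2 (pd1 x) z)"

definition sf_n :: "real \<times> real \<Rightarrow> real" where
  "sf_n z = lorentz (lorentz_cross (pd1 x z) (pd2 x z)) (pd2 (pd2 x) z)"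

definition coeff_a :: "real \<times> real \<Rightarrow> real" where
  "coeff_a z = ff_F z * sf_n z - ff_G z * sf_m z"

definition coeff_b :: "real \<times> real \<Rightarrow> real" where
  "coeff_b z = ff_E z * sf_n z - ff_G z * sf_l z"

definition coeff_c :: "real \<times> real \<Rightarrow> real" where
  "coeff_c z = ff_E z * sf_m z - ff_F z * sf_l z"

definition umbilic :: "real \<times> real \<Rightarrow> bool" where
  "umbilic q \<longleftrightarrow> coeff_a q = 0 \<and> coeff_b q = 0 \<and> coeff_c q = 0"

text \<open>The clauses below are consistent where they overlap: since \<open>E a - F b + G c = 0\<close>
  (\<open>coeff_syzygy\<close>), each pair of germs occurring in an applicable clause generates the ideal of
  all three. At least one clause applies, because the pseudo-scalar product has no totally
  isotropic plane.\<close>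

definition umbilic_multiplicity :: "real \<times> real \<Rightarrow> enat" where
  "umbilic_multiplicity q =
     (THE m. (ff_E q \<noteq> 0 \<longrightarrow> m = multiplicity_at q coeff_b coeff_c) \<and>
             (ff_F q \<noteq> 0 \<longrightarrow> m = multiplicity_at q coeff_a coeff_c) \<and>
             (ff_G q \<noteq> 0 \<longrightarrow> m = multiplicity_at q coeff_a coeff_b))"

lemma coeff_syzygy: "ff_E z * coeff_a z - ff_F z * coeff_b z + ff_G z * coeff_c z = 0"
  by (simp add: coeff_a_def coeff_b_def coeff_c_def algebra_simps)

end


section \<open>Distance squared functions, their singularities and versality\<close>

definition dist_sq :: "real^3 \<Rightarrow> real^3 \<Rightarrow> real" where
  "dist_sq p v = lorentz (p - v) (p - v)"

text \<open>The family of distance squared functions in the coordinates on \<open>M\<close> centred at \<open>x q\<close>.\<close>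

definition dist_sq_family ::
  "(real \<times> real \<Rightarrow> real^3) \<Rightarrow> real \<times> real \<Rightarrow> real \<times> real \<Rightarrow> real^3 \<Rightarrow> real" where
  "dist_sq_family x q z v = dist_sq (x (q + z)) v"

definition diffeo_germ_at_0 :: "(real \<times> real \<Rightarrow> real \<times> real) \<Rightarrow> bool" where
  "diffeo_germ_at_0 \<phi> \<longleftrightarrow>
     \<phi> 0 = 0 \<and> smooth_at \<phi> 0 \<and>
     (\<exists>\<psi>. \<psi> 0 = 0 \<and> smooth_at \<psi> 0 \<and>
          eventually (\<lambda>z. \<psi> (\<phi> z) = z) (nhds 0) \<and> eventually (\<lambda>z. \<phi> (\<psi> z) = z) (nhds 0))"

definition R_equivalent :: "(real \<times> real \<Rightarrow> real) \<Rightarrow> (real \<times> real \<Rightarrow> real) \<Rightarrow> bool" where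
  "R_equivalent f g \<longleftrightarrow>
     (\<exists>\<phi>. diffeo_germ_at_0 \<phi> \<and> eventually (\<lambda>z. f (\<phi> z) = g z) (nhds 0))"

definition D4_plus :: "(real \<times> real \<Rightarrow> real) \<Rightarrow> bool" where
  "D4_plus f \<longleftrightarrow> R_equivalent (\<lambda>z. f z - f 0) (\<lambda>(s, t). s ^ 2 * t + t ^ 3)"

definition D4_minus :: "(real \<times> real \<Rightarrow> real) \<Rightarrow> bool" where
  "D4_minus f \<longleftrightarrow> R_equivalent (\<lambda>z. f z - f 0) (\<lambda>(s, t). s ^ 2 * t - t ^ 3)"

definition smooth_germs :: "(real \<times> real \<Rightarrow> real) set set" where
  "smooth_germs = germ 0 ` {f. smooth_at f 0}"

text \<open>The deformation \<open>\<Phi> z v\<close> has \<open>z\<close> as variable and \<open>v\<close> as parameter. The left-hand side is the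
  sum of the ideal generated by the two partial derivatives of \<open>\<Phi> \<cdot> v0\<close> and of the real span of 1
  and of the three parameter derivatives.\<close>

definition Rplus_versal :: "(real \<times> real \<Rightarrow> real^3 \<Rightarrow> real) \<Rightarrow> real^3 \<Rightarrow> bool" where
  "Rplus_versal \<Phi> v0 \<longleftrightarrow>
     {germ 0 (\<lambda>z. \<alpha> z * pd1 (\<lambda>w. \<Phi> w v0) z + \<beta> z * pd2 (\<lambda>w. \<Phi> w v0) z
                + (c + (\<Sum>i\<in>UNIV. d i * frechet_derivative (\<Phi> z) (at v0) (axis i 1))))
        | \<alpha> \<beta> c (d :: 3 \<Rightarrow> real). smooth_at \<alpha> 0 \<and> smooth_at \<beta> 0}
     = smooth_germs"

end

theory Submission
  imports Defs "HOL-Complex_Analysis.Conformal_Mappings"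
begin

text \<open>Both sides of the equivalence amount to the non-vanishing of the same number. Let
  \<open>f(z) = \<langle>x(z) - v0, x(z) - v0\<rangle>\<close>, and let \<open>N\<close> be the cross product of the two tangent vectors at \<open>q\<close>. At a
  D4 singularity the first and second derivatives of \<open>f\<close> vanish. The first derivatives place \<open>x(q) - v0\<close> on
  the normal line, say \<open>x(q) - v0 = \<rho> N\<close>; the second ones give \<open>\<rho> (l, m, n) = - (E, F, G)\<close>, and \<open>\<rho>\<close> is
  not zero because the tangent plane is not totally isotropic (\<open>D4_point_data\<close>). The number in
  question is the determinant \<open>\<Delta>\<close> of the rows \<open>(E, F, G)\<close>, \<open>(A, B, C)\<close>, \<open>(B, C, D)\<close>, where \<open>A\<close>, \<open>B\<close>, \<open>C\<close>, \<open>D\<close>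
  are the third derivatives of \<open>f\<close> at \<open>q\<close> (\<open>D4_discriminant\<close>).

  Multiplicity. Differentiating the second fundamental form requires the derivative of the normal,
  which at an umbilic point is \<open>1/\<rho>\<close> times the derivative of \<open>x\<close>, up to a normal component
  (\<open>shape_operator\<close>). It follows that the derivatives of the coefficients \<open>a\<close>, \<open>b\<close>, \<open>c\<close> are minors of third
  derivatives of \<open>f\<close> against \<open>E\<close>, \<open>F\<close>, \<open>G\<close>, and that the Jacobian determinants of \<open>(b, c)\<close>, \<open>(a, c)\<close>, \<open>(a, b)\<close>
  are \<open>\<Delta>\<close> times \<open>E\<close>, \<open>F\<close>, \<open>G\<close>, up to a common nonzero factor (\<open>multiplicity_iff_discriminant\<close>). Two
  germs that vanish at a point have multiplicity one exactly if they generate the maximal ideal, and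
  this is the case exactly if their Jacobian determinant is not zero (\<open>multiplicity_one_iff_jacobian\<close>).

  Versality. The normal form of a D4 singularity shows that the partial derivatives of \<open>f\<close> generate
  an ideal that contains the cube of the maximal ideal (\<open>D4_jacobian_ideal_contains_cubic\<close>), so
  versality can be tested on 2-jets. The constants and the parameter derivatives provide all 1-jets
  and, in addition, the quadratic form \<open>(l, m, n)\<close> of the height function along \<open>N\<close>, a multiple of
  \<open>(E, F, G)\<close>; the partial derivatives provide the quadratic forms \<open>(A, B, C)\<close> and \<open>(B, C, D)\<close>. The family is
  versal if and only if these three forms are linearly independent (\<open>versal_iff_discriminant\<close>).

  The analytic preliminaries are the calculus of holomorphic functions of two variables, developed
  from Osgood's lemma and Cauchy's formula, by which real analytic functions are complexified, and
  Taylor expansion for smooth germs by Hadamard's lemma.\<close>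

section \<open>Circle integrals with a parameter\<close>

text \<open>Both lemmas rewrite the contour integral as an integral over the unit interval, where the
  standard results on parameter integrals apply.\<close>

lemma circle_integral_continuous_on:
  fixes g :: "'a::topological_space \<Rightarrow> complex \<Rightarrow> complex"
  assumes r: "r > 0" and g: "continuous_on (P \<times> sphere c r) (\<lambda>(p, u). g p u)"
  shows "continuous_on P (\<lambda>p. contour_integral (circlepath c r) (g p))"
proof -
  have "continuous_on (P \<times> cbox 0 1)
      (\<lambda>(p, t). g p (circlepath c r t) * (2 * pi * \<i> * r * exp (2 * of_real pi * \<i> * of_real t)))"
    unfolding split_beta
  proof (intro continuous_intros)
    show "continuous_on (P \<times> cbox 0 1) (\<lambda>x. g (fst x) (circlepath c r (snd x)))"
      by (rule continuous_on_compose2[OF g, where f = "\<lambda>x. (fst x, circlepath c r (snd x))", simplified])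
         (use r in \<open>auto simp: circlepath dist_norm norm_mult intro!: continuous_intros\<close>)
  qed
  from integral_continuous_on_param[OF this] show ?thesis
    by (simp add: contour_integral_integral vector_derivative_circlepath)
qed

lemma circle_integral_has_field_derivative:
  fixes g g' :: "complex \<Rightarrow> complex \<Rightarrow> complex"
  assumes r: "r > 0" and S: "open S" "convex S" "z \<in> S"
    and d: "\<And>z u. z \<in> S \<Longrightarrow> u \<in> sphere c r \<Longrightarrow> ((\<lambda>z. g z u) has_field_derivative g' z u) (at z)"
    and g: "\<And>z. z \<in> S \<Longrightarrow> continuous_on (sphere c r) (g z)"
    and g': "continuous_on (S \<times> sphere c r) (\<lambda>(p, u). g' p u)"
  shows "((\<lambda>z. contour_integral (circlepath c r) (g z)) has_field_derivative
           contour_integral (circlepath c r) (g' z)) (at z)"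
proof -
  let ?e = "\<lambda>t. 2 * pi * \<i> * r * exp (2 * of_real pi * \<i> * of_real t)"
  have in_sphere: "circlepath c r t \<in> sphere c r" for t
    using r by (auto simp: circlepath dist_norm norm_mult)
  have "((\<lambda>z. integral (cbox 0 1) (\<lambda>t. g z (circlepath c r t) * ?e t)) has_field_derivative
      integral (cbox 0 1) (\<lambda>t. g' z (circlepath c r t) * ?e t)) (at z within S)"
  proof (rule leibniz_rule_field_derivative[OF _ _ _ S(3,2)])
    fix w and t :: real assume "w \<in> S"
    then show "((\<lambda>z. g z (circlepath c r t) * ?e t) has_field_derivative
        g' w (circlepath c r t) * ?e t) (at w within S)"
      using d[OF _ in_sphere] by (auto intro!: DERIV_cmult_right intro: has_field_derivative_at_within)
  next
    fix w assume w: "w \<in> S"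
    have "continuous_on (cbox 0 1) (\<lambda>t. g w (circlepath c r t) * ?e t)"
      by (intro continuous_intros continuous_on_compose2[OF g[OF w], of _ "circlepath c r"])
         (use in_sphere in \<open>auto simp: circlepath intro!: continuous_intros\<close>)
    then show "(\<lambda>t. g w (circlepath c r t) * ?e t) integrable_on cbox 0 1"
      by (rule integrable_continuous)
  next
    show "continuous_on (S \<times> cbox 0 1) (\<lambda>(z, t). g' z (circlepath c r t) * ?e t)"
      unfolding split_beta
    proof (intro continuous_intros)
      show "continuous_on (S \<times> cbox 0 1) (\<lambda>x. g' (fst x) (circlepath c r (snd x)))"
        by (rule continuous_on_compose2[OF g', where f = "\<lambda>x. (fst x, circlepath c r (snd x))", simplified])
           (use r in \<open>auto simp: circlepath dist_norm norm_mult intro!: continuous_intros\<close>)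
    qed
  qed
  then show ?thesis
    unfolding contour_integral_integral vector_derivative_circlepath at_within_open[OF S(3,1)]
    by simp
qed

section \<open>Holomorphic functions of two variables\<close>

text \<open>The predicate \<open>holomorphic2_at\<close> hides an open set on which the function is complex
  differentiable; proofs need that set.\<close>

definition hol2_on :: "(complex \<times> complex) set \<Rightarrow> (complex \<times> complex \<Rightarrow> complex) \<Rightarrow> bool" where
  "hol2_on U f \<longleftrightarrow> (\<forall>z\<in>U. \<exists>a b. (f has_derivative (\<lambda>h. a * fst h + b * snd h)) (at z))"

definition cd1 :: "(complex \<times> complex \<Rightarrow> complex) \<Rightarrow> complex \<times> complex \<Rightarrow> complex" where
  "cd1 f z = deriv (\<lambda>w. f (w, snd z)) (fst z)"

definition cd2 :: "(complex \<times> complex \<Rightarrow> complex) \<Rightarrow> complex \<times> complex \<Rightarrow> complex" where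
  "cd2 f z = deriv (\<lambda>w. f (fst z, w)) (snd z)"

lemma holomorphic2_at_iff: "holomorphic2_at f q \<longleftrightarrow> (\<exists>U. open U \<and> q \<in> U \<and> hol2_on U f)"
  by (simp add: holomorphic2_at_def hol2_on_def)

lemma hol2_on_subset: "hol2_on U f \<Longrightarrow> V \<subseteq> U \<Longrightarrow> hol2_on V f"
  by (auto simp: hol2_on_def)

lemma partials_of_has_derivative:
  assumes "(f has_derivative (\<lambda>h. a * fst h + b * snd h)) (at (z :: complex \<times> complex))"
  shows "((\<lambda>w. f (w, snd z)) has_field_derivative a) (at (fst z))"
    and "((\<lambda>w. f (fst z, w)) has_field_derivative b) (at (snd z))"
proof -
  have "((\<lambda>w. f (w, snd z)) has_derivative (\<lambda>h. a * fst (h, 0::complex) + b * snd (h, 0::complex))) (at (fst z))"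
    by (rule has_derivative_compose[where f = "\<lambda>w. (w, snd z)" and g = f])
       (use assms in \<open>auto intro!: derivative_eq_intros\<close>)
  then show "((\<lambda>w. f (w, snd z)) has_field_derivative a) (at (fst z))"
    by (simp add: has_field_derivative_def)
  have "((\<lambda>w. f (fst z, w)) has_derivative (\<lambda>h. a * fst (0::complex, h) + b * snd (0::complex, h))) (at (snd z))"
    by (rule has_derivative_compose[where f = "\<lambda>w. (fst z, w)" and g = f])
       (use assms in \<open>auto intro!: derivative_eq_intros\<close>)
  then show "((\<lambda>w. f (fst z, w)) has_field_derivative b) (at (snd z))"
    by (simp add: has_field_derivative_def)
qed

lemma hol2_on_has_derivative:
  assumes "hol2_on U f" "z \<in> U"
  shows "(f has_derivative (\<lambda>h. cd1 f z * fst h + cd2 f z * snd h)) (at z)"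
proof -
  obtain a b where ab: "(f has_derivative (\<lambda>h. a * fst h + b * snd h)) (at z)"
    using assms by (auto simp: hol2_on_def)
  moreover have "cd1 f z = a" "cd2 f z = b"
    using partials_of_has_derivative[OF ab] by (auto simp: cd1_def cd2_def DERIV_imp_deriv)
  ultimately show ?thesis by simp
qed

lemma hol2_on_partials:
  assumes "hol2_on U f" "(z, w) \<in> U"
  shows "((\<lambda>z. f (z, w)) has_field_derivative cd1 f (z, w)) (at z)"
    and "((\<lambda>w. f (z, w)) has_field_derivative cd2 f (z, w)) (at w)"
  using partials_of_has_derivative[OF hol2_on_has_derivative[OF assms]] by auto

lemma hol2_on_imp_continuous_on: "hol2_on U f \<Longrightarrow> continuous_on U f"
  by (meson continuous_at_imp_continuous_on has_derivative_continuous hol2_on_def)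

lemma hol2_on_holomorphic:
  assumes "hol2_on U f"
  shows "(\<And>z. z \<in> S \<Longrightarrow> (z, w) \<in> U) \<Longrightarrow> (\<lambda>z. f (z, w)) holomorphic_on S"
    and "(\<And>w. w \<in> S \<Longrightarrow> (z, w) \<in> U) \<Longrightarrow> (\<lambda>w. f (z, w)) holomorphic_on S"
  using hol2_on_partials[OF assms]
  by (meson field_differentiable_at_within field_differentiable_def holomorphic_onI)+

lemma hol2_on_cong:
  assumes "open U" "\<And>z. z \<in> U \<Longrightarrow> f z = g z" "hol2_on U f"
  shows "hol2_on U g"
  unfolding hol2_on_def
proof
  fix z assume z: "z \<in> U"
  obtain a b where "(f has_derivative (\<lambda>h. a * fst h + b * snd h)) (at z)"
    using assms(3) z by (auto simp: hol2_on_def)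
  then show "\<exists>a b. (g has_derivative (\<lambda>h. a * fst h + b * snd h)) (at z)"
    by (blast intro: has_derivative_transform_within_open[where f = f, OF _ assms(1) z assms(2)])
qed

text \<open>Cauchy's formula expresses the derivative in one variable by an integral of the function itself
  over a fixed circle, so joint continuity of the function is inherited by the derivative.\<close>

lemma cd2_continuous_on:
  assumes s: "s > 0"
    and f: "continuous_on (S \<times> cball b s) f"
    and h: "\<And>z. z \<in> S \<Longrightarrow> (\<lambda>w. f (z, w)) holomorphic_on ball b s"
  shows "continuous_on (S \<times> ball b s) (cd2 f)"
proof -
  have eq: "cd2 f p = 1 / (2 * of_real pi * \<i>) *
      contour_integral (circlepath b s) (\<lambda>u. f (fst p, u) / (u - snd p)^2)"
    if p: "p \<in> S \<times> ball b s" for p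
    unfolding cd2_def
  proof (rule DERIV_imp_deriv, rule Cauchy_derivative_integral_circlepath(2))
    show "continuous_on (cball b s) (\<lambda>w. f (fst p, w))"
      by (rule continuous_on_compose2[OF f]) (use p in \<open>auto intro!: continuous_intros\<close>)
  qed (use p h in auto)
  have "continuous_on (S \<times> ball b s) (\<lambda>p. 1 / (2 * of_real pi * \<i>) *
      contour_integral (circlepath b s) (\<lambda>u. f (fst p, u) / (u - snd p)^2))"
    by (intro continuous_on_mult continuous_on_const circle_integral_continuous_on s)
       (auto simp: split_beta intro!: continuous_intros continuous_on_compose2[OF f])
  then show ?thesis using eq by (simp cong: continuous_on_cong)
qed

text \<open>Osgood's lemma. A map with two partial derivatives, one of them continuous, is Frechet
  differentiable, and the continuity of a partial derivative is a consequence of Cauchy's formula.\<close>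

lemma hol2_on_osgood:
  assumes S: "open S" "open T"
    and f: "continuous_on (S \<times> T) f"
    and h1: "\<And>w. w \<in> T \<Longrightarrow> (\<lambda>z. f (z, w)) holomorphic_on S"
    and h2: "\<And>z. z \<in> S \<Longrightarrow> (\<lambda>w. f (z, w)) holomorphic_on T"
  shows "hol2_on (S \<times> T) f"
  unfolding hol2_on_def
proof safe
  fix z w assume zw: "z \<in> S" "w \<in> T"
  obtain s where s: "s > 0" "cball w s \<subseteq> T" using S zw open_contains_cball by blast
  have cont: "continuous_on (S \<times> ball w s) (cd2 f)"
    by (rule cd2_continuous_on[OF s(1) continuous_on_subset[OF f] holomorphic_on_subset[OF h2]])
       (use s in \<open>auto intro: ball_subset_cball[THEN subsetD]\<close>)
  have "((\<lambda>(x, y). f (x, y)) has_derivative (\<lambda>(tx, ty). deriv (\<lambda>x. f (x, w)) z * tx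
       + blinfun_apply (blinfun_mult_right (cd2 f (z, w))) ty)) (at (z, w) within S \<times> ball w s)"
  proof (rule has_derivative_partialsI)
    show "((\<lambda>x. f (x, w)) has_derivative (*) (deriv (\<lambda>x. f (x, w)) z)) (at z within S)"
      using holomorphic_derivI[OF h1[OF zw(2)] S(1) zw(1)]
      by (auto simp: has_field_derivative_def intro: has_derivative_at_withinI)
    fix x y assume xy: "x \<in> S" "y \<in> ball w s"
    then have y: "y \<in> T" using s by auto
    show "((\<lambda>y. f (x, y)) has_derivative blinfun_apply (blinfun_mult_right (cd2 f (x, y))))
        (at y within ball w s)"
      using holomorphic_derivI[OF h2[OF xy(1)] S(2) y]
      by (auto simp: has_field_derivative_def cd2_def intro: has_derivative_at_withinI)
  next
    have "continuous_on (S \<times> ball w s) (\<lambda>p. blinfun_mult_right (cd2 f p))"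
      by (intro bounded_linear.continuous_on[OF bounded_linear_blinfun_mult_right] cont)
    then show "continuous (at (z, w) within S \<times> ball w s) (\<lambda>(x, y). blinfun_mult_right (cd2 f (x, y)))"
      using zw s by (simp add: continuous_on_eq_continuous_within case_prod_eta[of "\<lambda>p. blinfun_mult_right (cd2 f p)"])
  qed (use s in auto)
  moreover have "at (z, w) within S \<times> ball w s = at (z, w)"
    by (rule at_within_open) (use zw s S in \<open>auto intro: open_Times\<close>)
  ultimately have "(f has_derivative (\<lambda>h. deriv (\<lambda>x. f (x, w)) z * fst h + cd2 f (z, w) * snd h)) (at (z, w))"
    by (simp add: case_prod_unfold)
  then show "\<exists>a b. (f has_derivative (\<lambda>h. a * fst h + b * snd h)) (at (z, w))" by blast
qed

text \<open>The kernel \<open>k\<close> is \<open>1 / (u - z)^2\<close> when the integral represents a partial derivative, and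
  \<open>1 / ((u - a) * (u - z))\<close> when it represents a difference quotient. The second statement, that the
  derivative in the other variable passes under the integral, yields the symmetry of the mixed
  partial derivatives.\<close>

lemma hol2_on_circle_integral:
  assumes r: "r > 0" and S: "open S" "convex S" and T: "open T" "convex T"
    and f: "hol2_on V f" "sphere c r \<times> T \<subseteq> V" and V: "open V"
    and k: "continuous_on (S \<times> sphere c r) (\<lambda>(z, u). k z u)"
    and k': "continuous_on (S \<times> sphere c r) (\<lambda>(z, u). k' z u)"
    and dk: "\<And>z u. z \<in> S \<Longrightarrow> u \<in> sphere c r \<Longrightarrow> ((\<lambda>z. k z u) has_field_derivative k' z u) (at z)"
  shows "hol2_on (S \<times> T) (\<lambda>p. contour_integral (circlepath c r) (\<lambda>u. f (u, snd p) * k (fst p) u))"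
    and "\<And>z w. z \<in> S \<Longrightarrow> w \<in> T \<Longrightarrow>
      ((\<lambda>w. contour_integral (circlepath c r) (\<lambda>u. f (u, w) * k z u)) has_field_derivative
         contour_integral (circlepath c r) (\<lambda>u. cd2 f (u, w) * k z u)) (at w)"
proof -
  have fc: "continuous_on V f" by (rule hol2_on_imp_continuous_on[OF f(1)])
  have kz: "continuous_on (sphere c r) (k z)" if "z \<in> S" for z
    by (rule continuous_on_compose2[OF k, where f = "\<lambda>u. (z, u)", simplified])
       (use that in \<open>auto intro!: continuous_intros\<close>)
  have cd2c: "continuous_on V (cd2 f)"
  proof (rule continuous_at_imp_continuous_on, rule ballI)
    fix p assume p: "p \<in> V"
    obtain A B where AB: "open A" "open B" "p \<in> A \<times> B" "A \<times> B \<subseteq> V"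
      by (rule open_prod_elim[OF V p])
    then have "snd p \<in> B" by auto
    then obtain s where s: "s > 0" "cball (snd p) s \<subseteq> B" using AB(2) open_contains_cball by blast
    have "A \<times> cball (snd p) s \<subseteq> V" using s AB by auto
    moreover from this have "\<And>z w. z \<in> A \<Longrightarrow> w \<in> ball (snd p) s \<Longrightarrow> (z, w) \<in> V"
      by force
    ultimately have "continuous_on (A \<times> ball (snd p) s) (cd2 f)"
      by (intro cd2_continuous_on[OF s(1) continuous_on_subset[OF fc] hol2_on_holomorphic(2)[OF f(1)]])
    then show "isCont (cd2 f) p"
      using AB s by (intro continuous_on_interior) (auto simp: interior_Times interior_open mem_Times_iff)
  qed
  show d2: "((\<lambda>w. contour_integral (circlepath c r) (\<lambda>u. f (u, w) * k z u)) has_field_derivative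
         contour_integral (circlepath c r) (\<lambda>u. cd2 f (u, w) * k z u)) (at w)" if zw: "z \<in> S" "w \<in> T" for z w
  proof (rule circle_integral_has_field_derivative[OF r T zw(2)])
    fix w u assume "w \<in> T" "u \<in> sphere c r"
    then have "(u, w) \<in> V" using f by auto
    then show "((\<lambda>w. f (u, w) * k z u) has_field_derivative cd2 f (u, w) * k z u) (at w)"
      using hol2_on_partials(2)[OF f(1)] by (auto intro!: DERIV_cmult_right)
  next
    fix w assume w: "w \<in> T"
    show "continuous_on (sphere c r) (\<lambda>u. f (u, w) * k z u)"
      by (intro continuous_intros continuous_on_compose2[OF fc] kz)
         (use w f zw in \<open>auto intro!: continuous_intros\<close>)
  next
    show "continuous_on (T \<times> sphere c r) (\<lambda>(w, u). cd2 f (u, w) * k z u)"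
      unfolding split_beta
      by (intro continuous_intros continuous_on_compose2[OF cd2c] continuous_on_compose2[OF kz])
         (use f zw in \<open>auto intro!: continuous_intros\<close>)
  qed
  show "hol2_on (S \<times> T) (\<lambda>p. contour_integral (circlepath c r) (\<lambda>u. f (u, snd p) * k (fst p) u))"
  proof (rule hol2_on_osgood[OF S(1) T(1)])
    show "continuous_on (S \<times> T) (\<lambda>p. contour_integral (circlepath c r) (\<lambda>u. f (u, snd p) * k (fst p) u))"
    proof (rule circle_integral_continuous_on[OF r])
      show "continuous_on ((S \<times> T) \<times> sphere c r) (\<lambda>(p, u). f (u, snd p) * k (fst p) u)"
        unfolding split_beta
        by (intro continuous_intros continuous_on_compose2[OF fc]
              continuous_on_compose2[OF k, where f = "\<lambda>x. (fst (fst x), snd x)", simplified])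
           (use f in \<open>auto intro!: continuous_intros\<close>)
    qed
  next
    fix z assume "z \<in> S"
    then show "(\<lambda>w. contour_integral (circlepath c r) (\<lambda>u. f (u, snd (z, w)) * k (fst (z, w)) u)) holomorphic_on T"
      using d2 by (auto simp: holomorphic_on_open[OF T(1)])
  next
    fix w assume w: "w \<in> T"
    have "((\<lambda>z. contour_integral (circlepath c r) (\<lambda>u. f (u, w) * k z u)) has_field_derivative
         contour_integral (circlepath c r) (\<lambda>u. f (u, w) * k' z u)) (at z)" if z: "z \<in> S" for z
    proof (rule circle_integral_has_field_derivative[OF r S z])
      fix z u assume "z \<in> S" "u \<in> sphere c r"
      then show "((\<lambda>z. f (u, w) * k z u) has_field_derivative f (u, w) * k' z u) (at z)"
        using dk by (auto intro!: DERIV_cmult)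
    next
      fix z assume z: "z \<in> S"
      show "continuous_on (sphere c r) (\<lambda>u. f (u, w) * k z u)"
        by (intro continuous_intros continuous_on_compose2[OF fc] kz)
           (use w f z in \<open>auto intro!: continuous_intros\<close>)
    next
      show "continuous_on (S \<times> sphere c r) (\<lambda>(z, u). f (u, w) * k' z u)"
        unfolding split_beta
        by (intro continuous_intros continuous_on_compose2[OF fc] k'[unfolded split_beta])
           (use f w in \<open>auto intro!: continuous_intros\<close>)
    qed
    then show "(\<lambda>z. contour_integral (circlepath c r) (\<lambda>u. f (u, snd (z, w)) * k (fst (z, w)) u)) holomorphic_on S"
      by (auto simp: holomorphic_on_open[OF S(1)])
  qed
qed

lemma hol2_on_local:
  assumes "\<And>z. z \<in> U \<Longrightarrow> \<exists>V. z \<in> V \<and> hol2_on V f"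
  shows "hol2_on U f"
  using assms unfolding hol2_on_def by blast

lemma hol2_on_const: "hol2_on U (\<lambda>_. c)"
  unfolding hol2_on_def by (auto intro!: exI[of _ 0])

lemma hol2_on_fst: "hol2_on U fst"
  unfolding hol2_on_def by (intro ballI exI[of _ 1] exI[of _ 0]) (auto intro!: derivative_eq_intros)

lemma hol2_on_snd: "hol2_on U snd"
  unfolding hol2_on_def by (intro ballI exI[of _ 1] exI[of _ 0]) (auto intro!: derivative_eq_intros)

lemma hol2_on_add:
  assumes "hol2_on U f" "hol2_on U g" shows "hol2_on U (\<lambda>z. f z + g z)"
  unfolding hol2_on_def
proof
  fix z assume z: "z \<in> U"
  show "\<exists>a b. ((\<lambda>z. f z + g z) has_derivative (\<lambda>h. a * fst h + b * snd h)) (at z)"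
    by (rule exI[of _ "cd1 f z + cd1 g z"], rule exI[of _ "cd2 f z + cd2 g z"])
       (rule has_derivative_eq_rhs[OF has_derivative_add[OF hol2_on_has_derivative[OF assms(1) z]
          hol2_on_has_derivative[OF assms(2) z]]], auto simp: algebra_simps)
qed

lemma hol2_on_mult:
  assumes "hol2_on U f" "hol2_on U g" shows "hol2_on U (\<lambda>z. f z * g z)"
  unfolding hol2_on_def
proof
  fix z assume z: "z \<in> U"
  show "\<exists>a b. ((\<lambda>z. f z * g z) has_derivative (\<lambda>h. a * fst h + b * snd h)) (at z)"
    by (rule exI[of _ "f z * cd1 g z + cd1 f z * g z"], rule exI[of _ "f z * cd2 g z + cd2 f z * g z"])
       (rule has_derivative_eq_rhs[OF has_derivative_mult[OF hol2_on_has_derivative[OF assms(1) z]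
          hol2_on_has_derivative[OF assms(2) z]]], auto simp: algebra_simps)
qed

lemma hol2_on_sum: "(\<And>i. i \<in> I \<Longrightarrow> hol2_on U (f i)) \<Longrightarrow> hol2_on U (\<lambda>z. \<Sum>i\<in>I. f i z)"
  by (induction I rule: infinite_finite_induct) (auto intro: hol2_on_const hol2_on_add)

lemma hol2_on_power: "hol2_on U f \<Longrightarrow> hol2_on U (\<lambda>z. f z ^ n)"
  by (induction n) (auto intro: hol2_on_const hol2_on_mult)

lemma hol2_on_compose_linear:
  assumes "hol2_on U f" and L: "bounded_linear L" "\<And>h. L h = (a * fst h + b * snd h, c * fst h + d * snd h)"
  shows "hol2_on ((\<lambda>z. p + L z) -` U) (\<lambda>z. f (p + L z))"
  unfolding hol2_on_def
proof
  fix z assume z: "z \<in> (\<lambda>z. p + L z) -` U"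
  then have "(f has_derivative (\<lambda>h. cd1 f (p + L z) * fst h + cd2 f (p + L z) * snd h)) (at (p + L z))"
    using hol2_on_has_derivative[OF assms(1)] by auto
  moreover have "((\<lambda>z. p + L z) has_derivative L) (at z)"
    using has_derivative_add[OF has_derivative_const bounded_linear_imp_has_derivative[OF L(1)]] by simp
  ultimately have "((\<lambda>z. f (p + L z)) has_derivative (\<lambda>h. cd1 f (p + L z) * fst (L h) + cd2 f (p + L z) * snd (L h))) (at z)"
    by (rule has_derivative_compose[rotated])
  then show "\<exists>a b. ((\<lambda>z. f (p + L z)) has_derivative (\<lambda>h. a * fst h + b * snd h)) (at z)"
    by (intro exI[of _ "cd1 f (p + L z) * a + cd2 f (p + L z) * c"] exI[of _ "cd1 f (p + L z) * b + cd2 f (p + L z) * d"])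
       (auto elim!: has_derivative_eq_rhs simp: L algebra_simps)
qed

lemma hol2_on_swap:
  assumes "hol2_on U f" shows "hol2_on (prod.swap -` U) (\<lambda>z. f (prod.swap z))"
proof -
  have L: "bounded_linear (\<lambda>h :: complex \<times> complex. (snd h, fst h))"
    by (intro bounded_linear_Pair bounded_linear_fst bounded_linear_snd)
  have eq: "(snd h, fst h) = (0 * fst h + 1 * snd h, 1 * fst h + 0 * snd h)" for h :: "complex \<times> complex"
    by simp
  have swap: "prod.swap = (\<lambda>h :: complex \<times> complex. (snd h, fst h))" by (simp add: fun_eq_iff prod.swap_def)
  show ?thesis using hol2_on_compose_linear[OF assms L eq, of 0] by (simp add: swap)
qed

lemma hol2_on_snd_slice:
  assumes "hol2_on U f" shows "hol2_on ((\<lambda>z. (a, snd z)) -` U) (\<lambda>z. f (a, snd z))"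
proof -
  have L: "bounded_linear (\<lambda>h :: complex \<times> complex. (0 :: complex, snd h))"
    by (intro bounded_linear_Pair bounded_linear_zero bounded_linear_snd)
  have eq: "(0, snd h) = (0 * fst h + 0 * snd h, 0 * fst h + 1 * snd h)" for h :: "complex \<times> complex"
    by simp
  show ?thesis using hol2_on_compose_linear[OF assms L eq, of "(a, 0)"] by simp
qed

lemma cd2_eq_cd1_swap: "cd2 f = (\<lambda>z. cd1 (\<lambda>z. f (prod.swap z)) (prod.swap z))"
  by (rule ext) (simp add: cd1_def cd2_def)

lemma cd1_eq_circle_integral:
  assumes f: "hol2_on V f" "cball a r \<times> {w} \<subseteq> V" and z: "z \<in> ball a r"
  shows "cd1 f (z, w) = 1 / (2 * of_real pi * \<i>) * contour_integral (circlepath a r) (\<lambda>u. f (u, w) * (1 / (u - z)^2))"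
proof -
  have h: "(\<lambda>u. f (u, w)) holomorphic_on cball a r"
    using f by (intro hol2_on_holomorphic(1)[OF f(1)]) auto
  from Cauchy_derivative_integral_circlepath(2)[OF holomorphic_on_imp_continuous_on[OF h]
      holomorphic_on_subset[OF h ball_subset_cball] z]
  show ?thesis by (simp add: cd1_def DERIV_imp_deriv)
qed

lemma hol2_box:
  assumes "open U" "p \<in> U"
  obtains r where "r > 0" "cball (fst p) r \<times> cball (snd p) r \<subseteq> U"
proof -
  obtain A B where AB: "open A" "open B" "p \<in> A \<times> B" "A \<times> B \<subseteq> U"
    by (rule open_prod_elim[OF assms])
  then have "fst p \<in> A" "snd p \<in> B" by auto
  then obtain r s where "r > 0" "cball (fst p) r \<subseteq> A" "s > 0" "cball (snd p) s \<subseteq> B"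
    using AB open_contains_cball by metis
  moreover have "cball (fst p) (min r s) \<subseteq> cball (fst p) r" "cball (snd p) (min r s) \<subseteq> cball (snd p) s" by auto
  ultimately have "min r s > 0" "cball (fst p) (min r s) \<times> cball (snd p) (min r s) \<subseteq> U"
    using AB(4) Sigma_mono[of "cball (fst p) (min r s)" A "\<lambda>_. cball (snd p) (min r s)" "\<lambda>_. B"] by fastforce+
  then show ?thesis by (rule that)
qed

lemma reciprocal_kernels:
  assumes "n > 0"
  shows "continuous_on (ball a r \<times> sphere a r) (\<lambda>(z, u). c / (u - z) ^ n :: complex)"
    and "z \<in> ball a r \<Longrightarrow> u \<in> sphere a r \<Longrightarrow>
          ((\<lambda>z. 1 / (u - z) ^ n) has_field_derivative of_nat n / (u - z) ^ Suc n) (at z)"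
proof -
  show "continuous_on (ball a r \<times> sphere a r) (\<lambda>(z, u). c / (u - z) ^ n)"
    by (auto simp: split_beta intro!: continuous_intros)
  assume "z \<in> ball a r" "u \<in> sphere a r"
  then have "u \<noteq> z" by auto
  moreover have "(u - z) ^ n = (u - z) * (u - z) ^ (n - 1)"
    using assms by (cases n) auto
  ultimately show "((\<lambda>z. 1 / (u - z) ^ n) has_field_derivative of_nat n / (u - z) ^ Suc n) (at z)"
    by (auto intro!: derivative_eq_intros simp: divide_simps)
qed

text \<open>The derivative in the second variable of Cauchy's integral for \<open>cd1 f\<close> is Cauchy's integral for
  \<open>cd1 (cd2 f)\<close>.\<close>

lemma hol2_on_cd1_box:
  assumes U: "open U" "hol2_on U f" and box: "cball a r \<times> cball b s \<subseteq> U" "r > 0" "s > 0"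
  shows "hol2_on (ball a r \<times> ball b s) (cd1 f)"
    and "\<And>z w. z \<in> ball a r \<Longrightarrow> w \<in> ball b s \<Longrightarrow> ((\<lambda>w. cd1 f (z, w)) has_field_derivative
      1 / (2 * of_real pi * \<i>) * contour_integral (circlepath a r) (\<lambda>u. cd2 f (u, w) * (1 / (u - z)^2))) (at w)"
proof -
  let ?I = "\<lambda>p. 1 / (2 * of_real pi * \<i>) * contour_integral (circlepath a r) (\<lambda>u. f (u, snd p) * (1 / (u - fst p)^2))"
  have sub: "sphere a r \<times> ball b s \<subseteq> U" "ball a r \<times> ball b s \<subseteq> U"
    using box sphere_cball ball_subset_cball by blast+
  have eq: "?I p = cd1 f p" if "p \<in> ball a r \<times> ball b s" for p
    using that box cd1_eq_circle_integral[OF U(2), of a r "snd p" "fst p"] by (auto simp: subset_iff)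
  have dk: "((\<lambda>z. 1 / (u - z)^2) has_field_derivative 2 / (u - z)^3) (at z)"
    if "z \<in> ball a r" "u \<in> sphere a r" for z u
    using reciprocal_kernels(2)[of 2, OF _ that] by (simp add: eval_nat_numeral)
  have kc: "continuous_on (ball a r \<times> sphere a r) (\<lambda>(z, u). 1 / (u - z)^2)"
    "continuous_on (ball a r \<times> sphere a r) (\<lambda>(z, u). 2 / (u - z)^3)"
    by (simp_all add: reciprocal_kernels(1))
  note int = hol2_on_circle_integral[OF box(2) open_ball convex_ball open_ball convex_ball U(2) sub(1) U(1)
      kc dk]
  show "hol2_on (ball a r \<times> ball b s) (cd1 f)"
  proof (rule hol2_on_cong[OF _ eq])
    show "hol2_on (ball a r \<times> ball b s) ?I"
      by (intro hol2_on_mult hol2_on_const) (rule int(1))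
  qed (auto intro: open_Times)
  fix z w assume zw: "z \<in> ball a r" "w \<in> ball b s"
  have "((\<lambda>w. ?I (z, w)) has_field_derivative
      1 / (2 * of_real pi * \<i>) * contour_integral (circlepath a r) (\<lambda>u. cd2 f (u, w) * (1 / (u - z)^2))) (at w)"
    unfolding fst_conv snd_conv by (rule DERIV_cmult) (rule int(2)[OF _ _ zw])
  then show "((\<lambda>w. cd1 f (z, w)) has_field_derivative
      1 / (2 * of_real pi * \<i>) * contour_integral (circlepath a r) (\<lambda>u. cd2 f (u, w) * (1 / (u - z)^2))) (at w)"
    by (rule has_field_derivative_transform_within_open[OF _ open_ball zw(2)]) (use eq zw in auto)
qed

lemma hol2_on_cd1:
  assumes "open U" "hol2_on U f" shows "hol2_on U (cd1 f)"
proof (rule hol2_on_local)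
  fix p assume "p \<in> U"
  then obtain r where r: "r > 0" "cball (fst p) r \<times> cball (snd p) r \<subseteq> U" using hol2_box assms by blast
  then show "\<exists>V. p \<in> V \<and> hol2_on V (cd1 f)"
    using hol2_on_cd1_box(1)[OF assms r(2,1,1)] by (intro exI[of _ "ball (fst p) r \<times> ball (snd p) r"]) (auto simp: mem_Times_iff)
qed

lemma hol2_on_cd2:
  assumes "open U" "hol2_on U f" shows "hol2_on U (cd2 f)"
proof -
  have "open (prod.swap -` U)"
    using assms(1) by (intro open_vimage) (auto simp: prod.swap_def intro!: continuous_intros)
  from hol2_on_swap[OF hol2_on_cd1[OF this hol2_on_swap[OF assms(2)]]] show ?thesis
    by (simp add: cd2_eq_cd1_swap vimage_def)
qed

lemma cd2_cd1_commute:
  assumes "open U" "hol2_on U f" "p \<in> U" shows "cd2 (cd1 f) p = cd1 (cd2 f) p"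
proof -
  obtain r where r: "r > 0" "cball (fst p) r \<times> cball (snd p) r \<subseteq> U" using hol2_box assms by blast
  have "cd2 (cd1 f) (fst p, snd p) = cd1 (cd2 f) (fst p, snd p)"
    using DERIV_imp_deriv[OF hol2_on_cd1_box(2)[OF assms(1,2) r(2,1,1), of "fst p" "snd p"]] r
      cd1_eq_circle_integral[OF hol2_on_cd2[OF assms(1,2)], of "fst p" r "snd p" "fst p"]
    by (auto simp: cd2_def[of "cd1 f"] subset_iff)
  then show ?thesis by simp
qed

section \<open>Hadamard's lemma and the identity theorem\<close>

text \<open>Division of \<open>f (z, w) - f (a, w)\<close> by \<open>z - a\<close> in the ring of holomorphic functions. The quotient is
  written as one Cauchy integral with the kernel \<open>1 / ((u - a) * (u - z))\<close>, which is the difference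
  quotient of the Cauchy kernel; no case distinction at \<open>z = a\<close> is then necessary.\<close>

lemma hol2_divide_fst:
  assumes f: "hol2_on U f" "open U" and box: "cball a r \<times> cball b s \<subseteq> U" "r > 0" "s > 0"
  obtains g where "hol2_on (ball a r \<times> ball b s) g"
    and "\<And>z w. z \<in> ball a r \<Longrightarrow> w \<in> ball b s \<Longrightarrow> f (z, w) = f (a, w) + (z - a) * g (z, w)"
proof
  define g where "g p = 1 / (2 * of_real pi * \<i>) *
      contour_integral (circlepath a r) (\<lambda>u. f (u, snd p) * (1 / (u - a) * (1 / (u - fst p)^1)))" for p
  have sub: "sphere a r \<times> ball b s \<subseteq> U" "ball a r \<times> ball b s \<subseteq> U"
    using box sphere_cball ball_subset_cball by blast+
  have kc: "continuous_on (ball a r \<times> sphere a r) (\<lambda>(z, u). 1 / (u - a) * (1 / (u - z) ^ n))" for n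
    using box(2) by (auto simp: split_beta intro!: continuous_intros)
  have dk: "((\<lambda>z. 1 / (u - a) * (1 / (u - z)^1)) has_field_derivative 1 / (u - a) * (1 / (u - z)^2)) (at z)"
    if "z \<in> ball a r" "u \<in> sphere a r" for z u
    using DERIV_cmult[OF reciprocal_kernels(2)[of 1, OF _ that], of "1 / (u - a)"] by (simp add: eval_nat_numeral)
  show "hol2_on (ball a r \<times> ball b s) g"
    unfolding g_def
    by (intro hol2_on_mult hol2_on_const)
       (rule hol2_on_circle_integral(1)[OF box(2) open_ball convex_ball open_ball convex_ball f(1) sub(1) f(2) kc kc dk])
  fix z w assume zw: "z \<in> ball a r" "w \<in> ball b s"
  have h: "(\<lambda>u. f (u, w)) holomorphic_on cball a r"
    using box zw by (intro hol2_on_holomorphic(1)[OF f(1)]) (auto simp: subset_iff)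
  have 1: "((\<lambda>u. f (u, w) / (u - z)) has_contour_integral 2 * of_real pi * \<i> * f (z, w)) (circlepath a r)"
    by (rule Cauchy_integral_circlepath_simple[OF h]) (use zw in \<open>simp add: dist_norm norm_minus_commute\<close>)
  have 2: "((\<lambda>u. f (u, w) / (u - a)) has_contour_integral 2 * of_real pi * \<i> * f (a, w)) (circlepath a r)"
    by (rule Cauchy_integral_circlepath_simple[OF h]) (use box in simp)
  have 3: "((\<lambda>u. (1 / (2 * of_real pi * \<i>)) * (f (u, w) / (u - z) - f (u, w) / (u - a))) has_contour_integral
      (1 / (2 * of_real pi * \<i>)) * (2 * of_real pi * \<i> * f (z, w) - 2 * of_real pi * \<i> * f (a, w))) (circlepath a r)"
    by (intro has_contour_integral_lmul has_contour_integral_diff 1 2)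
  have cont: "continuous_on (path_image (circlepath a r)) (\<lambda>u. f (u, w) * (1 / (u - a) * (1 / (u - z)^1)))"
    by (intro continuous_intros continuous_on_subset[OF holomorphic_on_imp_continuous_on[OF h]])
       (use box zw in auto)
  then have "(z - a) * contour_integral (circlepath a r) (\<lambda>u. f (u, w) * (1 / (u - a) * (1 / (u - z)^1))) =
      contour_integral (circlepath a r) (\<lambda>u. (z - a) * (f (u, w) * (1 / (u - a) * (1 / (u - z)^1))))"
    by (intro contour_integral_lmul[symmetric] contour_integrable_continuous_circlepath)
  also have "\<dots> = contour_integral (circlepath a r) (\<lambda>u. f (u, w) / (u - z) - f (u, w) / (u - a))"
  proof (rule contour_integral_cong[OF refl])
    fix u assume "u \<in> path_image (circlepath a r)"
    then have "u \<noteq> a" "u \<noteq> z" using box zw by auto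
    then show "(z - a) * (f (u, w) * (1 / (u - a) * (1 / (u - z)^1))) = f (u, w) / (u - z) - f (u, w) / (u - a)"
      by (simp add: divide_simps) (simp add: algebra_simps)
  qed
  also have "\<dots> = 2 * of_real pi * \<i> * f (z, w) - 2 * of_real pi * \<i> * f (a, w)"
    by (intro contour_integral_unique has_contour_integral_diff 1 2)
  finally have "(z - a) * g (z, w) = f (z, w) - f (a, w)"
    by (simp add: g_def field_simps)
  then show "f (z, w) = f (a, w) + (z - a) * g (z, w)" by simp
qed

text \<open>The maximal ideal of the local ring is generated by the two coordinate functions centred at \<open>p\<close>.\<close>

lemma holomorphic2_at_hadamard:
  assumes "holomorphic2_at f p"
  obtains g1 g2 where "holomorphic2_at g1 p" "holomorphic2_at g2 p"
    "eventually (\<lambda>z. f z = f p + (fst z - fst p) * g1 z + (snd z - snd p) * g2 z) (nhds p)"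
proof -
  obtain U where U: "open U" "p \<in> U" "hol2_on U f" using assms by (auto simp: holomorphic2_at_iff)
  obtain a b where p: "p = (a, b)" by (cases p)
  obtain r where r: "r > 0" "cball a r \<times> cball b r \<subseteq> U" using hol2_box[OF U(1,2)] p by auto
  obtain g1 where g1: "hol2_on (ball a r \<times> ball b r) g1"
    "\<And>z w. z \<in> ball a r \<Longrightarrow> w \<in> ball b r \<Longrightarrow> f (z, w) = f (a, w) + (z - a) * g1 (z, w)"
    using hol2_divide_fst[OF U(3,1) r(2,1,1)] by metis
  have U': "open (prod.swap -` U)"
    using U(1) by (intro open_vimage) (auto simp: prod.swap_def intro!: continuous_intros)
  have r': "cball b r \<times> cball a r \<subseteq> prod.swap -` U" using r by auto
  obtain g where g: "hol2_on (ball b r \<times> ball a r) g"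
    "\<And>w z. w \<in> ball b r \<Longrightarrow> z \<in> ball a r \<Longrightarrow> f (z, w) = f (z, b) + (w - b) * g (w, z)"
    using hol2_divide_fst[OF hol2_on_swap[OF U(3)] U' r' r(1,1)] unfolding swap_simp by metis
  define g2 where "g2 z = g (snd z, a)" for z :: "complex \<times> complex"
  have "ball a r \<times> ball b r \<subseteq> (\<lambda>z. (a, snd z)) -` prod.swap -` (ball b r \<times> ball a r)" using r by auto
  from hol2_on_subset[OF hol2_on_snd_slice[OF hol2_on_swap[OF g(1)]] this]
  have "hol2_on (ball a r \<times> ball b r) g2"
    by (simp add: g2_def[abs_def])
  moreover have D: "open (ball a r \<times> ball b r)" "p \<in> ball a r \<times> ball b r" using r p by (auto intro: open_Times)
  moreover have "f z = f p + (fst z - fst p) * g1 z + (snd z - snd p) * g2 z" if "z \<in> ball a r \<times> ball b r" for z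
    using that g1(2)[of "fst z" "snd z"] g(2)[of "snd z" a] r by (auto simp: p g2_def)
  ultimately show thesis
    using that[of g1 g2] g1(1) unfolding holomorphic2_at_iff eventually_nhds by blast
qed

text \<open>A holomorphic function is determined by its values at real points: the identity theorem in one
  variable is applied first to the second variable at real values of the first, and then to the
  first variable.\<close>

lemma hol2_identity:
  assumes f: "hol2_on (ball (of_real a) r \<times> ball (of_real b) r) f" and r: "r > 0"
    and z: "\<And>s t. \<bar>s - a\<bar> < r \<Longrightarrow> \<bar>t - b\<bar> < r \<Longrightarrow> f (of_real s, of_real t) = 0"
    and p: "p \<in> ball (of_real a) r \<times> ball (of_real b) r"
  shows "f p = 0"
proof -
  have vanish: "F w = 0" if F: "F holomorphic_on ball (of_real c) r" "\<And>t. \<bar>t - c\<bar> < r \<Longrightarrow> F (of_real t) = 0"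
    and w: "w \<in> ball (of_real c) r" for F c w
  proof (rule analytic_continuation[OF F(1) open_ball connected_ball, where U = "of_real ` {t. \<bar>t - c\<bar> < r}" and \<xi> = "of_real c"])
    show "of_real ` {t. \<bar>t - c\<bar> < r} \<subseteq> ball (complex_of_real c) r"
      by (auto simp: dist_norm norm_minus_commute simp flip: of_real_diff)
    show "complex_of_real c islimpt of_real ` {t. \<bar>t - c\<bar> < r}"
      unfolding islimpt_approachable
    proof safe
      fix e :: real assume "e > 0"
      then show "\<exists>x'\<in>of_real ` {t. \<bar>t - c\<bar> < r}. x' \<noteq> complex_of_real c \<and> dist x' (complex_of_real c) < e"
        using r by (intro bexI[OF _ imageI[of "c + min e r / 2"]]) (auto simp: dist_norm min_def)
    qed
  qed (use F w r in auto)
  have 1: "f (of_real s, w) = 0" if "\<bar>s - a\<bar> < r" "w \<in> ball (of_real b) r" for s w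
    by (rule vanish[where F = "\<lambda>w. f (of_real s, w)" and c = b])
       (use that z in \<open>auto intro!: hol2_on_holomorphic(2)[OF f] simp: dist_norm norm_minus_commute simp flip: of_real_diff\<close>)
  have "f (u, w) = 0" if "u \<in> ball (of_real a) r" "w \<in> ball (of_real b) r" for u w
    by (rule vanish[where F = "\<lambda>u. f (u, w)" and c = a])
       (use that 1 in \<open>auto intro!: hol2_on_holomorphic(1)[OF f]\<close>)
  then show ?thesis using p by (cases p) auto
qed

section \<open>Complexification of real analytic functions\<close>

text \<open>The double power series of a real analytic function converges absolutely, hence uniformly on a
  complex bidisc, and its sum is holomorphic by Osgood's lemma.\<close>

lemma real_analytic_imp_complexification_exists:
  assumes "real_analytic_at f q"
  shows "\<exists>H. H \<in> complexification q f"
proof -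
  obtain c r where r: "r > 0" and sums: "\<And>u v. \<bar>u - fst q\<bar> < r \<Longrightarrow> \<bar>v - snd q\<bar> < r \<Longrightarrow>
      ((\<lambda>(i, j). c i j * (u - fst q) ^ i * (v - snd q) ^ j) has_sum f (u, v)) UNIV"
    using assms unfolding real_analytic_at_def by blast
  define \<rho> where "\<rho> = r / 2"
  have \<rho>: "\<rho> > 0" "\<rho> < r" using r by (auto simp: \<rho>_def)
  let ?a = "complex_of_real (fst q)" and ?b = "complex_of_real (snd q)"
  let ?D = "cball ?a \<rho> \<times> cball ?b \<rho>"
  define t where "t ij z = complex_of_real (c (fst ij) (snd ij)) * (fst z - ?a) ^ fst ij * (snd z - ?b) ^ snd ij" for ij z
  define H where "H z = infsum (\<lambda>ij. t ij z) UNIV" for z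
  define M where "M ij = \<bar>c (fst ij) (snd ij)\<bar> * \<rho> ^ fst ij * \<rho> ^ snd ij" for ij :: "nat \<times> nat"
  have "(\<lambda>(i, j). c i j * \<rho> ^ i * \<rho> ^ j) summable_on UNIV"
    using sums[of "fst q + \<rho>" "snd q + \<rho>"] \<rho> by (auto simp: summable_on_def)
  then have M: "M summable_on UNIV"
    using \<rho> by (subst (asm) summable_on_iff_abs_summable_on_real)
      (auto simp: M_def split_beta abs_mult power_abs cong: summable_on_cong)
  have ulim: "uniform_limit ?D (\<lambda>X z. \<Sum>ij\<in>X. t ij z) H (finite_subsets_at_top UNIV)"
    unfolding H_def
  proof (rule Weierstrass_m_test_general[OF _ M])
    fix ij z assume "z \<in> ?D"
    then have "cmod (fst z - ?a) ^ fst ij \<le> \<rho> ^ fst ij" "cmod (snd z - ?b) ^ snd ij \<le> \<rho> ^ snd ij"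
      by (auto intro!: power_mono simp: dist_norm norm_minus_commute)
    then show "norm (t ij z) \<le> M ij"
      unfolding t_def M_def norm_mult norm_power using \<rho> by (intro mult_mono) auto
  qed
  have thol: "hol2_on UNIV (\<lambda>z. \<Sum>ij\<in>X. t ij z)" for X
    unfolding t_def diff_conv_add_uminus
    by (intro hol2_on_sum hol2_on_mult hol2_on_const hol2_on_power hol2_on_add hol2_on_fst hol2_on_snd)
  have ne: "finite_subsets_at_top (UNIV :: (nat \<times> nat) set) \<noteq> bot" by simp
  have "hol2_on (ball ?a \<rho> \<times> ball ?b \<rho>) H"
  proof (rule hol2_on_osgood)
    show "continuous_on (ball ?a \<rho> \<times> ball ?b \<rho>) H"
      by (rule uniform_limit_theorem[OF _ uniform_limit_on_subset[OF ulim] ne])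
         (auto intro!: always_eventually continuous_on_subset[OF hol2_on_imp_continuous_on[OF thol]])
  next
    fix w assume w: "w \<in> ball ?b \<rho>"
    show "(\<lambda>z. H (z, w)) holomorphic_on ball ?a \<rho>"
    proof (rule holomorphic_uniform_limit[OF _ _ ne])
      show "uniform_limit (cball ?a \<rho>) (\<lambda>X z. \<Sum>ij\<in>X. t ij (z, w)) (\<lambda>z. H (z, w)) (finite_subsets_at_top UNIV)"
        using w by (intro uniform_limit_compose'[OF ulim]) auto
    qed (auto intro!: always_eventually hol2_on_holomorphic[OF thol] holomorphic_on_imp_continuous_on)
  next
    fix z assume z: "z \<in> ball ?a \<rho>"
    show "(\<lambda>w. H (z, w)) holomorphic_on ball ?b \<rho>"
    proof (rule holomorphic_uniform_limit[OF _ _ ne])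
      show "uniform_limit (cball ?b \<rho>) (\<lambda>X w. \<Sum>ij\<in>X. t ij (z, w)) (\<lambda>w. H (z, w)) (finite_subsets_at_top UNIV)"
        using z by (intro uniform_limit_compose'[OF ulim]) auto
    qed (auto intro!: always_eventually hol2_on_holomorphic[OF thol] holomorphic_on_imp_continuous_on)
  qed auto
  then have "holomorphic2_at H (complex_point q)"
    unfolding holomorphic2_at_iff using \<rho>
    by (intro exI[of _ "ball ?a \<rho> \<times> ball ?b \<rho>"]) (auto simp: complex_point_def intro: open_Times)
  moreover have "H (complex_point z) = of_real (f z)" if "\<bar>fst z - fst q\<bar> < r" "\<bar>snd z - snd q\<bar> < r" for z
  proof -
    have "((\<lambda>x. of_real ((\<lambda>(i, j). c i j * (fst z - fst q) ^ i * (snd z - snd q) ^ j) x)) has_sum complex_of_real (f z)) UNIV"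
      using sums[OF that] unfolding has_sum_of_real_iff by simp
    then show ?thesis
      by (auto simp: H_def t_def complex_point_def split_beta intro!: infsumI)
  qed
  moreover have "eventually (\<lambda>z. \<bar>fst z - fst q\<bar> < r \<and> \<bar>snd z - snd q\<bar> < r) (nhds q)"
    unfolding eventually_nhds
    by (rule exI[of _ "ball (fst q) r \<times> ball (snd q) r"])
       (use r in \<open>auto simp: dist_real_def abs_minus_commute mem_Times_iff intro!: open_Times\<close>)
  ultimately have "H \<in> complexification q f"
    unfolding complexification_def by (auto elim: eventually_mono)
  then show ?thesis by blast
qed

lemma open_complex_point_vimage: "open W \<Longrightarrow> open (complex_point -` W)"
  unfolding complex_point_def by (intro open_vimage continuous_intros)

lemma filterlim_complex_point: "filterlim complex_point (nhds (complex_point q)) (nhds q)"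
proof -
  have "continuous (at q) complex_point"
    unfolding complex_point_def by (intro continuous_intros)
  then show ?thesis using isCont_def tendsto_at_iff_tendsto_nhds by blast
qed

lemma has_derivative_complex_point: "(complex_point has_derivative complex_point) (at z)"
  unfolding complex_point_def by (auto intro!: derivative_eq_intros)

lemma holomorphic2_at_cong:
  assumes "holomorphic2_at f p" "eventually (\<lambda>z. f z = g z) (nhds p)"
  shows "holomorphic2_at g p"
proof -
  obtain U V where "open U" "p \<in> U" "hol2_on U f" "open V" "p \<in> V" "\<And>z. z \<in> V \<Longrightarrow> f z = g z"
    using assms unfolding holomorphic2_at_iff eventually_nhds by blast
  then show ?thesis
    unfolding holomorphic2_at_iff
    by (intro exI[of _ "U \<inter> V"] conjI open_Int IntI hol2_on_cong[of "U \<inter> V" f g])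
       (auto intro: hol2_on_subset)
qed

lemma holomorphic2_at_has_derivative:
  assumes "holomorphic2_at f p"
  shows "(f has_derivative (\<lambda>h. cd1 f p * fst h + cd2 f p * snd h)) (at p)"
  using assms hol2_on_has_derivative unfolding holomorphic2_at_iff by blast

lemma holomorphic2_at_const: "holomorphic2_at (\<lambda>_. c) p"
  unfolding holomorphic2_at_iff using hol2_on_const by blast

lemma holomorphic2_at_fst: "holomorphic2_at fst p" and holomorphic2_at_snd: "holomorphic2_at snd p"
  unfolding holomorphic2_at_iff using hol2_on_fst hol2_on_snd by blast+

lemma holomorphic2_at_add:
  assumes "holomorphic2_at f p" "holomorphic2_at g p" shows "holomorphic2_at (\<lambda>z. f z + g z) p"
  and holomorphic2_at_mult: "holomorphic2_at (\<lambda>z. f z * g z) p"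
proof -
  obtain U V where "open U" "p \<in> U" "hol2_on U f" "open V" "p \<in> V" "hol2_on V g"
    using assms unfolding holomorphic2_at_iff by blast
  then have UV: "open (U \<inter> V)" "p \<in> U \<inter> V" "hol2_on (U \<inter> V) f" "hol2_on (U \<inter> V) g"
    by (auto intro: hol2_on_subset)
  show "holomorphic2_at (\<lambda>z. f z + g z) p" "holomorphic2_at (\<lambda>z. f z * g z) p"
    unfolding holomorphic2_at_iff
    using hol2_on_add[OF UV(3,4)] hol2_on_mult[OF UV(3,4)] UV(1,2) by blast+
qed

lemma holomorphic2_at_diff:
  assumes "holomorphic2_at f p" "holomorphic2_at g p" shows "holomorphic2_at (\<lambda>z. f z - g z) p"
  using holomorphic2_at_add[OF assms(1) holomorphic2_at_mult[OF holomorphic2_at_const[of "-1"] assms(2)]] by simp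

lemma holomorphic2_at_inverse:
  assumes "holomorphic2_at f p" "f p \<noteq> 0" shows "holomorphic2_at (\<lambda>z. inverse (f z)) p"
proof -
  obtain U where U: "open U" "p \<in> U" "hol2_on U f" using assms unfolding holomorphic2_at_iff by blast
  let ?V = "U \<inter> f -` (- {0})"
  have "open ?V"
    by (rule continuous_open_preimage[OF hol2_on_imp_continuous_on[OF U(3)] U(1)]) auto
  moreover have "hol2_on ?V (\<lambda>z. inverse (f z))"
    unfolding hol2_on_def
  proof
    fix z assume z: "z \<in> ?V"
    then have "(f has_derivative (\<lambda>h. cd1 f z * fst h + cd2 f z * snd h)) (at z)"
      using hol2_on_has_derivative[OF U(3)] by auto
    from Deriv.has_derivative_inverse[OF _ this] z
    show "\<exists>a b. ((\<lambda>z. inverse (f z)) has_derivative (\<lambda>h. a * fst h + b * snd h)) (at z)"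
      by (intro exI[of _ "- (inverse (f z) * cd1 f z * inverse (f z))"] exI[of _ "- (inverse (f z) * cd2 f z * inverse (f z))"])
         (auto elim!: has_derivative_eq_rhs simp: algebra_simps)
  qed
  ultimately show ?thesis using U(2) assms(2) unfolding holomorphic2_at_iff by blast
qed

lemma cd_unique:
  assumes "(f has_derivative (\<lambda>h. a * fst h + b * snd h)) (at p)"
  shows "cd1 f p = a" "cd2 f p = b"
  using partials_of_has_derivative[OF assms] by (auto simp: cd1_def cd2_def DERIV_imp_deriv)

lemma cd_cong:
  assumes "holomorphic2_at f p" "eventually (\<lambda>z. f z = g z) (nhds p)"
  shows "cd1 g p = cd1 f p" "cd2 g p = cd2 f p"
proof -
  obtain S where "open S" "p \<in> S" "\<And>z. z \<in> S \<Longrightarrow> f z = g z" using assms(2) unfolding eventually_nhds by blast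
  then have "(g has_derivative (\<lambda>h. cd1 f p * fst h + cd2 f p * snd h)) (at p)"
    using has_derivative_transform_within_open[OF holomorphic2_at_has_derivative[OF assms(1)]] by blast
  then show "cd1 g p = cd1 f p" "cd2 g p = cd2 f p" by (rule cd_unique)+
qed

lemma cd_add:
  assumes "holomorphic2_at f p" "holomorphic2_at g p"
  shows "cd1 (\<lambda>z. f z + g z) p = cd1 f p + cd1 g p" "cd2 (\<lambda>z. f z + g z) p = cd2 f p + cd2 g p"
proof -
  have "((\<lambda>z. f z + g z) has_derivative (\<lambda>h. (cd1 f p + cd1 g p) * fst h + (cd2 f p + cd2 g p) * snd h)) (at p)"
    by (rule has_derivative_eq_rhs[OF has_derivative_add[OF assms[THEN holomorphic2_at_has_derivative]]])
       (auto simp: algebra_simps)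
  then show "cd1 (\<lambda>z. f z + g z) p = cd1 f p + cd1 g p" "cd2 (\<lambda>z. f z + g z) p = cd2 f p + cd2 g p"
    by (rule cd_unique)+
qed

lemma cd_mult:
  assumes "holomorphic2_at f p" "holomorphic2_at g p"
  shows "cd1 (\<lambda>z. f z * g z) p = cd1 f p * g p + f p * cd1 g p"
    and "cd2 (\<lambda>z. f z * g z) p = cd2 f p * g p + f p * cd2 g p"
proof -
  have "((\<lambda>z. f z * g z) has_derivative
      (\<lambda>h. (cd1 f p * g p + f p * cd1 g p) * fst h + (cd2 f p * g p + f p * cd2 g p) * snd h)) (at p)"
    by (rule has_derivative_eq_rhs[OF has_derivative_mult[OF assms[THEN holomorphic2_at_has_derivative]]])
       (auto simp: algebra_simps)
  then show "cd1 (\<lambda>z. f z * g z) p = cd1 f p * g p + f p * cd1 g p"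
    "cd2 (\<lambda>z. f z * g z) p = cd2 f p * g p + f p * cd2 g p"
    by (rule cd_unique)+
qed

lemma cd_const: "cd1 (\<lambda>_. c) p = 0" "cd2 (\<lambda>_. c) p = 0"
  by (simp_all add: cd1_def cd2_def)

lemma cd_shifted_coordinates:
  "cd1 (\<lambda>z. fst z - a) p = 1" "cd2 (\<lambda>z. fst z - a) p = 0"
  "cd1 (\<lambda>z. snd z - a) p = 0" "cd2 (\<lambda>z. snd z - a) p = 1"
  by (simp_all add: cd1_def cd2_def)

text \<open>Elements of \<open>complexification q f\<close> are the working representation of analytic functions: sums,
  products and partial derivatives are formed on the complex side and restricted to real points.\<close>

lemma complexificationE:
  assumes "H \<in> complexification q f"
  obtains N W where "open N" "q \<in> N" "open W" "hol2_on W H"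
    "\<And>z. z \<in> N \<Longrightarrow> complex_point z \<in> W \<and> H (complex_point z) = of_real (f z)"
proof -
  obtain W where W: "open W" "complex_point q \<in> W" "hol2_on W H"
    using assms unfolding complexification_def holomorphic2_at_iff by auto
  obtain N where N: "open N" "q \<in> N" "\<And>z. z \<in> N \<Longrightarrow> H (complex_point z) = of_real (f z)"
    using assms unfolding complexification_def eventually_nhds by auto
  show thesis
    by (rule that[of "N \<inter> complex_point -` W" W]) (use W N open_complex_point_vimage in auto)
qed

lemma complexificationI:
  assumes "open N" "q \<in> N" "open W" "hol2_on W H"
    "\<And>z. z \<in> N \<Longrightarrow> complex_point z \<in> W \<and> H (complex_point z) = of_real (f z)"
  shows "H \<in> complexification q f"
  using assms unfolding complexification_def holomorphic2_at_iff eventually_nhds by blast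

lemma complexification_const: "(\<lambda>_. of_real c) \<in> complexification q (\<lambda>_. c)"
  unfolding complexification_def by (auto intro: holomorphic2_at_const)

lemma complexification_add:
  assumes "H \<in> complexification q f" "K \<in> complexification q g"
  shows "(\<lambda>z. H z + K z) \<in> complexification q (\<lambda>z. f z + g z)"
  using assms unfolding complexification_def
  by (auto intro: holomorphic2_at_add elim: eventually_elim2)

lemma complexification_diff:
  assumes "H \<in> complexification q f" "K \<in> complexification q g"
  shows "(\<lambda>z. H z - K z) \<in> complexification q (\<lambda>z. f z - g z)"
  using assms unfolding complexification_def
  by (auto intro: holomorphic2_at_diff elim: eventually_elim2)

lemma complexification_mult:
  assumes "H \<in> complexification q f" "K \<in> complexification q g"
  shows "(\<lambda>z. H z * K z) \<in> complexification q (\<lambda>z. f z * g z)"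
  using assms unfolding complexification_def
  by (auto intro: holomorphic2_at_mult elim: eventually_elim2)

lemma complexification_cong:
  assumes "H \<in> complexification q f" "eventually (\<lambda>z. f z = g z) (nhds q)"
  shows "H \<in> complexification q g"
  using assms unfolding complexification_def by (auto elim: eventually_elim2)

lemma complexification_at: "H \<in> complexification q f \<Longrightarrow> H (complex_point q) = of_real (f q)"
  unfolding complexification_def using eventually_nhds_x_imp_x by blast

text \<open>This identifies the generators of the ideal in \<open>local_algebra\<close> with germs of concrete
  holomorphic functions.\<close>

lemma complexification_eq_germ:
  assumes H: "H \<in> complexification q f"
  shows "complexification q f = germ (complex_point q) H"
proof (intro equalityI subsetI)
  fix K assume "K \<in> germ (complex_point q) H"
  then have K: "eventually (\<lambda>z. H z = K z) (nhds (complex_point q))"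
    by (auto simp: germ_def eq_commute)
  have "eventually (\<lambda>z. H (complex_point z) = of_real (f z)) (nhds q)"
    using H by (simp add: complexification_def)
  moreover have "eventually (\<lambda>z. H (complex_point z) = K (complex_point z)) (nhds q)"
    using K filterlim_complex_point by (rule eventually_compose_filterlim)
  ultimately have "eventually (\<lambda>z. K (complex_point z) = of_real (f z)) (nhds q)"
    by eventually_elim simp
  then show "K \<in> complexification q f"
    using H holomorphic2_at_cong[OF _ K] by (simp add: complexification_def)
next
  fix K assume K: "K \<in> complexification q f"
  let ?D = "\<lambda>z. K z - H z"
  have "?D \<in> complexification q (\<lambda>z. f z - f z)" by (rule complexification_diff[OF K H])
  then obtain N W where N: "open N" "q \<in> N" and W: "open W" "hol2_on W ?D"
    and NW: "\<And>z. z \<in> N \<Longrightarrow> complex_point z \<in> W \<and> ?D (complex_point z) = of_real (f z - f z)"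
    by (rule complexificationE) (rule that)
  obtain r where r: "r > 0" "cball (fst (complex_point q)) r \<times> cball (snd (complex_point q)) r \<subseteq> W"
    using hol2_box[OF W(1)] NW N by metis
  obtain A B where AB: "open A" "open B" "q \<in> A \<times> B" "A \<times> B \<subseteq> N" using open_prod_elim[OF N] by metis
  then have "fst q \<in> A" "snd q \<in> B" by auto
  then obtain s t where st: "s > 0" "ball (fst q) s \<subseteq> A" "t > 0" "ball (snd q) t \<subseteq> B"
    using AB(1,2) open_contains_ball by metis
  define e where "e = min r (min s t)"
  have e: "e > 0" "e \<le> r" "e \<le> s" "e \<le> t" using r st by (auto simp: e_def)
  let ?B = "ball (of_real (fst q)) e \<times> ball (of_real (snd q)) e :: (complex \<times> complex) set"
  have "?B \<subseteq> W" using r e by (auto simp: complex_point_def subset_iff)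
  have "?D p = 0" if "p \<in> ?B" for p
  proof (rule hol2_identity[OF hol2_on_subset[OF W(2) \<open>?B \<subseteq> W\<close>] e(1) _ that])
    fix u v assume "\<bar>u - fst q\<bar> < e" "\<bar>v - snd q\<bar> < e"
    then have "u \<in> ball (fst q) s" "v \<in> ball (snd q) t"
      using e by (auto simp: dist_real_def abs_minus_commute)
    then have "(u, v) \<in> N" using st AB by blast
    then show "?D (complex_of_real u, complex_of_real v) = 0" using NW[of "(u, v)"] by (auto simp: complex_point_def)
  qed
  moreover have "open ?B" "complex_point q \<in> ?B" using e by (auto simp: complex_point_def intro: open_Times)
  ultimately show "K \<in> germ (complex_point q) H"
    unfolding germ_def eventually_nhds by auto
qed

text \<open>The complex derivative takes real values on real vectors because \<open>f\<close> does: the imaginary part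
  of \<open>H\<close> vanishes at all real points near \<open>z\<close>.\<close>

lemma has_derivative_of_complexification:
  assumes N: "open N" and H: "hol2_on W H" and z: "z \<in> N"
    and NW: "\<And>z. z \<in> N \<Longrightarrow> complex_point z \<in> W \<and> H (complex_point z) = of_real (f z)"
  shows "(f has_derivative (\<lambda>h. Re (cd1 H (complex_point z) * of_real (fst h) + cd2 H (complex_point z) * of_real (snd h)))) (at z)"
    and "of_real (pd f h z) = cd1 H (complex_point z) * of_real (fst h) + cd2 H (complex_point z) * of_real (snd h)"
proof -
  let ?D = "\<lambda>h. cd1 H (complex_point z) * of_real (fst h) + cd2 H (complex_point z) * of_real (snd h)"
  have "((\<lambda>z. H (complex_point z)) has_derivative ?D) (at z)"
    using has_derivative_compose[OF has_derivative_complex_point hol2_on_has_derivative[OF H]] NW[OF z]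
    by (simp add: complex_point_def)
  then have D: "((\<lambda>z. complex_of_real (f z)) has_derivative ?D) (at z)"
    by (rule has_derivative_transform_within_open[OF _ N z]) (use NW in auto)
  show re: "(f has_derivative (\<lambda>h. Re (?D h))) (at z)"
    using has_derivative_Re[OF D] by simp
  have "((\<lambda>z. 0) has_derivative (\<lambda>h. Im (?D h))) (at z)"
    using has_derivative_Im[OF D] by simp
  then have "(\<lambda>h. Im (?D h)) = (\<lambda>h. 0)"
    by (rule has_derivative_unique) simp
  then have im: "Im (?D h) = 0" by metis
  have "pd f h z = Re (?D h)"
    by (simp add: pd_def frechet_derivative_at[OF re, symmetric])
  with im show "of_real (pd f h z) = ?D h" by (simp add: complex_eq_iff)
qed

lemma complexification_pd:
  assumes "H \<in> complexification q f"
  shows complexification_pd1: "cd1 H \<in> complexification q (pd1 f)"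
    and complexification_pd2: "cd2 H \<in> complexification q (pd2 f)"
    and complexification_differentiable: "eventually (\<lambda>z. f differentiable (at z)) (nhds q)"
    and complexification_pd_commute: "eventually (\<lambda>z. pd2 (pd1 f) z = pd1 (pd2 f) z) (nhds q)"
proof -
  obtain N W where N: "open N" "q \<in> N" and W: "open W" "hol2_on W H"
    and NW: "\<And>z. z \<in> N \<Longrightarrow> complex_point z \<in> W \<and> H (complex_point z) = of_real (f z)"
    using complexificationE[OF assms] by metis
  have W1: "hol2_on W (cd1 H)" and W2: "hol2_on W (cd2 H)" using hol2_on_cd1 hol2_on_cd2 W by auto
  have 1: "complex_point z \<in> W \<and> cd1 H (complex_point z) = of_real (pd1 f z)" if "z \<in> N" for z
    using has_derivative_of_complexification(2)[OF N(1) W(2) that NW, of "(1, 0)"] NW[OF that] by simp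
  have 2: "complex_point z \<in> W \<and> cd2 H (complex_point z) = of_real (pd2 f z)" if "z \<in> N" for z
    using has_derivative_of_complexification(2)[OF N(1) W(2) that NW, of "(0, 1)"] NW[OF that] by simp
  show "cd1 H \<in> complexification q (pd1 f)" by (rule complexificationI[OF N W(1) W1 1])
  show "cd2 H \<in> complexification q (pd2 f)" by (rule complexificationI[OF N W(1) W2 2])
  show "eventually (\<lambda>z. f differentiable (at z)) (nhds q)"
    using N has_derivative_of_complexification(1)[OF N(1) W(2) _ NW]
    unfolding eventually_nhds differentiable_def by blast
  have "complex_of_real (pd2 (pd1 f) z) = of_real (pd1 (pd2 f) z)" if "z \<in> N" for z
    using has_derivative_of_complexification(2)[OF N(1) W1 that 1, of "(0, 1)"]
      has_derivative_of_complexification(2)[OF N(1) W2 that 2, of "(1, 0)"]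
      cd2_cd1_commute[OF W] NW[OF that] by simp
  then show "eventually (\<lambda>z. pd2 (pd1 f) z = pd1 (pd2 f) z) (nhds q)"
    using N unfolding eventually_nhds of_real_eq_iff by blast
qed

lemma Ck_on_subset: "Ck_on k U f \<Longrightarrow> V \<subseteq> U \<Longrightarrow> Ck_on k V f"
  by (induction k arbitrary: f) (auto intro: continuous_on_subset)

lemma Ck_on_cong:
  assumes "open U" "\<And>x. x \<in> U \<Longrightarrow> f x = g x"
  shows "Ck_on k U f \<Longrightarrow> Ck_on k U g"
  using assms(2)
proof (induction k arbitrary: f g)
  case 0 then show ?case by (auto cong: continuous_on_cong)
next
  case (Suc k)
  have d: "(g has_derivative frechet_derivative f (at x)) (at x)" if "x \<in> U" for x
  proof (rule has_derivative_transform_within_open[OF _ assms(1) that])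
    show "(f has_derivative frechet_derivative f (at x)) (at x)"
      using Suc.prems(1) that by (simp add: frechet_derivative_works[symmetric])
  qed (use Suc.prems(2) in auto)
  have "frechet_derivative g (at x) = frechet_derivative f (at x)" if "x \<in> U" for x
    using frechet_derivative_at[OF d[OF that]] by simp
  then have "Ck_on k U (\<lambda>x. frechet_derivative g (at x) v)" for v
    using Suc.IH[of "\<lambda>x. frechet_derivative f (at x) v"] Suc.prems(1) by auto
  then show ?case using d by (auto simp: differentiable_def)
qed

text \<open>The induction step for all closure properties of \<open>Ck_on\<close>.\<close>

lemma Ck_on_SucI:
  assumes "open U" "\<And>x. x \<in> U \<Longrightarrow> (f has_derivative D x) (at x)" "\<And>v. Ck_on k U (\<lambda>x. D x v)"
  shows "Ck_on (Suc k) U f"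
proof -
  have "Ck_on k U (\<lambda>x. frechet_derivative f (at x) v)" for v
    by (rule Ck_on_cong[OF assms(1) _ assms(3)]) (simp add: frechet_derivative_at[OF assms(2), symmetric])
  moreover have "f differentiable (at x)" if "x \<in> U" for x
    using assms(2)[OF that] unfolding differentiable_def by blast
  ultimately show ?thesis by simp
qed

lemma Ck_on_Suc_has_derivative:
  "Ck_on (Suc k) U f \<Longrightarrow> x \<in> U \<Longrightarrow> (f has_derivative frechet_derivative f (at x)) (at x)"
  by (simp add: frechet_derivative_works[symmetric])

lemma Ck_on_Suc_frechet_derivative:
  "Ck_on (Suc k) U f \<Longrightarrow> Ck_on k U (\<lambda>x. frechet_derivative f (at x) v)"
  unfolding Ck_on.simps(2) by blast

text \<open>The induction on \<open>k\<close> works for all \<open>H\<close> at once, since a directional derivative of the real part of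
  a holomorphic function is the real part of another one.\<close>

lemma Ck_on_restriction_of_hol2:
  assumes W: "open W" and H: "hol2_on W H"
  shows "Ck_on k (complex_point -` W) (\<lambda>z. Re (H (complex_point z)))"
  using H
proof (induction k arbitrary: H)
  case 0
  have "continuous_on (complex_point -` W) (\<lambda>z. H (complex_point z))"
    by (rule continuous_on_compose2[OF hol2_on_imp_continuous_on[OF 0]])
       (auto simp: complex_point_def intro!: continuous_intros)
  then show ?case by (auto intro!: continuous_intros)
next
  case (Suc k)
  show ?case
  proof (rule Ck_on_SucI[OF open_complex_point_vimage[OF W]])
    fix z assume "z \<in> complex_point -` W"
    then show "((\<lambda>z. Re (H (complex_point z))) has_derivative
        (\<lambda>h. Re (cd1 H (complex_point z) * of_real (fst h) + cd2 H (complex_point z) * of_real (snd h)))) (at z)"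
      using has_derivative_Re[OF has_derivative_compose[OF has_derivative_complex_point hol2_on_has_derivative[OF Suc.prems]]]
      by (simp add: complex_point_def)
  next
    fix v :: "real \<times> real"
    show "Ck_on k (complex_point -` W)
        (\<lambda>z. Re (cd1 H (complex_point z) * of_real (fst v) + cd2 H (complex_point z) * of_real (snd v)))"
      by (rule Suc.IH) (intro hol2_on_add hol2_on_mult hol2_on_const hol2_on_cd1 hol2_on_cd2 W Suc.prems)
  qed
qed

lemma complexification_smooth_at:
  assumes "H \<in> complexification q f"
  shows "smooth_at f q"
proof -
  obtain N W where N: "open N" "q \<in> N" and W: "open W" "hol2_on W H"
    and NW: "\<And>z. z \<in> N \<Longrightarrow> complex_point z \<in> W \<and> H (complex_point z) = of_real (f z)"
    using complexificationE[OF assms] by metis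
  have "N \<subseteq> complex_point -` W" using NW by auto
  then have "Ck_on k N (\<lambda>z. Re (H (complex_point z)))" for k
    by (rule Ck_on_subset[OF Ck_on_restriction_of_hol2[OF W]])
  then have "Ck_on k N f" for k by (rule Ck_on_cong[OF N(1), rotated]) (use NW in auto)
  then show ?thesis using N unfolding smooth_at_def by blast
qed

section \<open>The local ring and multiplicity one\<close>

lemma germ_eq_iff: "germ p f = germ p g \<longleftrightarrow> eventually (\<lambda>z. f z = g z) (nhds p)"
proof
  assume "germ p f = germ p g"
  moreover have "f \<in> germ p f" by (simp add: germ_def)
  ultimately show "eventually (\<lambda>z. f z = g z) (nhds p)" by (simp add: germ_def)
next
  assume fg: "eventually (\<lambda>z. f z = g z) (nhds p)"
  have "h \<in> germ p f \<longleftrightarrow> h \<in> germ p g" for h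
  proof
    assume "h \<in> germ p f"
    then have "eventually (\<lambda>z. h z = f z) (nhds p)" by (simp add: germ_def)
    with fg have "eventually (\<lambda>z. h z = g z) (nhds p)" by eventually_elim simp
    then show "h \<in> germ p g" by (simp add: germ_def)
  next
    assume "h \<in> germ p g"
    then have "eventually (\<lambda>z. h z = g z) (nhds p)" by (simp add: germ_def)
    with fg have "eventually (\<lambda>z. h z = f z) (nhds p)" by eventually_elim simp
    then show "h \<in> germ p f" by (simp add: germ_def)
  qed
  then show "germ p f = germ p g" by blast
qed

lemma germ_self: "f \<in> germ p f"
  by (simp add: germ_def)

text \<open>The union over representatives in \<open>hol_germs\<close> is taken over a set of equal germs.\<close>

lemma germ_lift2:
  "(\<Union>f'\<in>germ p f. \<Union>g'\<in>germ p g. germ p (\<lambda>z. op (f' z) (g' z))) = germ p (\<lambda>z. op (f z) (g z))"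
proof -
  have "germ p (\<lambda>z. op (f' z) (g' z)) = germ p (\<lambda>z. op (f z) (g z))" if "f' \<in> germ p f" "g' \<in> germ p g" for f' g'
    unfolding germ_eq_iff using that unfolding germ_def by (auto elim: eventually_elim2)
  then show ?thesis using germ_self[of f p] germ_self[of g p] by blast
qed

lemma hol_germs_carrier: "carrier (hol_germs p) = germ p ` {f. holomorphic2_at f p}"
  and hol_germs_zero: "\<zero>\<^bsub>hol_germs p\<^esub> = germ p (\<lambda>_. 0)"
  and hol_germs_one: "\<one>\<^bsub>hol_germs p\<^esub> = germ p (\<lambda>_. 1)"
  and hol_germs_add: "germ p f \<oplus>\<^bsub>hol_germs p\<^esub> germ p g = germ p (\<lambda>z. f z + g z)"
  and hol_germs_mult: "germ p f \<otimes>\<^bsub>hol_germs p\<^esub> germ p g = germ p (\<lambda>z. f z * g z)"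
  using germ_lift2[where op = "(+)"] germ_lift2[where op = "(*)"] by (simp_all add: hol_germs_def)

lemmas hol_germs_simps = hol_germs_zero hol_germs_one hol_germs_add hol_germs_mult

lemma germ_in_hol_germs: "holomorphic2_at f p \<Longrightarrow> germ p f \<in> carrier (hol_germs p)"
  by (simp add: hol_germs_carrier)

lemma hol_germs_cring: "cring (hol_germs p)"
proof (intro cringI abelian_groupI comm_monoidI)
  fix A assume "A \<in> carrier (hol_germs p)"
  then obtain f where f: "A = germ p f" "holomorphic2_at f p" by (auto simp: hol_germs_carrier)
  show "\<exists>B\<in>carrier (hol_germs p). B \<oplus>\<^bsub>hol_germs p\<^esub> A = \<zero>\<^bsub>hol_germs p\<^esub>"
    by (rule bexI[of _ "germ p (\<lambda>z. 0 - f z)"])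
       (simp_all add: f hol_germs_simps germ_in_hol_germs holomorphic2_at_diff holomorphic2_at_const del: diff_0)
qed (auto simp: hol_germs_carrier hol_germs_simps algebra_simps
      intro: holomorphic2_at_add holomorphic2_at_mult holomorphic2_at_const)

lemma hol_germs_uminus:
  assumes "holomorphic2_at f p"
  shows "\<ominus>\<^bsub>hol_germs p\<^esub> germ p f = germ p (\<lambda>z. - f z)"
proof -
  interpret cring "hol_germs p" by (rule hol_germs_cring)
  have "holomorphic2_at (\<lambda>z. - f z) p"
    using holomorphic2_at_diff[OF holomorphic2_at_const[of 0] assms] by simp
  then show ?thesis
    using assms by (intro minus_equality) (simp_all add: germ_in_hol_germs hol_germs_simps)
qed

lemma hol_germs_minus:
  assumes "holomorphic2_at f p" "holomorphic2_at g p"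
  shows "germ p f \<ominus>\<^bsub>hol_germs p\<^esub> germ p g = germ p (\<lambda>z. f z - g z)"
  by (simp add: a_minus_def hol_germs_uminus hol_germs_simps assms)

lemma germ_ideal_closed:
  assumes "ideal I (hol_germs p)"
  shows "holomorphic2_at f p \<Longrightarrow> germ p g \<in> I \<Longrightarrow> germ p (\<lambda>z. f z * g z) \<in> I"
    and "germ p f \<in> I \<Longrightarrow> germ p g \<in> I \<Longrightarrow> germ p (\<lambda>z. f z + g z) \<in> I"
  using ideal.I_l_closed[OF assms _ germ_in_hol_germs]
    additive_subgroup.a_closed[OF ideal.axioms(1)[OF assms]]
  by (simp_all add: hol_germs_simps[symmetric])

lemma holomorphic2_at_eventually_nonzero:
  assumes "holomorphic2_at f p" "f p \<noteq> 0" shows "eventually (\<lambda>z. f z \<noteq> 0) (nhds p)"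
proof -
  have "isCont f p" using has_derivative_continuous[OF holomorphic2_at_has_derivative[OF assms(1)]] .
  then show ?thesis
    using assms(2) tendsto_imp_eventually_ne[of f "f p" "nhds p" 0]
    by (simp add: isCont_def tendsto_at_iff_tendsto_nhds)
qed

lemma subfield_constant_germs: "subfield (range (\<lambda>c. germ p (\<lambda>_. c))) (hol_germs p)"
proof -
  interpret cring "hol_germs p" by (rule hol_germs_cring)
  let ?K = "range (\<lambda>c. germ p (\<lambda>_. c))"
  have K: "subring ?K (hol_germs p)"
    by (rule subringI)
       (auto simp: hol_germs_simps hol_germs_uminus holomorphic2_at_const intro: germ_in_hol_germs)
  have const_eq: "germ p (\<lambda>_. c) = germ p (\<lambda>_. d) \<longleftrightarrow> c = d" for c d :: complex
    by (simp add: germ_eq_iff)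
  show ?thesis
  proof (rule subfieldI[OF subcringI'[OF K]])
    show "Units (hol_germs p \<lparr>carrier := ?K\<rparr>) = ?K - {\<zero>\<^bsub>hol_germs p\<^esub>}"
      unfolding Units_def
    proof (intro equalityI subsetI)
      fix a assume "a \<in> ?K - {\<zero>\<^bsub>hol_germs p\<^esub>}"
      then obtain c where c: "a = germ p (\<lambda>_. c)" "c \<noteq> 0" by (auto simp: hol_germs_simps const_eq)
      then show "a \<in> {y \<in> carrier (hol_germs p\<lparr>carrier := ?K\<rparr>). \<exists>x\<in>carrier (hol_germs p\<lparr>carrier := ?K\<rparr>).
          x \<otimes>\<^bsub>hol_germs p\<lparr>carrier := ?K\<rparr>\<^esub> y = \<one>\<^bsub>hol_germs p\<lparr>carrier := ?K\<rparr>\<^esub> \<and>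
          y \<otimes>\<^bsub>hol_germs p\<lparr>carrier := ?K\<rparr>\<^esub> x = \<one>\<^bsub>hol_germs p\<lparr>carrier := ?K\<rparr>\<^esub>}"
        by (auto simp: hol_germs_simps const_eq intro!: exI[of _ "inverse c"])
    qed (auto simp: hol_germs_simps const_eq)
  qed
qed

text \<open>Germs that vanish at \<open>p\<close> and are killed there by the derivation with components \<open>\<alpha>\<close> and \<open>\<beta>\<close>. For
  \<open>\<alpha> = \<beta> = 0\<close> this is the maximal ideal; otherwise it is a proper subideal of it, which does not
  contain both coordinates.\<close>

definition jet_ideal :: "complex \<times> complex \<Rightarrow> complex \<Rightarrow> complex \<Rightarrow> (complex \<times> complex \<Rightarrow> complex) set set" where
  "jet_ideal p \<alpha> \<beta> = germ p ` {f. holomorphic2_at f p \<and> f p = 0 \<and> \<alpha> * cd1 f p + \<beta> * cd2 f p = 0}"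

lemma germ_in_jet_ideal_iff:
  assumes "holomorphic2_at f p"
  shows "germ p f \<in> jet_ideal p \<alpha> \<beta> \<longleftrightarrow> f p = 0 \<and> \<alpha> * cd1 f p + \<beta> * cd2 f p = 0"
proof
  assume "germ p f \<in> jet_ideal p \<alpha> \<beta>"
  then obtain g where g: "holomorphic2_at g p" "g p = 0" "\<alpha> * cd1 g p + \<beta> * cd2 g p = 0"
    "eventually (\<lambda>z. f z = g z) (nhds p)" by (auto simp: jet_ideal_def germ_eq_iff)
  then show "f p = 0 \<and> \<alpha> * cd1 f p + \<beta> * cd2 f p = 0"
    using cd_cong[OF assms g(4)] eventually_nhds_x_imp_x[OF g(4)] by simp
qed (use assms in \<open>auto simp: jet_ideal_def\<close>)

lemma jet_ideal_ideal: "ideal (jet_ideal p \<alpha> \<beta>) (hol_germs p)"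
proof -
  interpret cring "hol_germs p" by (rule hol_germs_cring)
  have mult: "A \<otimes>\<^bsub>hol_germs p\<^esub> B \<in> jet_ideal p \<alpha> \<beta>"
    if AB: "A \<in> jet_ideal p \<alpha> \<beta>" "B \<in> carrier (hol_germs p)" for A B
  proof -
    obtain f g where "A = germ p f" "holomorphic2_at f p" "f p = 0" "\<alpha> * cd1 f p + \<beta> * cd2 f p = 0"
      "B = germ p g" "holomorphic2_at g p"
      using AB unfolding jet_ideal_def hol_germs_carrier by blast
    moreover from this have "\<alpha> * (cd1 f p * g p) + \<beta> * (cd2 f p * g p) = 0"
      by (metis distrib_right mult.assoc mult_zero_left)
    ultimately show ?thesis
      by (simp add: hol_germs_simps germ_in_jet_ideal_iff holomorphic2_at_mult cd_mult)
  qed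
  show ?thesis
  proof (rule idealI[OF ring_axioms])
    show "subgroup (jet_ideal p \<alpha> \<beta>) (add_monoid (hol_germs p))"
    proof (rule add.subgroupI)
      show "jet_ideal p \<alpha> \<beta> \<subseteq> carrier (hol_germs p)"
        by (auto simp: jet_ideal_def hol_germs_carrier)
      show "jet_ideal p \<alpha> \<beta> \<noteq> {}"
        using germ_in_jet_ideal_iff[OF holomorphic2_at_const[of 0 p]] by (auto simp: cd_const)
    next
      fix A assume A: "A \<in> jet_ideal p \<alpha> \<beta>"
      then have "A \<otimes>\<^bsub>hol_germs p\<^esub> (\<ominus>\<^bsub>hol_germs p\<^esub> \<one>\<^bsub>hol_germs p\<^esub>) \<in> jet_ideal p \<alpha> \<beta>"
        by (intro mult) auto
      moreover have "A \<in> carrier (hol_germs p)" using A by (auto simp: jet_ideal_def hol_germs_carrier)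
      ultimately show "\<ominus>\<^bsub>hol_germs p\<^esub> A \<in> jet_ideal p \<alpha> \<beta>" by (simp add: r_minus)
    next
      fix A B assume "A \<in> jet_ideal p \<alpha> \<beta>" "B \<in> jet_ideal p \<alpha> \<beta>"
      then obtain f g where "A = germ p f" "holomorphic2_at f p" "f p = 0" "\<alpha> * cd1 f p + \<beta> * cd2 f p = 0"
        "B = germ p g" "holomorphic2_at g p" "g p = 0" "\<alpha> * cd1 g p + \<beta> * cd2 g p = 0"
        by (auto simp: jet_ideal_def)
      moreover from this have "\<alpha> * (cd1 f p + cd1 g p) + \<beta> * (cd2 f p + cd2 g p) = 0"
        by (simp add: algebra_simps)
      ultimately show "A \<oplus>\<^bsub>hol_germs p\<^esub> B \<in> jet_ideal p \<alpha> \<beta>"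
        by (simp add: hol_germs_simps germ_in_jet_ideal_iff holomorphic2_at_add cd_add)
    qed
  qed (use mult m_comm in \<open>auto simp: jet_ideal_def hol_germs_carrier\<close>)
qed

text \<open>A one-dimensional space that contains \<open>K\<close>, which has dimension one over itself, equals \<open>K\<close>.\<close>

lemma dimension_one_iff:
  assumes "ring Q" "subfield K Q"
  shows "ring.dimension Q 1 K (carrier Q) \<longleftrightarrow> carrier Q = K"
proof -
  interpret ring Q by (rule assms(1))
  note K = subfieldE[OF assms(2)]
  show ?thesis
  proof
    assume d: "dimension 1 K (carrier Q)"
    have ind: "independent K [\<one>\<^bsub>Q\<^esub>]"
      using li_Cons[of "\<one>\<^bsub>Q\<^esub>" K "[]"] li_Nil K(6) by simp
    have "Span K [\<one>\<^bsub>Q\<^esub>] = carrier Q"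
      using independent_length_eq_dimension[OF assms(2) d ind] by simp
    moreover have "Span K [\<one>\<^bsub>Q\<^esub>] = K"
      using K(3) by (force simp: line_extension_mem_iff)
    ultimately show "carrier Q = K" by simp
  qed (use dimension_one[OF assms(2)] in simp)
qed

text \<open>If the Jacobian matrix of \<open>H\<close> and \<open>K\<close> is invertible at \<open>p\<close>, then Hadamard's lemma writes \<open>H\<close> and \<open>K\<close> as
  combinations of the shifted coordinates with a matrix of coefficients that is invertible in the
  local ring, and Cramer's rule recovers the coordinates. If it is singular, a nonzero derivation at
  \<open>p\<close> kills both germs, and then it kills the whole ideal.\<close>

lemma ideal_eq_maximal_iff_jacobian:
  assumes H: "holomorphic2_at H p" "H p = 0" and K: "holomorphic2_at K p" "K p = 0"
  defines "I \<equiv> genideal (hol_germs p) {germ p H, germ p K}"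
  shows "(\<forall>f. holomorphic2_at f p \<and> f p = 0 \<longrightarrow> germ p f \<in> I) \<longleftrightarrow> cd1 H p * cd2 K p - cd2 H p * cd1 K p \<noteq> 0"
proof -
  interpret cring "hol_germs p" by (rule hol_germs_cring)
  let ?R = "hol_germs p"
  have HK: "{germ p H, germ p K} \<subseteq> carrier ?R" using H K germ_in_hol_germs by auto
  have I: "ideal I ?R" "germ p H \<in> I" "germ p K \<in> I"
    unfolding I_def using genideal_ideal[OF HK] genideal_self[OF HK] by auto
  note I_mult = germ_ideal_closed(1)[OF I(1)] and I_add = germ_ideal_closed(2)[OF I(1)]
  let ?z = "\<lambda>z. fst z - fst p" and ?w = "\<lambda>z. snd z - snd p"
  have zw: "holomorphic2_at ?z p" "holomorphic2_at ?w p"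
    by (intro holomorphic2_at_diff holomorphic2_at_fst holomorphic2_at_snd holomorphic2_at_const)+
  show ?thesis
  proof
    assume all: "\<forall>f. holomorphic2_at f p \<and> f p = 0 \<longrightarrow> germ p f \<in> I"
    show "cd1 H p * cd2 K p - cd2 H p * cd1 K p \<noteq> 0"
    proof
      assume J: "cd1 H p * cd2 K p - cd2 H p * cd1 K p = 0"
      \<comment> \<open>a vector in the kernel of the singular Jacobian matrix, taken orthogonal to a nonzero row if there is one\<close>
      obtain \<alpha> \<beta> where ab: "\<alpha> \<noteq> 0 \<or> \<beta> \<noteq> 0" "\<alpha> * cd1 H p + \<beta> * cd2 H p = 0" "\<alpha> * cd1 K p + \<beta> * cd2 K p = 0"
      proof (cases "cd1 H p = 0 \<and> cd2 H p = 0")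
        case True
        show thesis
        proof (cases "cd1 K p = 0 \<and> cd2 K p = 0")
          case True
          with \<open>cd1 H p = 0 \<and> cd2 H p = 0\<close> show thesis by (intro that[of 1 0]) auto
        next
          case False
          with True show thesis by (intro that[of "cd2 K p" "- cd1 K p"]) auto
        qed
      next
        case False
        with J show thesis by (intro that[of "cd2 H p" "- cd1 H p"]) (auto simp: algebra_simps)
      qed
      have "I \<subseteq> jet_ideal p \<alpha> \<beta>"
        unfolding I_def by (rule genideal_minimal[OF jet_ideal_ideal])
          (use H K ab in \<open>simp add: germ_in_jet_ideal_iff\<close>)
      then have "germ p ?z \<in> jet_ideal p \<alpha> \<beta>" "germ p ?w \<in> jet_ideal p \<alpha> \<beta>"
        using all zw by auto
      then show False
        using ab(1) zw by (simp add: germ_in_jet_ideal_iff cd_shifted_coordinates)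
    qed
  next
    assume J: "cd1 H p * cd2 K p - cd2 H p * cd1 K p \<noteq> 0"
    obtain H1 H2 where H12: "holomorphic2_at H1 p" "holomorphic2_at H2 p"
      and H_eq: "eventually (\<lambda>z. H z = H p + ?z z * H1 z + ?w z * H2 z) (nhds p)"
      by (rule holomorphic2_at_hadamard[OF H(1)])
    obtain K1 K2 where K12: "holomorphic2_at K1 p" "holomorphic2_at K2 p"
      and K_eq: "eventually (\<lambda>z. K z = K p + ?z z * K1 z + ?w z * K2 z) (nhds p)"
      by (rule holomorphic2_at_hadamard[OF K(1)])
    have val: "cd1 f p = f1 p \<and> cd2 f p = f2 p"
      if "holomorphic2_at f p" "holomorphic2_at f1 p" "holomorphic2_at f2 p"
        "eventually (\<lambda>z. f z = f p + ?z z * f1 z + ?w z * f2 z) (nhds p)" for f f1 f2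
      using cd_cong[OF that(1,4)] that(2,3) zw
      by (simp add: cd_add cd_mult cd_const cd_shifted_coordinates holomorphic2_at_add holomorphic2_at_mult holomorphic2_at_const)
    define D where "D z = H1 z * K2 z - H2 z * K1 z" for z
    have D: "holomorphic2_at D p" "D p \<noteq> 0"
      using H12 K12 J val[OF H(1) H12 H_eq] val[OF K(1) K12 K_eq] unfolding D_def
      by (auto intro: holomorphic2_at_diff holomorphic2_at_mult)
    have Dne: "eventually (\<lambda>z. D z \<noteq> 0) (nhds p)" by (rule holomorphic2_at_eventually_nonzero[OF D])
    have inv: "holomorphic2_at (\<lambda>z. inverse (D z)) p" by (rule holomorphic2_at_inverse[OF D])
    \<comment> \<open>Cramer's rule, with \<open>D\<close> the determinant of the coefficients\<close>
    have "germ p (\<lambda>z. (inverse (D z) * K2 z) * H z + (inverse (D z) * (0 - H2 z)) * K z) \<in> I"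
      by (intro I_add I_mult I holomorphic2_at_mult inv H12 K12 holomorphic2_at_diff holomorphic2_at_const)
    also have "germ p (\<lambda>z. (inverse (D z) * K2 z) * H z + (inverse (D z) * (0 - H2 z)) * K z) = germ p ?z"
      unfolding germ_eq_iff using H_eq K_eq Dne
    proof eventually_elim
      case (elim z)
      have "D z * ?z z = K2 z * H z - H2 z * K z"
        unfolding D_def elim(1) elim(2) H(2) K(2) by (simp add: algebra_simps)
      then show ?case using elim(3) by (simp add: field_simps)
    qed
    finally have zI: "germ p ?z \<in> I" .
    have "germ p (\<lambda>z. (inverse (D z) * H1 z) * K z + (inverse (D z) * (0 - K1 z)) * H z) \<in> I"
      by (intro I_add I_mult I holomorphic2_at_mult inv H12 K12 holomorphic2_at_diff holomorphic2_at_const)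
    also have "germ p (\<lambda>z. (inverse (D z) * H1 z) * K z + (inverse (D z) * (0 - K1 z)) * H z) = germ p ?w"
      unfolding germ_eq_iff using H_eq K_eq Dne
    proof eventually_elim
      case (elim z)
      have "D z * ?w z = H1 z * K z - K1 z * H z"
        unfolding D_def elim(1) elim(2) H(2) K(2) by (simp add: algebra_simps)
      then show ?case using elim(3) by (simp add: field_simps)
    qed
    finally have wI: "germ p ?w \<in> I" .
    show "\<forall>f. holomorphic2_at f p \<and> f p = 0 \<longrightarrow> germ p f \<in> I"
    proof safe
      fix f assume f: "holomorphic2_at f p" "f p = 0"
      obtain f1 f2 where f12: "holomorphic2_at f1 p" "holomorphic2_at f2 p"
        and f_eq: "eventually (\<lambda>z. f z = f p + ?z z * f1 z + ?w z * f2 z) (nhds p)"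
        by (rule holomorphic2_at_hadamard[OF f(1)])
      have "germ p (\<lambda>z. f1 z * ?z z + f2 z * ?w z) \<in> I" by (intro I_add I_mult f12 zI wI)
      also have "germ p (\<lambda>z. f1 z * ?z z + f2 z * ?w z) = germ p f"
        unfolding germ_eq_iff using f_eq by eventually_elim (simp add: f algebra_simps)
      finally show "germ p f \<in> I" .
    qed
  qed
qed

text \<open>Multiplicity one means that the local algebra consists of constants, that is, that the ideal is
  the maximal one. Uniqueness of the dimension is what turns the definite description in
  \<open>multiplicity_at\<close> into a statement about dimension one.\<close>

lemma multiplicity_one_iff_jacobian:
  assumes H: "H \<in> complexification q h" and K: "K \<in> complexification q k" and z: "h q = 0" "k q = 0"
  shows "multiplicity_at q h k = 1 \<longleftrightarrow> pd1 h q * pd2 k q - pd2 h q * pd1 k q \<noteq> 0"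
proof -
  let ?p = "complex_point q"
  let ?R = "hol_germs ?p"
  interpret cring ?R by (rule hol_germs_cring)
  have hol: "holomorphic2_at H ?p" "holomorphic2_at K ?p" using H K by (auto simp: complexification_def)
  have HK0: "H ?p = 0" "K ?p = 0" using complexification_at[OF H] complexification_at[OF K] z by auto
  define I where "I = genideal ?R {germ ?p H, germ ?p K}"
  have HK: "{germ ?p H, germ ?p K} \<subseteq> carrier ?R" using hol germ_in_hol_germs by auto
  have I: "ideal I ?R" unfolding I_def by (rule genideal_ideal[OF HK])
  have "I \<subseteq> jet_ideal ?p 0 0"
    unfolding I_def by (rule genideal_minimal[OF jet_ideal_ideal])
      (use hol HK0 in \<open>simp add: germ_in_jet_ideal_iff\<close>)
  then have I0: "f ?p = 0" if "germ ?p f \<in> I" "holomorphic2_at f ?p" for f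
    using that germ_in_jet_ideal_iff by blast
  let ?Q = "?R Quot I"
  let ?K = "range (\<lambda>c. germ ?p (\<lambda>_. c))"
  have alg: "local_algebra q h k = ?Q"
    by (simp add: local_algebra_def I_def complexification_eq_germ[OF H] complexification_eq_germ[OF K])
  have consts_eq: "local_algebra_consts q h k = (\<lambda>a. I +>\<^bsub>?R\<^esub> a) ` ?K"
    by (simp add: local_algebra_consts_def I_def complexification_eq_germ[OF H] complexification_eq_germ[OF K] image_image)
  have coset_eq: "I +>\<^bsub>?R\<^esub> germ ?p f = I +>\<^bsub>?R\<^esub> germ ?p g \<longleftrightarrow> germ ?p (\<lambda>z. f z - g z) \<in> I"
    if "holomorphic2_at f ?p" "holomorphic2_at g ?p" for f g
    using quotient_eq_iff_same_a_r_cos[OF I germ_in_hol_germs[OF that(1)] germ_in_hol_germs[OF that(2)]]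
    by (simp add: hol_germs_minus that)
  have Q: "ring ?Q" by (rule ideal.quotient_is_ring[OF I])
  interpret hom: ring_hom_ring ?R ?Q "a_r_coset ?R I" by (rule ideal.rcos_ring_hom_ring[OF I])
  have "\<one>\<^bsub>?Q\<^esub> \<noteq> \<zero>\<^bsub>?Q\<^esub>"
  proof
    assume "\<one>\<^bsub>?Q\<^esub> = \<zero>\<^bsub>?Q\<^esub>"
    then have "I +>\<^bsub>?R\<^esub> germ ?p (\<lambda>_. 1) = I +>\<^bsub>?R\<^esub> germ ?p (\<lambda>_. 0)"
      using hom.hom_one hom.hom_zero by (simp add: hol_germs_simps)
    then have "germ ?p (\<lambda>_. 1 - 0) \<in> I"
      by (subst (asm) coset_eq) (auto intro: holomorphic2_at_const)
    from I0[OF this holomorphic2_at_const] show False by simp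
  qed
  from hom.img_is_subfield(2)[OF subfield_constant_germs this]
  have sub: "subfield (local_algebra_consts q h k) ?Q" by (simp add: consts_eq)
  have "multiplicity_at q h k = 1 \<longleftrightarrow> ring.dimension ?Q 1 (local_algebra_consts q h k) (carrier ?Q)"
  proof -
    have uniq: "n = m" if "ring.dimension ?Q n (local_algebra_consts q h k) (carrier ?Q)"
      "ring.dimension ?Q m (local_algebra_consts q h k) (carrier ?Q)" for n m
      using ring.dimension_is_inj[OF Q sub that] .
    show ?thesis
    proof (cases "\<exists>n. ring.dimension ?Q n (local_algebra_consts q h k) (carrier ?Q)")
      case True
      then obtain n where n: "ring.dimension ?Q n (local_algebra_consts q h k) (carrier ?Q)" ..
      then have "(THE n. ring.dimension ?Q n (local_algebra_consts q h k) (carrier ?Q)) = n"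
        using uniq by blast
      then have "multiplicity_at q h k = enat n"
        using True by (simp add: multiplicity_at_def alg)
      then show ?thesis using n uniq by (auto simp: one_enat_def)
    next
      case False
      then show ?thesis by (auto simp: multiplicity_at_def alg)
    qed
  qed
  also have "\<dots> \<longleftrightarrow> carrier ?Q = local_algebra_consts q h k" by (rule dimension_one_iff[OF Q sub])
  also have "\<dots> \<longleftrightarrow> (\<forall>f. holomorphic2_at f ?p \<longrightarrow> (\<exists>c. germ ?p (\<lambda>z. f z - c) \<in> I))"
  proof -
    have c1: "carrier ?Q = (\<lambda>f. I +>\<^bsub>?R\<^esub> germ ?p f) ` {f. holomorphic2_at f ?p}"
      unfolding FactRing_def A_RCOSETS_def' hol_germs_carrier partial_object.simps by blast
    have c2: "local_algebra_consts q h k \<subseteq> (\<lambda>f. I +>\<^bsub>?R\<^esub> germ ?p f) ` {f. holomorphic2_at f ?p}"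
      unfolding consts_eq image_image
      by (rule image_subsetI, rule image_eqI[OF refl]) (simp add: holomorphic2_at_const)
    have mem: "I +>\<^bsub>?R\<^esub> germ ?p f \<in> local_algebra_consts q h k \<longleftrightarrow> (\<exists>c. germ ?p (\<lambda>z. f z - c) \<in> I)"
      if "holomorphic2_at f ?p" for f
      unfolding consts_eq using coset_eq[OF that holomorphic2_at_const] by auto
    have "carrier ?Q = local_algebra_consts q h k \<longleftrightarrow>
        (\<lambda>f. I +>\<^bsub>?R\<^esub> germ ?p f) ` {f. holomorphic2_at f ?p} \<subseteq> local_algebra_consts q h k"
      unfolding c1 by (rule iffI, erule equalityD1, erule equalityI[OF _ c2])
    also have "\<dots> \<longleftrightarrow> (\<forall>f. holomorphic2_at f ?p \<longrightarrow> I +>\<^bsub>?R\<^esub> germ ?p f \<in> local_algebra_consts q h k)"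
      by (simp only: image_subset_iff Ball_def mem_Collect_eq)
    also have "\<dots> \<longleftrightarrow> (\<forall>f. holomorphic2_at f ?p \<longrightarrow> (\<exists>c. germ ?p (\<lambda>z. f z - c) \<in> I))"
      by (intro all_cong1 imp_cong refl mem)
    finally show ?thesis .
  qed
  also have "\<dots> \<longleftrightarrow> (\<forall>f. holomorphic2_at f ?p \<and> f ?p = 0 \<longrightarrow> germ ?p f \<in> I)"
  proof (intro iffI allI impI)
    fix f assume "\<forall>f. holomorphic2_at f ?p \<longrightarrow> (\<exists>c. germ ?p (\<lambda>z. f z - c) \<in> I)" "holomorphic2_at f ?p \<and> f ?p = 0"
    then obtain c where c: "germ ?p (\<lambda>z. f z - c) \<in> I" and f: "holomorphic2_at f ?p" "f ?p = 0" by blast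
    then have "f ?p - c = 0" by (intro I0[OF c] holomorphic2_at_diff holomorphic2_at_const)
    then show "germ ?p f \<in> I" using c f by simp
  next
    fix f assume all: "\<forall>f. holomorphic2_at f ?p \<and> f ?p = 0 \<longrightarrow> germ ?p f \<in> I" and f: "holomorphic2_at f ?p"
    have "germ ?p (\<lambda>z. f z - f ?p) \<in> I"
      using f by (intro all[rule_format]) (auto intro: holomorphic2_at_diff holomorphic2_at_const)
    then show "\<exists>c. germ ?p (\<lambda>z. f z - c) \<in> I" ..
  qed
  also have "\<dots> \<longleftrightarrow> cd1 H ?p * cd2 K ?p - cd2 H ?p * cd1 K ?p \<noteq> 0"
    unfolding I_def by (rule ideal_eq_maximal_iff_jacobian[OF hol(1) HK0(1) hol(2) HK0(2)])
  also have "cd1 H ?p * cd2 K ?p - cd2 H ?p * cd1 K ?p = of_real (pd1 h q * pd2 k q - pd2 h q * pd1 k q)"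
    using complexification_at[OF complexification_pd1[OF H]] complexification_at[OF complexification_pd2[OF H]]
      complexification_at[OF complexification_pd1[OF K]] complexification_at[OF complexification_pd2[OF K]] by simp
  finally show ?thesis by (simp only: of_real_eq_0_iff)
qed

text \<open>The relation \<open>e * a = f * b + g * c\<close> can be solved for \<open>a\<close> in the local ring, \<open>e\<close> being a unit. It holds
  for the complexified functions because both sides complexify the same real function.\<close>

lemma genideal_pair_subset:
  assumes X: "X \<in> complexification q a" "Y \<in> complexification q b" "Z \<in> complexification q c"
    and A: "A \<in> complexification q e" "B \<in> complexification q f" "C \<in> complexification q g" and ne: "e q \<noteq> 0"
    and eq: "\<And>z. e z * a z = f z * b z + g z * c z"
  shows "genideal (hol_germs (complex_point q)) {complexification q a, complexification q c}
    \<subseteq> genideal (hol_germs (complex_point q)) {complexification q b, complexification q c}"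
proof -
  let ?p = "complex_point q"
  let ?R = "hol_germs ?p"
  interpret cring ?R by (rule hol_germs_cring)
  let ?I = "genideal ?R {germ ?p Y, germ ?p Z}"
  have hol: "holomorphic2_at X ?p" "holomorphic2_at Y ?p" "holomorphic2_at Z ?p"
    "holomorphic2_at A ?p" "holomorphic2_at B ?p" "holomorphic2_at C ?p"
    using X A by (auto simp: complexification_def)
  have YZ: "{germ ?p Y, germ ?p Z} \<subseteq> carrier ?R" using hol germ_in_hol_germs by auto
  have I: "ideal ?I ?R" "germ ?p Y \<in> ?I" "germ ?p Z \<in> ?I"
    using genideal_ideal[OF YZ] genideal_self[OF YZ] by auto
  note I_mult = germ_ideal_closed(1)[OF I(1)] and I_add = germ_ideal_closed(2)[OF I(1)]
  have A0: "A ?p \<noteq> 0" using complexification_at[OF A(1)] ne by simp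
  have "(\<lambda>z. A z * X z) \<in> complexification q (\<lambda>z. f z * b z + g z * c z)"
    using complexification_mult[OF A(1) X(1)] by (simp add: eq)
  moreover have "(\<lambda>z. B z * Y z + C z * Z z) \<in> complexification q (\<lambda>z. f z * b z + g z * c z)"
    by (intro complexification_add complexification_mult X A)
  ultimately have "germ ?p (\<lambda>z. A z * X z) = germ ?p (\<lambda>z. B z * Y z + C z * Z z)"
    by (metis complexification_eq_germ)
  moreover have "germ ?p (\<lambda>z. B z * Y z + C z * Z z) \<in> ?I"
    by (intro I_add I_mult hol I)
  ultimately have "germ ?p (\<lambda>z. inverse (A z) * (A z * X z)) \<in> ?I"
    using I_mult[OF holomorphic2_at_inverse[OF hol(4) A0], of "\<lambda>z. A z * X z"] by simp
  moreover have "eventually (\<lambda>z. A z \<noteq> 0) (nhds ?p)"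
    by (rule holomorphic2_at_eventually_nonzero[OF hol(4) A0])
  then have "germ ?p (\<lambda>z. inverse (A z) * (A z * X z)) = germ ?p X"
    unfolding germ_eq_iff by eventually_elim simp
  ultimately have "germ ?p X \<in> ?I" by simp
  then show ?thesis
    unfolding complexification_eq_germ[OF X(1)] complexification_eq_germ[OF X(2)] complexification_eq_germ[OF X(3)]
    using I by (intro genideal_minimal) auto
qed

text \<open>This makes the clauses in \<open>umbilic_multiplicity\<close> agree where they overlap.\<close>

lemma multiplicity_at_exchange:
  assumes X: "X \<in> complexification q a" "Y \<in> complexification q b" "Z \<in> complexification q c"
    and A: "A \<in> complexification q e" "B \<in> complexification q f" "C \<in> complexification q g"
    and ne: "e q \<noteq> 0" "f q \<noteq> 0"
    and eq: "\<And>z. e z * a z = f z * b z + g z * c z"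
  shows "multiplicity_at q a c = multiplicity_at q b c"
proof -
  have eq': "f z * b z = e z * a z + (0 - g z) * c z" for z using eq[of z] by simp
  have C': "(\<lambda>z. of_real 0 - C z) \<in> complexification q (\<lambda>z. 0 - g z)"
    by (intro complexification_diff complexification_const A)
  have "genideal (hol_germs (complex_point q)) {complexification q a, complexification q c} =
    genideal (hol_germs (complex_point q)) {complexification q b, complexification q c}"
    by (rule equalityI[OF genideal_pair_subset[OF X A ne(1) eq]
        genideal_pair_subset[OF X(2,1,3) A(2,1) C' ne(2) eq']])
  then show ?thesis
    by (simp add: multiplicity_at_def local_algebra_def local_algebra_consts_def)
qed

lemma multiplicity_at_commute: "multiplicity_at q h k = multiplicity_at q k h"
  by (simp add: multiplicity_at_def local_algebra_def local_algebra_consts_def insert_commute)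

section \<open>Smooth functions of two real variables\<close>

lemma Ck_on_SucD: "Ck_on (Suc k) U f \<Longrightarrow> Ck_on k U f"
proof (induction k arbitrary: f)
  case 0
  then show ?case
    by (auto intro!: continuous_at_imp_continuous_on differentiable_imp_continuous_within)
next
  case (Suc k)
  then show ?case by simp
qed

lemma Ck_on_const: "Ck_on k U (\<lambda>_. c)"
  by (induction k arbitrary: c) (auto simp: frechet_derivative_const)

lemma Ck_on_bounded_linear_compose:
  assumes "open U" "bounded_linear L" "Ck_on k U f"
  shows "Ck_on k U (\<lambda>x. L (f x))"
  using assms(3)
proof (induction k arbitrary: f)
  case 0 then show ?case by (auto intro: bounded_linear.continuous_on[OF assms(2)])
next
  case (Suc k)
  show ?case
    by (rule Ck_on_SucI[OF assms(1) bounded_linear.has_derivative[OF assms(2) Ck_on_Suc_has_derivative[OF Suc.prems]]])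
       (assumption, rule Suc.IH[OF Ck_on_Suc_frechet_derivative[OF Suc.prems]])
qed

lemma Ck_on_linear:
  assumes "open U" "bounded_linear L" shows "Ck_on k U L"
proof (cases k)
  case 0 then show ?thesis using assms(2) by (simp add: linear_continuous_on)
next
  case (Suc m)
  then show ?thesis
    using Ck_on_SucI[OF assms(1) bounded_linear_imp_has_derivative[OF assms(2)] Ck_on_const] by simp
qed

lemma Ck_on_add:
  fixes f g :: "'a::real_normed_vector \<Rightarrow> 'b::real_normed_vector"
  assumes "open U" "Ck_on k U f" "Ck_on k U g"
  shows "Ck_on k U (\<lambda>x. f x + g x)"
  using assms(2,3)
proof (induction k arbitrary: f g)
  case 0 then show ?case by (auto intro: continuous_on_add)
next
  case (Suc k)
  note d = Ck_on_Suc_has_derivative[OF Suc.prems(1)] Ck_on_Suc_has_derivative[OF Suc.prems(2)]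
  show ?case
    by (rule Ck_on_SucI[OF assms(1) has_derivative_add[OF d]])
       (assumption, assumption, rule Suc.IH[OF Suc.prems[THEN Ck_on_Suc_frechet_derivative]])
qed

lemma Ck_on_mult:
  fixes f g :: "'a::real_normed_vector \<Rightarrow> real"
  assumes "open U" "Ck_on k U f" "Ck_on k U g"
  shows "Ck_on k U (\<lambda>x. f x * g x)"
  using assms(2,3)
proof (induction k arbitrary: f g)
  case 0 then show ?case by (auto intro: continuous_on_mult)
next
  case (Suc k)
  note d = Ck_on_Suc_has_derivative[OF Suc.prems(1)] Ck_on_Suc_has_derivative[OF Suc.prems(2)]
  note f = Ck_on_SucD[OF Suc.prems(1)] and f' = Ck_on_Suc_frechet_derivative[OF Suc.prems(1)]
    and g = Ck_on_SucD[OF Suc.prems(2)] and g' = Ck_on_Suc_frechet_derivative[OF Suc.prems(2)]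
  show ?case
    by (rule Ck_on_SucI[OF assms(1) has_derivative_mult[OF d]])
       (assumption, assumption, rule Ck_on_add[OF assms(1) Suc.IH[OF f g'] Suc.IH[OF f' g]])
qed

lemma Ck_on_pd: "Ck_on (Suc k) U g \<Longrightarrow> Ck_on k U (pd g h)"
  unfolding pd_def[abs_def] by (rule Ck_on_Suc_frechet_derivative)

text \<open>Directions are reduced to the two coordinate directions, the only ones for which partial
  derivatives of analytic functions are computed.\<close>

lemma has_derivative_pd:
  assumes "f differentiable (at z)"
  shows "(f has_derivative (\<lambda>h. fst h *\<^sub>R pd1 f z + snd h *\<^sub>R pd2 f z)) (at z)"
proof -
  have d: "(f has_derivative frechet_derivative f (at z)) (at z)"
    using assms by (simp add: frechet_derivative_works[symmetric])
  interpret bounded_linear "frechet_derivative f (at z)" by (rule has_derivative_bounded_linear[OF d])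
  have "frechet_derivative f (at z) h = fst h *\<^sub>R pd1 f z + snd h *\<^sub>R pd2 f z" for h
  proof -
    have "h = fst h *\<^sub>R (1, 0) + snd h *\<^sub>R (0, 1)" by (simp add: prod_eq_iff)
    then have "frechet_derivative f (at z) h = frechet_derivative f (at z) (fst h *\<^sub>R (1, 0) + snd h *\<^sub>R (0, 1))" by simp
    then show ?thesis unfolding pd_def add scaleR .
  qed
  then have "frechet_derivative f (at z) = (\<lambda>h. fst h *\<^sub>R pd1 f z + snd h *\<^sub>R pd2 f z)" by (rule ext)
  with d show ?thesis by simp
qed

lemma pd_eqI: "(f has_derivative D) (at z) \<Longrightarrow> pd f h z = D h"
  by (simp add: pd_def frechet_derivative_at[symmetric])

lemma Ck_on_compose:
  fixes f :: "real \<times> real \<Rightarrow> real" and \<phi> :: "real \<times> real \<Rightarrow> real \<times> real"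
  assumes "open U" "open V" "\<phi> ` U \<subseteq> V" "Ck_on k V f" "Ck_on k U \<phi>"
  shows "Ck_on k U (\<lambda>x. f (\<phi> x))"
  using assms(4,5)
proof (induction k arbitrary: f)
  case 0 then show ?case using assms(3) continuous_on_compose2 by auto
next
  case (Suc k)
  show ?case
  proof (rule Ck_on_SucI[OF assms(1)])
    fix x assume x: "x \<in> U"
    have "f differentiable (at (\<phi> x))" using Suc.prems(1) x assms(3) by auto
    from has_derivative_compose[OF Ck_on_Suc_has_derivative[OF Suc.prems(2) x] has_derivative_pd[OF this]]
    show "((\<lambda>x. f (\<phi> x)) has_derivative (\<lambda>v. fst (frechet_derivative \<phi> (at x) v) * pd1 f (\<phi> x)
      + snd (frechet_derivative \<phi> (at x) v) * pd2 f (\<phi> x))) (at x)" by simp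
  next
    fix v
    have 1: "Ck_on k U (\<lambda>x. pd f h (\<phi> x))" for h
      by (rule Suc.IH[OF Ck_on_pd[OF Suc.prems(1)] Ck_on_SucD[OF Suc.prems(2)]])
    have 2: "Ck_on k U (\<lambda>x. fst (frechet_derivative \<phi> (at x) v))" "Ck_on k U (\<lambda>x. snd (frechet_derivative \<phi> (at x) v))"
      by (rule Ck_on_bounded_linear_compose[OF assms(1) _ Ck_on_Suc_frechet_derivative[OF Suc.prems(2)]],
          rule bounded_linear_fst bounded_linear_snd)+
    show "Ck_on k U (\<lambda>x. fst (frechet_derivative \<phi> (at x) v) * pd1 f (\<phi> x)
      + snd (frechet_derivative \<phi> (at x) v) * pd2 f (\<phi> x))"
      by (rule Ck_on_add[OF assms(1) Ck_on_mult[OF assms(1) 2(1) 1] Ck_on_mult[OF assms(1) 2(2) 1]])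
  qed
qed

lemma smooth_at_const: "smooth_at (\<lambda>_. c) p"
  unfolding smooth_at_def using Ck_on_const by blast

lemma smooth_at_linear: "bounded_linear L \<Longrightarrow> smooth_at L p"
  unfolding smooth_at_def using Ck_on_linear open_UNIV by blast

lemma smooth_at_add:
  fixes f g :: "'a::real_normed_vector \<Rightarrow> 'b::real_normed_vector"
  assumes "smooth_at f p" "smooth_at g p"
  shows "smooth_at (\<lambda>x. f x + g x) p"
proof -
  obtain U V where UV: "open U" "p \<in> U" "\<And>k. Ck_on k U f" "open V" "p \<in> V" "\<And>k. Ck_on k V g"
    using assms unfolding smooth_at_def by blast
  have o: "open (U \<inter> V)" using UV by auto
  have "Ck_on k (U \<inter> V) (\<lambda>x. f x + g x)" for k
    by (intro Ck_on_add o Ck_on_subset[OF UV(3)] Ck_on_subset[OF UV(6)]) auto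
  then show ?thesis unfolding smooth_at_def using o UV by blast
qed

lemma smooth_at_mult:
  fixes f g :: "'a::real_normed_vector \<Rightarrow> real"
  assumes "smooth_at f p" "smooth_at g p"
  shows "smooth_at (\<lambda>x. f x * g x) p"
proof -
  obtain U V where UV: "open U" "p \<in> U" "\<And>k. Ck_on k U f" "open V" "p \<in> V" "\<And>k. Ck_on k V g"
    using assms unfolding smooth_at_def by blast
  have o: "open (U \<inter> V)" using UV by auto
  have "Ck_on k (U \<inter> V) (\<lambda>x. f x * g x)" for k
    by (intro Ck_on_mult o Ck_on_subset[OF UV(3)] Ck_on_subset[OF UV(6)]) auto
  then show ?thesis unfolding smooth_at_def using o UV by blast
qed

lemma smooth_at_diff:
  fixes f g :: "'a::real_normed_vector \<Rightarrow> real"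
  assumes "smooth_at f p" "smooth_at g p"
  shows "smooth_at (\<lambda>x. f x - g x) p"
  using smooth_at_add[OF assms(1) smooth_at_mult[OF smooth_at_const[of "-1"] assms(2)]] by simp

lemma smooth_at_power:
  fixes f :: "'a::real_normed_vector \<Rightarrow> real"
  assumes "smooth_at f p" shows "smooth_at (\<lambda>x. f x ^ n) p"
  by (induction n) (auto intro: smooth_at_const smooth_at_mult assms)

lemma smooth_at_bounded_linear_compose:
  assumes "bounded_linear L" "smooth_at f p" shows "smooth_at (\<lambda>x. L (f x)) p"
  using assms Ck_on_bounded_linear_compose unfolding smooth_at_def by blast

lemma smooth_at_coordinates: "smooth_at fst p" "smooth_at snd p"
  by (intro smooth_at_linear bounded_linear_fst bounded_linear_snd)+

lemma smooth_at_pd: "smooth_at f p \<Longrightarrow> smooth_at (pd f h) p"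
  unfolding smooth_at_def pd_def[abs_def] by (metis Ck_on.simps(2))

lemma smooth_at_imp_differentiable: "smooth_at f p \<Longrightarrow> eventually (\<lambda>z. f differentiable (at z)) (nhds p)"
  unfolding smooth_at_def eventually_nhds by (metis Ck_on.simps(2))

lemma smooth_at_imp_differentiable_at: "smooth_at f p \<Longrightarrow> f differentiable (at p)"
  using smooth_at_imp_differentiable eventually_nhds_x_imp_x by blast

lemma smooth_at_filterlim: "smooth_at f p \<Longrightarrow> filterlim f (nhds (f p)) (nhds p)"
  using smooth_at_imp_differentiable_at differentiable_imp_continuous_within
  by (metis isCont_def tendsto_at_iff_tendsto_nhds)

lemma smooth_at_compose:
  fixes f :: "real \<times> real \<Rightarrow> real" and \<phi> :: "real \<times> real \<Rightarrow> real \<times> real"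
  assumes "smooth_at f (\<phi> p)" "smooth_at \<phi> p"
  shows "smooth_at (\<lambda>x. f (\<phi> x)) p"
proof -
  obtain U V where UV: "open U" "p \<in> U" "\<And>k. Ck_on k U \<phi>" "open V" "\<phi> p \<in> V" "\<And>k. Ck_on k V f"
    using assms unfolding smooth_at_def by blast
  have o: "open (U \<inter> \<phi> -` V)"
    using UV(3)[of 0] by (intro continuous_open_preimage UV) simp
  have "Ck_on k (U \<inter> \<phi> -` V) (\<lambda>x. f (\<phi> x))" for k
    by (rule Ck_on_compose[OF o UV(4) _ UV(6) Ck_on_subset[OF UV(3)]]) auto
  then show ?thesis unfolding smooth_at_def using o UV by blast
qed

lemma smooth_at_translation:
  assumes "smooth_at f (q + p)" shows "smooth_at (\<lambda>z. f (q + z)) (p :: 'a::real_normed_vector)"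
proof -
  obtain U where U: "open U" "q + p \<in> U" "\<And>k. Ck_on k U f" using assms unfolding smooth_at_def by blast
  have sh: "((\<lambda>z. q + z) has_derivative (\<lambda>h. h)) (at x)" for x :: 'a
    by (auto intro!: derivative_eq_intros)
  have o: "open ((\<lambda>z. q + z) -` U)" by (intro open_vimage U) (auto intro!: continuous_intros)
  have "Ck_on k ((\<lambda>z. q + z) -` U) (\<lambda>z. f (q + z))" if "Ck_on k U f" for k f
    using that
  proof (induction k arbitrary: f)
    case 0 then show ?case by (auto intro!: continuous_on_compose2[of U f] continuous_intros)
  next
    case (Suc k)
    show ?case
      by (rule Ck_on_SucI[OF o has_derivative_compose[OF sh Ck_on_Suc_has_derivative[OF Suc.prems]]])
         (simp, rule Suc.IH[OF Ck_on_Suc_frechet_derivative[OF Suc.prems]])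
  qed
  with U o show ?thesis unfolding smooth_at_def by blast
qed

lemmas smooth_at_intros = smooth_at_const smooth_at_add smooth_at_diff smooth_at_mult smooth_at_power
  smooth_at_coordinates smooth_at_pd

lemma pd_cong:
  assumes "eventually (\<lambda>z. f z = g z) (nhds p)"
  shows "pd f h p = pd g h p"
proof -
  obtain S where S: "open S" "p \<in> S" "\<And>z. z \<in> S \<Longrightarrow> f z = g z" using assms unfolding eventually_nhds by blast
  have "(f has_derivative D) (at p) \<longleftrightarrow> (g has_derivative D) (at p)" for D
    by (rule iffI; erule has_derivative_transform_within_open[OF _ S(1,2)]) (simp_all add: S(3))
  then show ?thesis by (simp add: pd_def frechet_derivative_def)
qed

lemma pd_cong_eventually:
  assumes "eventually (\<lambda>z. f z = g z) (nhds p)"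
  shows "eventually (\<lambda>z. pd f h z = pd g h z) (nhds p)"
  by (rule eventually_mono[OF eventually_eventually[THEN iffD2, OF assms]]) (rule pd_cong)

lemma pd_add:
  assumes "f differentiable (at z)" "g differentiable (at z)"
  shows "pd (\<lambda>z. f z + g z) h z = pd f h z + pd g h z"
  unfolding pd_def[of f] pd_def[of g]
  by (rule pd_eqI, rule has_derivative_add) (use assms in \<open>simp_all add: frechet_derivative_works[symmetric]\<close>)

lemma pd_diff:
  assumes "f differentiable (at z)" "g differentiable (at z)"
  shows "pd (\<lambda>z. f z - g z) h z = pd f h z - pd g h z"
  unfolding pd_def[of f] pd_def[of g]
  by (rule pd_eqI, rule has_derivative_diff) (use assms in \<open>simp_all add: frechet_derivative_works[symmetric]\<close>)

lemma pd_mult: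
  fixes f g :: "real \<times> real \<Rightarrow> real"
  assumes "f differentiable (at z)" "g differentiable (at z)"
  shows "pd (\<lambda>z. f z * g z) h z = f z * pd g h z + pd f h z * g z"
  unfolding pd_def[of f] pd_def[of g]
  by (rule pd_eqI, rule has_derivative_mult) (use assms in \<open>simp_all add: frechet_derivative_works[symmetric]\<close>)

lemma pd_const: "pd (\<lambda>_. c) h z = 0"
  by (simp add: pd_def frechet_derivative_const)

lemma pd_translation: "pd (\<lambda>z. f (q + z)) h z = pd f h (q + z)"
proof -
  have "((\<lambda>z. f (q + z)) has_derivative D) (at z) \<longleftrightarrow> (f has_derivative D) (at (q + z))" for D
  proof
    assume "((\<lambda>z. f (q + z)) has_derivative D) (at z)"
    moreover have "((\<lambda>y. y - q) has_derivative (\<lambda>h. h)) (at (q + z))" by (auto intro!: derivative_eq_intros)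
    ultimately show "(f has_derivative D) (at (q + z))"
      using has_derivative_compose[where f = "\<lambda>y. y - q" and g = "\<lambda>z. f (q + z)" and x = "q + z" and s = UNIV and f' = "\<lambda>h. h" and g' = D] by simp
  next
    assume "(f has_derivative D) (at (q + z))"
    moreover have "((\<lambda>y. q + y) has_derivative (\<lambda>h. h)) (at z)" by (auto intro!: derivative_eq_intros)
    ultimately show "((\<lambda>z. f (q + z)) has_derivative D) (at z)"
      by (rule has_derivative_compose[where g = f and g' = D and f' = "\<lambda>h. h", rotated])
  qed
  then show ?thesis by (simp add: pd_def frechet_derivative_def)
qed

lemma pd_compose:
  fixes f :: "real \<times> real \<Rightarrow> real" and \<phi> :: "real \<times> real \<Rightarrow> real \<times> real"
  assumes "f differentiable (at (\<phi> z))" "\<phi> differentiable (at z)"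
  shows "pd (\<lambda>z. f (\<phi> z)) h z = fst (pd \<phi> h z) * pd1 f (\<phi> z) + snd (pd \<phi> h z) * pd2 f (\<phi> z)"
proof (rule pd_eqI)
  have "(\<phi> has_derivative (\<lambda>h. pd \<phi> h z)) (at z)"
    unfolding pd_def by (use assms in \<open>simp add: frechet_derivative_works[symmetric]\<close>)
  from has_derivative_compose[OF this has_derivative_pd[OF assms(1)]]
  show "((\<lambda>z. f (\<phi> z)) has_derivative (\<lambda>h. fst (pd \<phi> h z) * pd1 f (\<phi> z) + snd (pd \<phi> h z) * pd2 f (\<phi> z))) (at z)"
    by simp
qed

lemma smooth_at_fst: "smooth_at f p \<Longrightarrow> smooth_at (\<lambda>x. fst (f x)) p"
  and smooth_at_snd: "smooth_at f p \<Longrightarrow> smooth_at (\<lambda>x. snd (f x)) p"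
  by (rule smooth_at_bounded_linear_compose[OF bounded_linear_fst], assumption)
     (rule smooth_at_bounded_linear_compose[OF bounded_linear_snd])

section \<open>Taylor expansion of smooth germs\<close>

text \<open>Weighted means over the segment from the origin to \<open>z\<close>. The mean with \<open>j = 0\<close> is the quotient
  function in Hadamard's lemma, and each differentiation raises \<open>j\<close> by one.\<close>

definition radial_mean :: "nat \<Rightarrow> (real \<times> real \<Rightarrow> real) \<Rightarrow> real \<times> real \<Rightarrow> real" where
  "radial_mean j g z = integral {0..1} (\<lambda>t. t ^ j * g (t *\<^sub>R z))"

lemma scaleR_in_ball_0:
  fixes z :: "'a::real_normed_vector"
  assumes "z \<in> ball 0 r" "t \<in> {0..1 :: real}" shows "t *\<^sub>R z \<in> ball 0 r"
proof -
  have "norm (t *\<^sub>R z) \<le> norm z" using assms(2) by (simp add: mult_left_le_one_le)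
  then show ?thesis using assms(1) by auto
qed

lemma continuous_on_radial:
  assumes "continuous_on (ball 0 r) g"
  shows "continuous_on (ball 0 r \<times> {0..1}) (\<lambda>p. snd p ^ j * g (snd p *\<^sub>R fst p :: real \<times> real) :: real)"
proof (intro continuous_intros continuous_on_compose2[OF assms, of _ "\<lambda>p. snd p *\<^sub>R fst p"])
  show "(\<lambda>p. snd p *\<^sub>R fst p) ` (ball 0 r \<times> {0..1}) \<subseteq> (ball 0 r :: (real \<times> real) set)"
    by (rule image_subsetI, rule scaleR_in_ball_0) auto
qed

lemma continuous_on_radial_slice:
  assumes "continuous_on (ball 0 r) g" "z \<in> ball 0 r"
  shows "continuous_on {0..1} (\<lambda>t. t ^ j * g (t *\<^sub>R z :: real \<times> real) :: real)"
  by (rule continuous_on_compose2[OF continuous_on_radial[OF assms(1)], of _ "\<lambda>t. (z, t)", simplified])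
     (use assms(2) in \<open>auto intro!: continuous_intros\<close>)

text \<open>Differentiation under the integral sign; the inner derivative of \<open>t *\<^sub>R z\<close> contributes the
  additional factor \<open>t\<close>.\<close>

lemma radial_mean_has_derivative:
  assumes g: "Ck_on 1 (ball 0 r) g" and z: "z \<in> ball 0 r"
  shows "(radial_mean j g has_derivative
      (\<lambda>h. fst h * radial_mean (Suc j) (pd1 g) z + snd h * radial_mean (Suc j) (pd2 g) z)) (at z)"
proof -
  have dg: "g differentiable (at x)" if "x \<in> ball 0 r" for x using g that by simp
  have cg: "continuous_on (ball 0 r) g" using dg differentiable_imp_continuous_within
    by (intro continuous_at_imp_continuous_on ballI) blast
  have c1: "continuous_on (ball 0 r) (pd g h)" for h
    using g unfolding One_nat_def Ck_on.simps pd_def[abs_def] by blast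
  let ?D = "\<lambda>z t. (t ^ Suc j * pd1 g (t *\<^sub>R z)) *\<^sub>R fst_blinfun + (t ^ Suc j * pd2 g (t *\<^sub>R z)) *\<^sub>R snd_blinfun :: (real \<times> real) \<Rightarrow>\<^sub>L real"
  have "((\<lambda>z. integral (cbox 0 1) (\<lambda>t. t ^ j * g (t *\<^sub>R z))) has_derivative
      blinfun_apply (integral (cbox 0 1) (?D z))) (at z within ball 0 r)"
  proof (rule leibniz_rule[OF _ _ _ z convex_ball])
    fix x and t :: real assume x: "x \<in> ball (0 :: real \<times> real) r" and t: "t \<in> cbox 0 1"
    then have "t *\<^sub>R x \<in> ball 0 r" by (intro scaleR_in_ball_0) auto
    from has_derivative_pd[OF dg[OF this]]
    have "(g has_derivative (\<lambda>h. fst h *\<^sub>R pd1 g (t *\<^sub>R x) + snd h *\<^sub>R pd2 g (t *\<^sub>R x))) (at (t *\<^sub>R x))" .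
    moreover have "((\<lambda>x. t *\<^sub>R x) has_derivative (\<lambda>h. t *\<^sub>R h)) (at x)"
      by (auto intro!: derivative_eq_intros)
    ultimately have "((\<lambda>x. g (t *\<^sub>R x)) has_derivative
        (\<lambda>h. fst (t *\<^sub>R h) *\<^sub>R pd1 g (t *\<^sub>R x) + snd (t *\<^sub>R h) *\<^sub>R pd2 g (t *\<^sub>R x))) (at x)"
      by (rule has_derivative_compose[rotated])
    then have "((\<lambda>x. t ^ j * g (t *\<^sub>R x)) has_derivative
        (\<lambda>h. t ^ j * (fst (t *\<^sub>R h) *\<^sub>R pd1 g (t *\<^sub>R x) + snd (t *\<^sub>R h) *\<^sub>R pd2 g (t *\<^sub>R x)))) (at x)"
      by (rule has_derivative_mult_right)
    then have "((\<lambda>x. t ^ j * g (t *\<^sub>R x)) has_derivative blinfun_apply (?D x t)) (at x)"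
      by (rule has_derivative_eq_rhs) (auto simp: fun_eq_iff blinfun.bilinear_simps algebra_simps)
    then show "((\<lambda>x. t ^ j * g (t *\<^sub>R x)) has_derivative blinfun_apply (?D x t)) (at x within ball 0 r)"
      by (rule has_derivative_at_withinI)
  next
    fix x :: "real \<times> real" assume x: "x \<in> ball 0 r"
    show "(\<lambda>t. t ^ j * g (t *\<^sub>R x)) integrable_on cbox 0 1"
      using continuous_on_radial_slice[OF cg x] by (intro integrable_continuous) simp
  next
    show "continuous_on (ball 0 r \<times> cbox 0 1) (\<lambda>(z, t). ?D z t)"
      unfolding split_beta cbox_interval
      by (intro continuous_on_add continuous_on_scaleR continuous_on_const continuous_on_radial c1)
  qed
  then have 1: "(radial_mean j g has_derivative blinfun_apply (integral {0..1} (?D z))) (at z)"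
    unfolding at_within_open[OF z open_ball] radial_mean_def[abs_def] cbox_interval .
  have "(?D z has_integral radial_mean (Suc j) (pd1 g) z *\<^sub>R fst_blinfun + radial_mean (Suc j) (pd2 g) z *\<^sub>R snd_blinfun) {0..1}"
    unfolding radial_mean_def
    by (intro has_integral_add has_integral_scaleR_left integrable_integral integrable_continuous_interval
          continuous_on_radial_slice[OF c1 z])
  then have "integral {0..1} (?D z) = radial_mean (Suc j) (pd1 g) z *\<^sub>R fst_blinfun + radial_mean (Suc j) (pd2 g) z *\<^sub>R snd_blinfun"
    by (rule integral_unique)
  with 1 show ?thesis
    by (auto elim!: has_derivative_eq_rhs simp: fun_eq_iff blinfun.bilinear_simps)
qed

lemma Ck_on_radial_mean:
  assumes "\<And>k. Ck_on k (ball 0 r) g"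
  shows "Ck_on k (ball 0 r) (radial_mean j g)"
  using assms
proof (induction k arbitrary: g j)
  case 0
  then show ?case
    using has_derivative_continuous[OF radial_mean_has_derivative[OF 0[of 1]]]
    by (auto intro!: continuous_at_imp_continuous_on)
next
  case (Suc k)
  have g': "Ck_on k (ball 0 r) (radial_mean (Suc j) (pd g h))" for h
    by (rule Suc.IH) (rule Ck_on_pd[OF Suc.prems])
  show ?case
    by (rule Ck_on_SucI[OF open_ball radial_mean_has_derivative[OF Suc.prems]])
       (assumption, rule Ck_on_add[OF open_ball Ck_on_mult[OF open_ball Ck_on_const g'] Ck_on_mult[OF open_ball Ck_on_const g']])
qed

text \<open>Besides the quotients, the statement records their 1-jets at the origin, so that iterating it
  gives the Taylor polynomial with the usual coefficients. The factor \<open>1/2\<close> is the integral of \<open>t\<close> over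
  the unit interval.\<close>

lemma smooth_at_0_hadamard:
  assumes "smooth_at g (0 :: real \<times> real)"
  obtains g1 g2 where "smooth_at g1 0" "smooth_at g2 0"
    "eventually (\<lambda>z. g z = g 0 + fst z * g1 z + snd z * g2 z) (nhds 0)"
    "g1 0 = pd1 g 0" "g2 0 = pd2 g 0"
    "pd1 g1 0 = pd1 (pd1 g) 0 / 2" "pd2 g1 0 = pd2 (pd1 g) 0 / 2"
    "pd1 g2 0 = pd1 (pd2 g) 0 / 2" "pd2 g2 0 = pd2 (pd2 g) 0 / 2"
proof -
  obtain U where U: "open U" "0 \<in> U" "\<And>k. Ck_on k U g" using assms unfolding smooth_at_def by blast
  then obtain r where r: "r > 0" "ball 0 r \<subseteq> U" using open_contains_ball by blast
  have g: "Ck_on k (ball 0 r) g" for k by (rule Ck_on_subset[OF U(3) r(2)])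
  have g': "Ck_on k (ball 0 r) (pd g h)" for k h by (rule Ck_on_pd[OF g])
  have 0: "(0 :: real \<times> real) \<in> ball 0 r" using r by simp
  have "smooth_at (radial_mean 0 (pd g h)) 0" for h
    unfolding smooth_at_def using Ck_on_radial_mean[OF g'] 0 by blast
  moreover have "g z = g 0 + fst z * radial_mean 0 (pd1 g) z + snd z * radial_mean 0 (pd2 g) z" if z: "z \<in> ball 0 r" for z
  proof -
    have "((\<lambda>t. fst z * pd1 g (t *\<^sub>R z) + snd z * pd2 g (t *\<^sub>R z)) has_integral g (1 *\<^sub>R z) - g (0 *\<^sub>R z)) {0..1}"
    proof (rule fundamental_theorem_of_calculus)
      fix t :: real assume t: "t \<in> {0..1}"
      have "g differentiable (at (t *\<^sub>R z))" using g[of 1] scaleR_in_ball_0[OF z t] by simp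
      from has_derivative_pd[OF this]
      have "((\<lambda>t. g (t *\<^sub>R z)) has_derivative (\<lambda>s. fst (s *\<^sub>R z) *\<^sub>R pd1 g (t *\<^sub>R z) + snd (s *\<^sub>R z) *\<^sub>R pd2 g (t *\<^sub>R z))) (at t)"
        by (rule has_derivative_compose[rotated]) (auto intro!: derivative_eq_intros)
      then have "((\<lambda>t. g (t *\<^sub>R z)) has_vector_derivative fst z * pd1 g (t *\<^sub>R z) + snd z * pd2 g (t *\<^sub>R z)) (at t)"
        unfolding has_vector_derivative_def by (rule has_derivative_eq_rhs) (auto simp: algebra_simps)
      then show "((\<lambda>t. g (t *\<^sub>R z)) has_vector_derivative fst z * pd1 g (t *\<^sub>R z) + snd z * pd2 g (t *\<^sub>R z)) (at t within {0..1})"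
        by (rule has_vector_derivative_at_within)
    qed simp
    moreover have "((\<lambda>t. fst z * (t ^ 0 * pd1 g (t *\<^sub>R z)) + snd z * (t ^ 0 * pd2 g (t *\<^sub>R z))) has_integral
        fst z * radial_mean 0 (pd1 g) z + snd z * radial_mean 0 (pd2 g) z) {0..1}"
      unfolding radial_mean_def
      by (intro has_integral_add has_integral_mult_right integrable_integral integrable_continuous_interval
          continuous_on_radial_slice[OF g'[of 0, unfolded Ck_on.simps] z])
    ultimately have "g (1 *\<^sub>R z) - g (0 *\<^sub>R z) = fst z * radial_mean 0 (pd1 g) z + snd z * radial_mean 0 (pd2 g) z"
      by (auto intro: has_integral_unique)
    then show ?thesis by simp
  qed
  then have "eventually (\<lambda>z. g z = g 0 + fst z * radial_mean 0 (pd1 g) z + snd z * radial_mean 0 (pd2 g) z) (nhds 0)"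
    unfolding eventually_nhds using 0 open_ball by blast
  moreover have mean0: "radial_mean 0 f 0 = f 0" for f by (simp add: radial_mean_def)
  moreover have mean1: "radial_mean 1 f 0 = f 0 / 2" for f
  proof -
    have "((\<lambda>t::real. t * f 0) has_integral (1\<^sup>2 - 0\<^sup>2) / 2 * f 0) {0..1}"
      by (intro has_integral_mult_left ident_has_integral) simp
    then show ?thesis by (auto simp: radial_mean_def intro!: integral_unique)
  qed
  moreover have "pd1 (radial_mean 0 (pd g h)) 0 = pd1 (pd g h) 0 / 2" "pd2 (radial_mean 0 (pd g h)) 0 = pd2 (pd g h) 0 / 2" for h
    using pd_eqI[OF radial_mean_has_derivative[OF g' 0], where h = "(1, 0)"]
      pd_eqI[OF radial_mean_has_derivative[OF g' 0], where h = "(0, 1)"] by (simp_all add: mean1[unfolded One_nat_def])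
  ultimately show thesis
    by (intro that[of "radial_mean 0 (pd1 g)" "radial_mean 0 (pd2 g)"])
qed

text \<open>Membership in the third power of the maximal ideal of smooth germs.\<close>

definition cubic_at_0 :: "(real \<times> real \<Rightarrow> real) \<Rightarrow> bool" where
  "cubic_at_0 f \<longleftrightarrow> (\<exists>r0 r1 r2 r3. smooth_at r0 0 \<and> smooth_at r1 0 \<and> smooth_at r2 0 \<and> smooth_at r3 0 \<and>
     eventually (\<lambda>(u, v). f (u, v) = u^3 * r0 (u, v) + u^2 * v * r1 (u, v) + u * v^2 * r2 (u, v) + v^3 * r3 (u, v)) (nhds 0))"

definition taylor2 :: "(real \<times> real \<Rightarrow> real) \<Rightarrow> real \<times> real \<Rightarrow> real" where
  "taylor2 g z = g 0 + pd1 g 0 * fst z + pd2 g 0 * snd z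
    + pd1 (pd1 g) 0 / 2 * fst z ^ 2 + (pd2 (pd1 g) 0 + pd1 (pd2 g) 0) / 2 * (fst z * snd z) + pd2 (pd2 g) 0 / 2 * snd z ^ 2"

text \<open>Hadamard's lemma is applied three times: to the function, to its two quotients, and to the four
  quotients of these.\<close>

lemma cubic_at_0_minus_taylor2:
  assumes "smooth_at g 0" shows "cubic_at_0 (\<lambda>z. g z - taylor2 g z)"
proof -
  obtain g1 g2 where g: "smooth_at g1 0" "smooth_at g2 0"
    "eventually (\<lambda>z. g z = g 0 + fst z * g1 z + snd z * g2 z) (nhds 0)"
    "g1 0 = pd1 g 0" "g2 0 = pd2 g 0"
    "pd1 g1 0 = pd1 (pd1 g) 0 / 2" "pd2 g1 0 = pd2 (pd1 g) 0 / 2"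
    "pd1 g2 0 = pd1 (pd2 g) 0 / 2" "pd2 g2 0 = pd2 (pd2 g) 0 / 2"
    by (rule smooth_at_0_hadamard[OF assms])
  obtain g11 g12 where g1: "smooth_at g11 0" "smooth_at g12 0"
    "eventually (\<lambda>z. g1 z = g1 0 + fst z * g11 z + snd z * g12 z) (nhds 0)"
    "g11 0 = pd1 g1 0" "g12 0 = pd2 g1 0"
    by (rule smooth_at_0_hadamard[OF g(1)])
  obtain g21 g22 where g2: "smooth_at g21 0" "smooth_at g22 0"
    "eventually (\<lambda>z. g2 z = g2 0 + fst z * g21 z + snd z * g22 z) (nhds 0)"
    "g21 0 = pd1 g2 0" "g22 0 = pd2 g2 0"
    by (rule smooth_at_0_hadamard[OF g(2)])
  obtain a1 b1 where 1: "smooth_at a1 0" "smooth_at b1 0"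
    "eventually (\<lambda>z. g11 z = g11 0 + fst z * a1 z + snd z * b1 z) (nhds 0)"
    by (rule smooth_at_0_hadamard[OF g1(1)])
  obtain a2 b2 where 2: "smooth_at a2 0" "smooth_at b2 0"
    "eventually (\<lambda>z. g12 z = g12 0 + fst z * a2 z + snd z * b2 z) (nhds 0)"
    by (rule smooth_at_0_hadamard[OF g1(2)])
  obtain a3 b3 where 3: "smooth_at a3 0" "smooth_at b3 0"
    "eventually (\<lambda>z. g21 z = g21 0 + fst z * a3 z + snd z * b3 z) (nhds 0)"
    by (rule smooth_at_0_hadamard[OF g2(1)])
  obtain a4 b4 where 4: "smooth_at a4 0" "smooth_at b4 0"
    "eventually (\<lambda>z. g22 z = g22 0 + fst z * a4 z + snd z * b4 z) (nhds 0)"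
    by (rule smooth_at_0_hadamard[OF g2(2)])
  show ?thesis
    unfolding cubic_at_0_def
  proof (intro exI conjI)
    show "eventually (\<lambda>(u, v). g (u, v) - taylor2 g (u, v)
      = u^3 * a1 (u, v) + u^2 * v * (\<lambda>z. b1 z + (a2 z + a3 z)) (u, v)
        + u * v^2 * (\<lambda>z. b2 z + (b3 z + a4 z)) (u, v) + v^3 * b4 (u, v)) (nhds 0)"
      using g(3) g1(3) g2(3) 1(3) 2(3) 3(3) 4(3)
    proof eventually_elim
      case (elim z)
      obtain u v where z: "z = (u, v)" by (cases z)
      have e1: "g1 z = pd1 g 0 + u * (pd1 (pd1 g) 0 / 2 + u * a1 z + v * b1 z) + v * (pd2 (pd1 g) 0 / 2 + u * a2 z + v * b2 z)"
        using elim(2,4,5) g g1 by (simp add: z)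
      have e2: "g2 z = pd2 g 0 + u * (pd1 (pd2 g) 0 / 2 + u * a3 z + v * b3 z) + v * (pd2 (pd2 g) 0 / 2 + u * a4 z + v * b4 z)"
        using elim(3,6,7) g g2 by (simp add: z)
      have "g z = g 0 + u * g1 z + v * g2 z" using elim(1) by (simp add: z)
      then show ?case unfolding e1 e2 taylor2_def by (simp add: z field_simps power2_eq_square power3_eq_cube)
    qed
  qed (intro smooth_at_intros 1 2 3 4)+
qed

section \<open>The D4 singularities\<close>

definition in_jacobian_ideal :: "(real \<times> real \<Rightarrow> real) \<Rightarrow> (real \<times> real \<Rightarrow> real) \<Rightarrow> bool" where
  "in_jacobian_ideal f g \<longleftrightarrow> (\<exists>\<alpha> \<beta>. smooth_at \<alpha> 0 \<and> smooth_at \<beta> 0 \<and>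
     eventually (\<lambda>z. g z = \<alpha> z * pd1 f z + \<beta> z * pd2 f z) (nhds 0))"

text \<open>For \<open>\<epsilon> = 1\<close> and \<open>\<epsilon> = -1\<close> these are the two normal forms of a D4 singularity. The parameter
  allows both signs to be treated at once.\<close>

definition D4_germ :: "real \<Rightarrow> real \<times> real \<Rightarrow> real" where
  "D4_germ \<epsilon> = (\<lambda>(s, t). s ^ 2 * t + \<epsilon> * t ^ 3)"

lemma has_derivative_D4_germ:
  "(D4_germ \<epsilon> has_derivative (\<lambda>h. fst h * (2 * fst z * snd z) + snd h * (fst z ^ 2 + 3 * \<epsilon> * snd z ^ 2))) (at z)"
  unfolding D4_germ_def split_beta
  by (auto intro!: derivative_eq_intros simp: algebra_simps power2_eq_square)

lemma pd_D4_germ: "pd1 (D4_germ \<epsilon>) z = 2 * fst z * snd z" "pd2 (D4_germ \<epsilon>) z = fst z ^ 2 + 3 * \<epsilon> * snd z ^ 2"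
  by (simp_all add: pd_eqI[OF has_derivative_D4_germ])

lemma differentiable_D4_germ: "D4_germ \<epsilon> differentiable (at z)"
  using has_derivative_D4_germ unfolding differentiable_def by blast

lemma smooth_at_0_filterlim:
  assumes "\<phi> 0 = 0" "smooth_at \<phi> (0 :: real \<times> real)"
  shows "filterlim \<phi> (nhds 0) (nhds 0)"
  using smooth_at_filterlim[OF assms(2)] assms(1) by simp

text \<open>Near the origin \<open>f\<close> is \<open>f 0\<close> plus a form of degree three in the components of a map that vanishes at the
  origin. Its first derivative is therefore a sum of products of two vanishing functions, and
  differentiating such a product once more still gives zero.\<close>

lemma D4_two_jet_vanishes:
  assumes f: "smooth_at f (0 :: real \<times> real)" and R: "R_equivalent (\<lambda>z. f z - f 0) (D4_germ \<epsilon>)"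
  shows "pd f h 0 = 0" and "pd (pd f h) k 0 = 0"
proof -
  obtain \<phi> where \<phi>: "diffeo_germ_at_0 \<phi>" and g: "eventually (\<lambda>z. f (\<phi> z) - f 0 = D4_germ \<epsilon> z) (nhds 0)"
    using R unfolding R_equivalent_def by blast
  obtain \<psi> where \<psi>: "\<psi> 0 = 0" "smooth_at \<psi> 0" and inv: "eventually (\<lambda>z. \<phi> (\<psi> z) = z) (nhds 0)"
    using \<phi> unfolding diffeo_germ_at_0_def by blast
  have "eventually (\<lambda>z. f z = f 0 + D4_germ \<epsilon> (\<psi> z)) (nhds 0)"
    using eventually_compose_filterlim[OF g smooth_at_0_filterlim[OF \<psi>]] inv
    by eventually_elim (simp add: algebra_simps)
  then have e1: "eventually (\<lambda>z. pd f h z = pd (\<lambda>z. f 0 + D4_germ \<epsilon> (\<psi> z)) h z) (nhds 0)"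
    by (rule pd_cong_eventually)
  let ?a = "\<lambda>z. fst (pd \<psi> h z)" and ?b = "\<lambda>z. snd (pd \<psi> h z)" and ?X = "\<lambda>z. fst (\<psi> z)" and ?Y = "\<lambda>z. snd (\<psi> z)"
  \<comment> \<open>\<open>pd f h = ?X * ?A + ?Y * ?B\<close> near the origin, and all four factors vanish at the origin\<close>
  let ?A = "\<lambda>z. 2 * ?a z * ?Y z + ?b z * ?X z" and ?B = "\<lambda>z. 3 * \<epsilon> * ?b z * ?Y z"
  have e2: "eventually (\<lambda>z. pd f h z = ?X z * ?A z + ?Y z * ?B z) (nhds 0)"
    using e1 smooth_at_imp_differentiable[OF \<psi>(2)]
  proof eventually_elim
    case (elim z)
    have "(\<lambda>z. D4_germ \<epsilon> (\<psi> z)) differentiable (at z)"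
      using differentiable_chain_at[OF elim(2) differentiable_D4_germ] by (simp add: o_def)
    then have "pd f h z = pd (\<lambda>z. D4_germ \<epsilon> (\<psi> z)) h z"
      using elim(1) by (simp add: pd_add pd_const)
    also have "\<dots> = ?a z * (2 * ?X z * ?Y z) + ?b z * (?X z ^ 2 + 3 * \<epsilon> * ?Y z ^ 2)"
      by (simp add: pd_compose[OF differentiable_D4_germ elim(2)] pd_D4_germ)
    finally show ?case by (simp add: algebra_simps power2_eq_square)
  qed
  show "pd f h 0 = 0" using eventually_nhds_x_imp_x[OF e2] \<psi>(1) by simp
  have X: "smooth_at ?X 0" "smooth_at ?Y 0" "smooth_at ?a 0" "smooth_at ?b 0"
    by (intro smooth_at_fst smooth_at_snd \<psi>(2) smooth_at_pd)+
  have AB: "smooth_at ?A 0" "smooth_at ?B 0" by (intro smooth_at_intros X)+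
  have "pd (pd f h) k 0 = pd (\<lambda>z. ?X z * ?A z + ?Y z * ?B z) k 0" by (rule pd_cong[OF e2])
  also have "\<dots> = pd (\<lambda>z. ?X z * ?A z) k 0 + pd (\<lambda>z. ?Y z * ?B z) k 0"
    by (intro pd_add smooth_at_imp_differentiable_at smooth_at_mult X AB)
  also have "\<dots> = 0"
    by (subst (1 2) pd_mult) (use X AB \<psi>(1) in \<open>auto intro: smooth_at_imp_differentiable_at\<close>)
  finally show "pd (pd f h) k 0 = 0" .
qed

text \<open>For the normal form, each of the monomials \<open>s^3\<close>, \<open>s^2 t\<close>, \<open>s t^2\<close>, \<open>t^3\<close> is a combination with linear
  coefficients of the partial derivatives \<open>2 s t\<close> and \<open>s^2 + 3 \<epsilon> t^2\<close>. The property is invariant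
  under changes of coordinates: a substitution maps the cube of the maximal ideal to itself, and by
  the chain rule the partial derivatives of \<open>f \<circ> \<phi>\<close> are combinations of those of \<open>f\<close> composed with
  \<open>\<phi>\<close>.\<close>

lemma D4_jacobian_ideal_contains_cubic:
  assumes f: "smooth_at f (0 :: real \<times> real)" and R: "R_equivalent (\<lambda>z. f z - f 0) (D4_germ \<epsilon>)" and \<epsilon>: "\<epsilon> \<noteq> 0"
    and p: "cubic_at_0 p"
  shows "in_jacobian_ideal f p"
proof -
  obtain \<phi> where \<phi>: "diffeo_germ_at_0 \<phi>" and g: "eventually (\<lambda>z. f (\<phi> z) - f 0 = D4_germ \<epsilon> z) (nhds 0)"
    using R unfolding R_equivalent_def by blast
  have \<phi>0: "\<phi> 0 = 0" "smooth_at \<phi> 0" using \<phi> unfolding diffeo_germ_at_0_def by blast+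
  obtain \<psi> where \<psi>: "\<psi> 0 = 0" "smooth_at \<psi> 0" and inv: "eventually (\<lambda>z. \<phi> (\<psi> z) = z) (nhds 0)"
    using \<phi> unfolding diffeo_germ_at_0_def by blast
  note lim_\<phi> = smooth_at_0_filterlim[OF \<phi>0] and lim_\<psi> = smooth_at_0_filterlim[OF \<psi>]
  obtain r0 r1 r2 r3 where r: "smooth_at r0 0" "smooth_at r1 0" "smooth_at r2 0" "smooth_at r3 0"
    and p_eq: "eventually (\<lambda>(u, v). p (u, v) = u^3 * r0 (u, v) + u^2 * v * r1 (u, v) + u * v^2 * r2 (u, v) + v^3 * r3 (u, v)) (nhds 0)"
    using p unfolding cubic_at_0_def by blast
  define R0 R1 R2 R3 where "R0 z = r0 (\<phi> z)" and "R1 z = r1 (\<phi> z)" and "R2 z = r2 (\<phi> z)" and "R3 z = r3 (\<phi> z)" for z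
  have Rs: "smooth_at R0 0" "smooth_at R1 0" "smooth_at R2 0" "smooth_at R3 0"
    unfolding R0_def[abs_def] R1_def[abs_def] R2_def[abs_def] R3_def[abs_def]
    by (rule smooth_at_compose; simp add: \<phi>0 r)+
  let ?X = "\<lambda>z. fst (\<phi> z)" and ?Y = "\<lambda>z. snd (\<phi> z)"
  have XY: "smooth_at ?X 0" "smooth_at ?Y 0"
    by (intro smooth_at_fst smooth_at_snd \<phi>0)+
  obtain x1 x2 where x: "smooth_at x1 0" "smooth_at x2 0"
    and x_eq: "eventually (\<lambda>z. ?X z = ?X 0 + fst z * x1 z + snd z * x2 z) (nhds 0)"
    by (rule smooth_at_0_hadamard[OF XY(1)])
  obtain y1 y2 where y: "smooth_at y1 0" "smooth_at y2 0"
    and y_eq: "eventually (\<lambda>z. ?Y z = ?Y 0 + fst z * y1 z + snd z * y2 z) (nhds 0)"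
    by (rule smooth_at_0_hadamard[OF XY(2)])
  \<comment> \<open>coefficients of \<open>p \<circ> \<phi>\<close> with respect to \<open>s^3\<close>, \<open>s^2 t\<close>, \<open>s t^2\<close>, \<open>t^3\<close>\<close>
  define S0 S1 S2 S3 where
    "S0 z = x1 z^3 * R0 z + x1 z^2 * y1 z * R1 z + x1 z * y1 z^2 * R2 z + y1 z^3 * R3 z" and
    "S1 z = 3 * x1 z^2 * x2 z * R0 z + (x1 z^2 * y2 z + 2 * x1 z * x2 z * y1 z) * R1 z
        + (2 * x1 z * y1 z * y2 z + x2 z * y1 z^2) * R2 z + 3 * y1 z^2 * y2 z * R3 z" and
    "S2 z = 3 * x1 z * x2 z^2 * R0 z + (2 * x1 z * x2 z * y2 z + x2 z^2 * y1 z) * R1 z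
        + (x1 z * y2 z^2 + 2 * x2 z * y1 z * y2 z) * R2 z + 3 * y1 z * y2 z^2 * R3 z" and
    "S3 z = x2 z^3 * R0 z + x2 z^2 * y2 z * R1 z + x2 z * y2 z^2 * R2 z + y2 z^3 * R3 z" for z
  have S: "smooth_at S0 0" "smooth_at S1 0" "smooth_at S2 0" "smooth_at S3 0"
    unfolding S0_def[abs_def] S1_def[abs_def] S2_def[abs_def] S3_def[abs_def]
    by (intro smooth_at_intros Rs x y)+
  \<comment> \<open>the four monomials expressed by the partial derivatives of the normal form\<close>
  define A B where
    "A z = S0 z * (- (3 * \<epsilon> / 2) * snd z) + S1 z * (1/2 * fst z) + S2 z * (1/2 * snd z) + S3 z * (- (1 / (6 * \<epsilon>)) * fst z)" and
    "B z = S0 z * fst z + S3 z * (1 / (3 * \<epsilon>) * snd z)" for z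
  have AB: "smooth_at A 0" "smooth_at B 0"
    unfolding A_def[abs_def] B_def[abs_def] by (intro smooth_at_intros S)+
  let ?a = "\<lambda>z. fst (pd1 \<phi> z)" and ?b = "\<lambda>z. snd (pd1 \<phi> z)"
  let ?c = "\<lambda>z. fst (pd2 \<phi> z)" and ?d = "\<lambda>z. snd (pd2 \<phi> z)"
  have abcd: "smooth_at ?a 0" "smooth_at ?b 0" "smooth_at ?c 0" "smooth_at ?d 0"
    by (intro smooth_at_fst smooth_at_snd \<phi>0 smooth_at_pd)+
  define \<alpha> \<beta> where "\<alpha> z = A z * ?a z + B z * ?c z" and "\<beta> z = A z * ?b z + B z * ?d z" for z
  have \<alpha>\<beta>: "smooth_at \<alpha> 0" "smooth_at \<beta> 0"
    unfolding \<alpha>_def[abs_def] \<beta>_def[abs_def] by (intro smooth_at_intros abcd AB)+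
  have chain: "eventually (\<lambda>z. pd (D4_germ \<epsilon>) h z = fst (pd \<phi> h z) * pd1 f (\<phi> z) + snd (pd \<phi> h z) * pd2 f (\<phi> z)) (nhds 0)" for h
  proof -
    have "eventually (\<lambda>z. D4_germ \<epsilon> z = f (\<phi> z) - f 0) (nhds 0)" using g by (auto elim: eventually_mono)
    from pd_cong_eventually[OF this]
    have "eventually (\<lambda>z. pd (D4_germ \<epsilon>) h z = pd (\<lambda>z. f (\<phi> z) - f 0) h z) (nhds 0)" .
    then show ?thesis
      using smooth_at_imp_differentiable[OF \<phi>0(2)]
        eventually_compose_filterlim[OF smooth_at_imp_differentiable[OF f] lim_\<phi>]
    proof eventually_elim
      case (elim z)
      have "(\<lambda>z. f (\<phi> z)) differentiable (at z)"
        using differentiable_chain_at[OF elim(2,3)] by (simp add: o_def)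
      then show ?case using elim(1) by (simp add: pd_diff pd_const pd_compose[OF elim(3,2)])
    qed
  qed
  have "eventually (\<lambda>z. p (\<phi> z) = \<alpha> z * pd1 f (\<phi> z) + \<beta> z * pd2 f (\<phi> z)) (nhds 0)"
    using eventually_compose_filterlim[OF p_eq lim_\<phi>] x_eq y_eq chain[of "(1, 0)"] chain[of "(0, 1)"]
  proof eventually_elim
    case (elim z)
    obtain s t where z: "z = (s, t)" by (cases z)
    let ?F1 = "pd1 f (\<phi> z)" and ?F2 = "pd2 f (\<phi> z)"
    have G1: "2 * s * t = ?a z * ?F1 + ?b z * ?F2" using elim(4) by (simp add: pd_D4_germ z)
    have G2: "s^2 + 3 * \<epsilon> * t^2 = ?c z * ?F1 + ?d z * ?F2" using elim(5) by (simp add: pd_D4_germ z)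
    have X: "?X z = s * x1 z + t * x2 z" using elim(2) \<phi>0 by (simp add: z)
    have Y: "?Y z = s * y1 z + t * y2 z" using elim(3) \<phi>0 by (simp add: z)
    have "p (\<phi> z) = ?X z^3 * R0 z + ?X z^2 * ?Y z * R1 z + ?X z * ?Y z^2 * R2 z + ?Y z^3 * R3 z"
      using elim(1) by (simp add: R0_def R1_def R2_def R3_def split_beta)
    also have "\<dots> = s^3 * S0 z + s^2 * t * S1 z + s * t^2 * S2 z + t^3 * S3 z"
      unfolding X Y S0_def S1_def S2_def S3_def by (simp add: power2_eq_square power3_eq_cube algebra_simps)
    also have "\<dots> = A z * (2 * s * t) + B z * (s^2 + 3 * \<epsilon> * t^2)"
      unfolding A_def B_def using \<epsilon> by (simp add: z power2_eq_square power3_eq_cube field_simps)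
    also have "\<dots> = \<alpha> z * ?F1 + \<beta> z * ?F2"
      unfolding G1 G2 \<alpha>_def \<beta>_def by (simp add: algebra_simps)
    finally show ?case .
  qed
  from eventually_compose_filterlim[OF this lim_\<psi>] inv
  have "eventually (\<lambda>z. p z = \<alpha> (\<psi> z) * pd1 f z + \<beta> (\<psi> z) * pd2 f z) (nhds 0)"
    by eventually_elim simp
  moreover have "smooth_at (\<lambda>z. \<alpha> (\<psi> z)) 0" "smooth_at (\<lambda>z. \<beta> (\<psi> z)) 0"
    by (rule smooth_at_compose; simp add: \<psi> \<alpha>\<beta>)+
  ultimately show ?thesis unfolding in_jacobian_ideal_def by blast
qed

section \<open>Analytic surfaces in Minkowski space\<close>

text \<open>The analyticity used from here on: closed under the operations that build the fundamental forms
  from a parametrisation, and stronger than smoothness.\<close>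

definition complexifiable_at :: "real \<times> real \<Rightarrow> (real \<times> real \<Rightarrow> real) \<Rightarrow> bool" where
  "complexifiable_at q f \<longleftrightarrow> (\<exists>H. H \<in> complexification q f)"

definition complexifiable_vec_at :: "real \<times> real \<Rightarrow> (real \<times> real \<Rightarrow> real^3) \<Rightarrow> bool" where
  "complexifiable_vec_at q y \<longleftrightarrow> (\<forall>i. complexifiable_at q (\<lambda>z. y z $ i))"

lemma complexifiable_at_intros:
  shows "complexifiable_at q (\<lambda>_. c)"
    and "complexifiable_at q f \<Longrightarrow> complexifiable_at q g \<Longrightarrow> complexifiable_at q (\<lambda>z. f z + g z)"
    and "complexifiable_at q f \<Longrightarrow> complexifiable_at q g \<Longrightarrow> complexifiable_at q (\<lambda>z. f z - g z)"
    and "complexifiable_at q f \<Longrightarrow> complexifiable_at q g \<Longrightarrow> complexifiable_at q (\<lambda>z. f z * g z)"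
  unfolding complexifiable_at_def
  using complexification_const complexification_add complexification_diff complexification_mult by blast+

lemma complexifiable_at_smooth: "complexifiable_at q f \<Longrightarrow> smooth_at f q"
  unfolding complexifiable_at_def using complexification_smooth_at by blast

lemma complexifiable_at_cong:
  "complexifiable_at q f \<Longrightarrow> eventually (\<lambda>z. f z = g z) (nhds q) \<Longrightarrow> complexifiable_at q g"
  unfolding complexifiable_at_def using complexification_cong by blast

abbreviation unit_directions :: "(real \<times> real) set" where
  "unit_directions \<equiv> {(1, 0), (0, 1)}"

lemma complexifiable_at_pd:
  assumes "complexifiable_at q f" "h \<in> unit_directions" shows "complexifiable_at q (pd f h)"
  using assms complexification_pd1 complexification_pd2 unfolding complexifiable_at_def by blast

lemma complexifiable_vec_at_const: "complexifiable_vec_at q (\<lambda>_. c)"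
  unfolding complexifiable_vec_at_def by (intro allI complexifiable_at_intros)

lemma complexifiable_vec_at_diff:
  assumes "complexifiable_vec_at q y" "complexifiable_vec_at q w"
  shows "complexifiable_vec_at q (\<lambda>z. y z - w z)"
  using assms unfolding complexifiable_vec_at_def by (auto intro: complexifiable_at_intros)

lemma pd_vec_nth:
  assumes "y differentiable (at z)"
  shows "pd y h z $ i = pd (\<lambda>z. y z $ i) h z"
proof -
  have "(y has_derivative (\<lambda>h. pd y h z)) (at z)"
    using assms unfolding pd_def by (simp add: frechet_derivative_works[symmetric])
  from bounded_linear.has_derivative[OF bounded_linear_vec_nth this]
  show ?thesis using pd_eqI by metis
qed

lemma complexifiable_vec_at_differentiable:
  assumes "complexifiable_vec_at q y"
  shows "eventually (\<lambda>z. y differentiable (at z)) (nhds q)"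
proof -
  have "eventually (\<lambda>z. (\<lambda>z. y z $ i) differentiable (at z)) (nhds q)" for i
    using assms complexification_differentiable unfolding complexifiable_vec_at_def complexifiable_at_def by blast
  then have "eventually (\<lambda>z. \<forall>i. (\<lambda>z. y z $ i) differentiable (at z)) (nhds q)"
    by (rule eventually_all_finite)
  then show ?thesis
  proof eventually_elim
    case (elim z)
    have "(\<lambda>z. \<Sum>i\<in>UNIV. (y z $ i) *\<^sub>R (axis i 1 :: real^3)) differentiable (at z)"
      using elim by (intro differentiable_sum differentiable_scaleR differentiable_const) auto
    moreover have "(\<lambda>z. \<Sum>i\<in>UNIV. (y z $ i) *\<^sub>R (axis i 1 :: real^3)) = y"
      using basis_expansion[of "y z" for z] by (simp add: fun_eq_iff scalar_mult_eq_scaleR)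
    ultimately show ?case by (simp only:)
  qed
qed

lemma complexifiable_vec_at_pd:
  assumes "complexifiable_vec_at q y" "h \<in> unit_directions"
  shows "complexifiable_vec_at q (pd y h)"
  unfolding complexifiable_vec_at_def
proof
  fix i
  have "eventually (\<lambda>z. pd (\<lambda>z. y z $ i) h z = pd y h z $ i) (nhds q)"
    using complexifiable_vec_at_differentiable[OF assms(1)] by eventually_elim (simp add: pd_vec_nth)
  then show "complexifiable_at q (\<lambda>z. pd y h z $ i)"
    by (rule complexifiable_at_cong[rotated])
       (use assms in \<open>auto simp: complexifiable_vec_at_def intro!: complexifiable_at_pd\<close>)
qed

lemma complexifiable_vec_at_pd_commute:
  assumes "complexifiable_vec_at q y"
  shows "eventually (\<lambda>z. pd1 (pd2 y) z = pd2 (pd1 y) z) (nhds q)"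
proof -
  have comp: "eventually (\<lambda>z. pd (pd y h) k z $ i = pd (pd (\<lambda>z. y z $ i) h) k z) (nhds q)"
    if "h \<in> unit_directions" for h k i
  proof -
    have "eventually (\<lambda>z. pd y h z $ i = pd (\<lambda>z. y z $ i) h z) (nhds q)"
      using complexifiable_vec_at_differentiable[OF assms] by eventually_elim (simp add: pd_vec_nth)
    from pd_cong_eventually[OF this] complexifiable_vec_at_differentiable[OF complexifiable_vec_at_pd[OF assms that]]
    show ?thesis by eventually_elim (simp add: pd_vec_nth)
  qed
  have "eventually (\<lambda>z. pd1 (pd2 y) z $ i = pd2 (pd1 y) z $ i) (nhds q)" for i
  proof -
    have "eventually (\<lambda>z. pd2 (pd1 (\<lambda>z. y z $ i)) z = pd1 (pd2 (\<lambda>z. y z $ i)) z) (nhds q)"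
      using assms complexification_pd_commute unfolding complexifiable_vec_at_def complexifiable_at_def by blast
    moreover have "eventually (\<lambda>z. pd1 (pd2 y) z $ i = pd1 (pd2 (\<lambda>z. y z $ i)) z) (nhds q)" by (rule comp) simp
    moreover have "eventually (\<lambda>z. pd2 (pd1 y) z $ i = pd2 (pd1 (\<lambda>z. y z $ i)) z) (nhds q)" by (rule comp) simp
    ultimately show ?thesis by eventually_elim simp
  qed
  then have "eventually (\<lambda>z. \<forall>i. pd1 (pd2 y) z $ i = pd2 (pd1 y) z $ i) (nhds q)"
    by (rule eventually_all_finite)
  then show ?thesis by eventually_elim (simp add: vec_eq_iff)
qed

lemma lorentz_simps:
  "lorentz (a + b) c = lorentz a c + lorentz b c" "lorentz a (b + c) = lorentz a b + lorentz a c"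
  "lorentz (a - b) c = lorentz a c - lorentz b c" "lorentz a (b - c) = lorentz a b - lorentz a c"
  "lorentz (r *\<^sub>R a) c = r * lorentz a c" "lorentz a (r *\<^sub>R c) = r * lorentz a c"
  "lorentz 0 c = 0" "lorentz a 0 = 0"
  by (simp_all add: lorentz_def algebra_simps)

lemma lorentz_commute: "lorentz a b = lorentz b a"
  by (simp add: lorentz_def algebra_simps)

lemma bounded_bilinear_lorentz: "bounded_bilinear lorentz"
  unfolding bilinear_conv_bounded_bilinear[symmetric] bilinear_def
  by (auto intro!: linearI simp: lorentz_simps)

lemma lorentz_cross_nth:
  "lorentz_cross a b $ 1 = a $ 2 * b $ 3 - a $ 3 * b $ 2"
  "lorentz_cross a b $ 2 = a $ 3 * b $ 1 - a $ 1 * b $ 3"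
  "lorentz_cross a b $ 3 = - (a $ 1 * b $ 2 - a $ 2 * b $ 1)"
  by (simp_all add: lorentz_cross_def cross3_def)

lemma bounded_bilinear_lorentz_cross: "bounded_bilinear lorentz_cross"
  unfolding bilinear_conv_bounded_bilinear[symmetric] bilinear_def
  by (auto intro!: linearI simp: vec_eq_iff forall_3 lorentz_cross_nth algebra_simps)

lemma complexifiable_at_lorentz:
  assumes "complexifiable_vec_at q y" "complexifiable_vec_at q w"
  shows "complexifiable_at q (\<lambda>z. lorentz (y z) (w z))"
  using assms unfolding complexifiable_vec_at_def lorentz_def by (intro complexifiable_at_intros) auto

lemma complexifiable_vec_at_cross:
  assumes "complexifiable_vec_at q y" "complexifiable_vec_at q w"
  shows "complexifiable_vec_at q (\<lambda>z. lorentz_cross (y z) (w z))"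
proof -
  have "complexifiable_at q (\<lambda>z. y z $ i * w z $ j - y z $ k * w z $ l)" for i j k l
    using assms unfolding complexifiable_vec_at_def by (intro complexifiable_at_intros) auto
  from this complexifiable_at_intros(3)[OF complexifiable_at_intros(1)[of _ 0] this] show ?thesis
    unfolding complexifiable_vec_at_def forall_3 lorentz_cross_nth by simp
qed

lemma pd_bilinear:
  assumes "bounded_bilinear B" "y differentiable (at z)" "w differentiable (at z)"
  shows "pd (\<lambda>z. B (y z) (w z)) h z = B (y z) (pd w h z) + B (pd y h z) (w z)"
  unfolding pd_def[of y] pd_def[of w]
  by (rule pd_eqI, rule bounded_bilinear.FDERIV[OF assms(1)])
     (use assms in \<open>simp_all add: frechet_derivative_works[symmetric]\<close>)

lemma pd_lorentz:
  assumes "complexifiable_vec_at q y" "complexifiable_vec_at q w"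
  shows "eventually (\<lambda>z. pd (\<lambda>z. lorentz (y z) (w z)) h z = lorentz (y z) (pd w h z) + lorentz (pd y h z) (w z)) (nhds q)"
  using assms[THEN complexifiable_vec_at_differentiable]
  by eventually_elim (rule pd_bilinear[OF bounded_bilinear_lorentz])

lemma pd_lorentz_cross:
  assumes "complexifiable_vec_at q y" "complexifiable_vec_at q w"
  shows "pd (\<lambda>z. lorentz_cross (y z) (w z)) h q = lorentz_cross (y q) (pd w h q) + lorentz_cross (pd y h q) (w q)"
  using assms[THEN complexifiable_vec_at_differentiable, THEN eventually_nhds_x_imp_x]
  by (intro pd_bilinear[OF bounded_bilinear_lorentz_cross])

lemmas pd_lorentz_at = pd_lorentz[THEN eventually_nhds_x_imp_x]

lemma complexifiable_at_differentiable: "complexifiable_at q f \<Longrightarrow> f differentiable (at q)"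
  using complexifiable_at_smooth smooth_at_imp_differentiable_at by blast

text \<open>The functions \<open>lorentz (x z - p) D\<close> are, up to a factor, the derivatives of the distance squared
  family in the parameter directions.\<close>

lemma height_pd:
  assumes x: "complexifiable_vec_at q x" and h: "h \<in> unit_directions"
  shows "pd (\<lambda>z. lorentz (x z - p) D) h q = lorentz (pd x h q) D"
    and "pd (pd (\<lambda>z. lorentz (x z - p) D) h) k q = lorentz (pd (pd x h) k q) D"
proof -
  note c = complexifiable_vec_at_const
  have xp: "complexifiable_vec_at q (\<lambda>z. x z - p)" by (intro complexifiable_vec_at_diff x c)
  have pdx: "eventually (\<lambda>z. pd (\<lambda>z. x z - p) h z = pd x h z) (nhds q)" for h
    using complexifiable_vec_at_differentiable[OF x] by eventually_elim (simp add: pd_diff pd_const)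
  have 1: "eventually (\<lambda>z. pd (\<lambda>z. lorentz (x z - p) D) h z = lorentz (pd x h z) D) (nhds q)"
    using pd_lorentz[OF xp c[of q D], where h = h] pdx[of h] by eventually_elim (simp add: pd_const lorentz_simps)
  then show "pd (\<lambda>z. lorentz (x z - p) D) h q = lorentz (pd x h q) D" by (rule eventually_nhds_x_imp_x)
  show "pd (pd (\<lambda>z. lorentz (x z - p) D) h) k q = lorentz (pd (pd x h) k q) D"
    unfolding pd_cong[OF 1] pd_lorentz_at[OF complexifiable_vec_at_pd[OF x h] c]
    by (simp add: pd_const lorentz_simps)
qed

text \<open>The third derivative contains the scalar products of first with second derivatives of the
  parametrisation that also occur in the derivatives of the first fundamental form.\<close>

lemma dist_sq_pd:
  assumes x: "complexifiable_vec_at q x" and h: "h \<in> unit_directions" "k \<in> unit_directions"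
  shows "pd (\<lambda>z. dist_sq (x z) p) h q = 2 * lorentz (pd x h q) (x q - p)"
    and "pd (pd (\<lambda>z. dist_sq (x z) p) h) k q = 2 * (lorentz (pd (pd x h) k q) (x q - p) + lorentz (pd x h q) (pd x k q))"
    and "pd (pd (pd (\<lambda>z. dist_sq (x z) p) h) k) j q = 2 * (lorentz (pd (pd (pd x h) k) j q) (x q - p)
      + lorentz (pd (pd x h) k q) (pd x j q) + lorentz (pd (pd x h) j q) (pd x k q) + lorentz (pd x h q) (pd (pd x k) j q))"
proof -
  note c = complexifiable_vec_at_const
  have xp: "complexifiable_vec_at q (\<lambda>z. x z - p)" by (intro complexifiable_vec_at_diff x c)
  have pdx: "eventually (\<lambda>z. pd (\<lambda>z. x z - p) h z = pd x h z) (nhds q)" for h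
    using complexifiable_vec_at_differentiable[OF x] by eventually_elim (simp add: pd_diff pd_const)
  note dx = complexifiable_vec_at_pd[OF x]
  have 1: "eventually (\<lambda>z. pd (\<lambda>z. dist_sq (x z) p) h z = 2 * lorentz (pd x h z) (x z - p)) (nhds q)"
    unfolding dist_sq_def using pd_lorentz[OF xp xp, where h = h] pdx[of h] by eventually_elim (simp add: lorentz_commute)
  then show "pd (\<lambda>z. dist_sq (x z) p) h q = 2 * lorentz (pd x h q) (x q - p)" by (rule eventually_nhds_x_imp_x)
  have double: "eventually (\<lambda>z. pd (\<lambda>z. 2 * f z) k z = 2 * pd f k z) (nhds q)" if "complexifiable_at q f" for f k
    using smooth_at_imp_differentiable[OF complexifiable_at_smooth[OF that]]
    by eventually_elim (simp add: pd_mult pd_const)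
  have L1: "complexifiable_at q (\<lambda>z. lorentz (pd x h z) (x z - p))" by (intro complexifiable_at_lorentz dx h xp)
  have 2: "eventually (\<lambda>z. pd (pd (\<lambda>z. dist_sq (x z) p) h) k z
      = 2 * (lorentz (pd (pd x h) k z) (x z - p) + lorentz (pd x h z) (pd x k z))) (nhds q)"
    using pd_cong_eventually[OF 1, of k] double[OF L1, of k] pd_lorentz[OF dx[OF h(1)] xp, where h = k] pdx[of k]
    by eventually_elim simp
  then show "pd (pd (\<lambda>z. dist_sq (x z) p) h) k q = 2 * (lorentz (pd (pd x h) k q) (x q - p) + lorentz (pd x h q) (pd x k q))"
    by (rule eventually_nhds_x_imp_x)
  have L2: "complexifiable_at q (\<lambda>z. lorentz (pd (pd x h) k z) (x z - p))"
    "complexifiable_at q (\<lambda>z. lorentz (pd x h z) (pd x k z))"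
    by (intro complexifiable_at_lorentz complexifiable_vec_at_pd x h xp)+
  show "pd (pd (pd (\<lambda>z. dist_sq (x z) p) h) k) j q = 2 * (lorentz (pd (pd (pd x h) k) j q) (x q - p)
      + lorentz (pd (pd x h) k q) (pd x j q) + lorentz (pd (pd x h) j q) (pd x k q) + lorentz (pd x h q) (pd (pd x k) j q))"
    unfolding pd_cong[OF 2] eventually_nhds_x_imp_x[OF double[OF complexifiable_at_intros(2)[OF L2]]]
      pd_add[OF L2[THEN complexifiable_at_differentiable]]
      pd_lorentz_at[OF complexifiable_vec_at_pd[OF dx[OF h(1)] h(2)] xp] pd_lorentz_at[OF dx[OF h(1)] dx[OF h(2)]]
      eventually_nhds_x_imp_x[OF pdx]
    by simp
qed

section \<open>Linear algebra\<close>

text \<open>Changing the sign of the last coordinate turns pseudo-orthogonality into Euclidean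
  orthogonality, for which the cross product describes the complement.\<close>

lemma lorentz_orthogonal_complement:
  assumes N: "lorentz_cross a b \<noteq> 0" and w: "lorentz a w = 0" "lorentz b w = 0"
  obtains \<kappa> where "w = \<kappa> *\<^sub>R lorentz_cross a b"
proof -
  let ?w = "vector [w $ 1, w $ 2, - w $ 3] :: real^3"
  have "cross3 a b \<noteq> 0"
    using N by (auto simp: lorentz_cross_def vec_eq_iff forall_3)
  moreover have "a \<bullet> ?w = 0" "b \<bullet> ?w = 0"
    using w by (simp_all add: lorentz_def inner_vec_def sum_3)
  moreover have "cross3 (cross3 a b) ?w = (a \<bullet> ?w) *\<^sub>R b - (b \<bullet> ?w) *\<^sub>R a"
    by (simp add: cross3_def vec_eq_iff forall_3 inner_vec_def sum_3 algebra_simps)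
  ultimately have "?w = 0 \<or> (\<exists>\<kappa>. ?w = \<kappa> *\<^sub>R cross3 a b)"
    using collinear_lemma[of "cross3 a b" ?w] cross_eq_0[of "cross3 a b" ?w] by simp
  then obtain \<kappa> where "?w = \<kappa> *\<^sub>R cross3 a b"
    by (metis scaleR_zero_left)
  then show thesis
    by (intro that[of \<kappa>]) (auto simp: vec_eq_iff forall_3 lorentz_cross_def)
qed

text \<open>The Euclidean dual basis of two independent vectors, with the sign of the last coordinate
  changed.\<close>

lemma lorentz_dual_basis:
  assumes N: "lorentz_cross a b \<noteq> 0"
  obtains D where "lorentz a D = r" "lorentz b D = s"
proof -
  let ?n = "cross3 a b"
  have n: "?n \<noteq> 0" using N by (auto simp: lorentz_cross_def vec_eq_iff forall_3)
  define e where "e = (1 / (?n \<bullet> ?n)) *\<^sub>R (r *\<^sub>R cross3 b ?n + s *\<^sub>R cross3 ?n a)"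
  have "a \<bullet> cross3 b ?n = ?n \<bullet> ?n" "b \<bullet> cross3 ?n a = ?n \<bullet> ?n"
    by (simp_all add: cross3_def inner_vec_def sum_3 algebra_simps)
  moreover have "a \<bullet> cross3 ?n a = 0" "b \<bullet> cross3 b ?n = 0" by (simp_all add: dot_cross_self)
  ultimately have "a \<bullet> e = r" "b \<bullet> e = s"
    using n by (simp_all add: e_def inner_add_right)
  then show thesis
    by (intro that[of "vector [e $ 1, e $ 2, - e $ 3]"]) (simp_all add: lorentz_def inner_vec_def sum_3)
qed

text \<open>The columns are the coefficients of the three binary quadratic forms that have to span all
  quadratic forms when the family is versal.\<close>

lemma surjective_3x3_iff:
  fixes A B C D E F G :: real
  shows "(\<forall>r1 r2 r3. \<exists>\<alpha> \<beta> \<kappa>. \<alpha> * A + \<beta> * B + \<kappa> * E = r1 \<and> \<alpha> * B + \<beta> * C + \<kappa> * F = r2 \<and> \<alpha> * C + \<beta> * D + \<kappa> * G = r3)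
    \<longleftrightarrow> E * (B * D - C^2) - F * (A * D - B * C) + G * (A * C - B^2) \<noteq> 0"
proof -
  let ?M = "vector [vector [A, B, E], vector [B, C, F], vector [C, D, G]] :: real^3^3"
  have mv: "?M *v y = vector [y $ 1 * A + y $ 2 * B + y $ 3 * E, y $ 1 * B + y $ 2 * C + y $ 3 * F, y $ 1 * C + y $ 2 * D + y $ 3 * G]" for y
    by (simp add: vec_eq_iff forall_3 matrix_vector_mult_def sum_3)
  have "det ?M \<noteq> 0 \<longleftrightarrow> surj ((*v) ?M)"
    by (metis invertible_det_nz invertible_right_inverse matrix_right_invertible_surjective)
  also have "\<dots> \<longleftrightarrow> (\<forall>r1 r2 r3. \<exists>\<alpha> \<beta> \<kappa>. \<alpha> * A + \<beta> * B + \<kappa> * E = r1 \<and> \<alpha> * B + \<beta> * C + \<kappa> * F = r2 \<and> \<alpha> * C + \<beta> * D + \<kappa> * G = r3)"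
  proof (intro iffI allI)
    fix r1 r2 r3 assume "surj ((*v) ?M)"
    then obtain y where "?M *v y = vector [r1, r2, r3]" unfolding surj_def by metis
    then show "\<exists>\<alpha> \<beta> \<kappa>. \<alpha> * A + \<beta> * B + \<kappa> * E = r1 \<and> \<alpha> * B + \<beta> * C + \<kappa> * F = r2 \<and> \<alpha> * C + \<beta> * D + \<kappa> * G = r3"
      unfolding mv by (intro exI[of _ "y $ 1"] exI[of _ "y $ 2"] exI[of _ "y $ 3"]) (simp add: vec_eq_iff forall_3)
  next
    assume all: "\<forall>r1 r2 r3. \<exists>\<alpha> \<beta> \<kappa>. \<alpha> * A + \<beta> * B + \<kappa> * E = r1 \<and> \<alpha> * B + \<beta> * C + \<kappa> * F = r2 \<and> \<alpha> * C + \<beta> * D + \<kappa> * G = r3"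
    show "surj ((*v) ?M)"
      unfolding surj_def
    proof
      fix r :: "real^3"
      obtain \<alpha> \<beta> \<kappa> where "\<alpha> * A + \<beta> * B + \<kappa> * E = r $ 1" "\<alpha> * B + \<beta> * C + \<kappa> * F = r $ 2" "\<alpha> * C + \<beta> * D + \<kappa> * G = r $ 3"
        using all by blast
      then show "\<exists>y. r = ?M *v y"
        by (intro exI[of _ "vector [\<alpha>, \<beta>, \<kappa>]"]) (simp add: mv vec_eq_iff forall_3)
    qed
  qed
  also have "det ?M = E * (B * D - C^2) - F * (A * D - B * C) + G * (A * C - B^2)"
    by (simp add: det_3 algebra_simps power2_eq_square)
  finally show ?thesis by simp
qed

section \<open>The umbilic multiplicity at a D4 point\<close>

lemma analytic_parametrisation_complexifiable:
  assumes "analytic_parametrisation M U x" "q \<in> U"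
  shows "complexifiable_vec_at q x"
  using assms real_analytic_imp_complexification_exists
  unfolding analytic_parametrisation_def complexifiable_vec_at_def complexifiable_at_def by blast

lemma analytic_parametrisation_normal_nonzero:
  assumes "analytic_parametrisation M U x" "q \<in> U"
  shows "lorentz_cross (pd1 x q) (pd2 x q) \<noteq> 0"
proof
  assume N: "lorentz_cross (pd1 x q) (pd2 x q) = 0"
  have x: "complexifiable_vec_at q x" by (rule analytic_parametrisation_complexifiable[OF assms])
  have "x differentiable (at q)"
    using complexifiable_vec_at_differentiable[OF x] by (rule eventually_nhds_x_imp_x)
  then have d: "(x has_derivative frechet_derivative x (at q)) (at q)" by (simp add: frechet_derivative_works[symmetric])
  interpret D: bounded_linear "frechet_derivative x (at q)" by (rule has_derivative_bounded_linear[OF d])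
  have inj: "inj (frechet_derivative x (at q))"
    using assms unfolding analytic_parametrisation_def by blast
  have "cross3 (pd1 x q) (pd2 x q) = 0"
    using N by (auto simp: lorentz_cross_def vec_eq_iff forall_3)
  then consider "pd1 x q = 0" | c where "pd2 x q = c *\<^sub>R pd1 x q"
    using collinear_lemma[of "pd1 x q" "pd2 x q"] cross_eq_0[of "pd1 x q" "pd2 x q"]
    by (metis scaleR_zero_left)
  then show False
  proof cases
    case 1
    then have "frechet_derivative x (at q) (1, 0) = frechet_derivative x (at q) 0" by (simp add: pd_def D.zero)
    then show False using injD[OF inj, of "(1, 0)" 0] by (simp add: zero_prod_def)
  next
    case (2 c)
    then have "frechet_derivative x (at q) (0, 1) = frechet_derivative x (at q) (c *\<^sub>R (1, 0))"
      by (simp only: pd_def D.scaleR)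
    then show False using injD[OF inj, of "(0, 1)" "c *\<^sub>R (1, 0)"] by simp
  qed
qed

lemma complexifiable_fundamental_forms:
  assumes x: "complexifiable_vec_at q x"
  shows "complexifiable_at q (ff_E x)" "complexifiable_at q (ff_F x)" "complexifiable_at q (ff_G x)"
    "complexifiable_at q (sf_l x)" "complexifiable_at q (sf_m x)" "complexifiable_at q (sf_n x)"
  unfolding ff_E_def[abs_def] ff_F_def[abs_def] ff_G_def[abs_def] sf_l_def[abs_def] sf_m_def[abs_def] sf_n_def[abs_def]
  by (intro complexifiable_at_lorentz complexifiable_vec_at_cross complexifiable_vec_at_pd x; simp)+

lemma complexifiable_coefficients:
  assumes "complexifiable_vec_at q x"
  shows "complexifiable_at q (coeff_a x)" "complexifiable_at q (coeff_b x)" "complexifiable_at q (coeff_c x)"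
  unfolding coeff_a_def[abs_def] coeff_b_def[abs_def] coeff_c_def[abs_def]
  by (intro complexifiable_at_intros complexifiable_fundamental_forms assms)+

text \<open>At an umbilic point the derivative of the normal is, up to normal components, a multiple of the
  derivative of the position. The argument compares scalar products with the two tangent vectors, and
  so it covers a degenerate induced metric too.\<close>

lemma shape_operator:
  assumes N: "lorentz_cross a b \<noteq> 0" and w: "w = \<rho> *\<^sub>R lorentz_cross a b"
    and d: "lorentz ah w = - lorentz a e" "lorentz bh w = - lorentz b e"
  obtains \<mu> where "\<rho> *\<^sub>R (lorentz_cross a bh + lorentz_cross ah b) = e + \<mu> *\<^sub>R lorentz_cross a b"
proof -
  let ?n = "\<rho> *\<^sub>R (lorentz_cross a bh + lorentz_cross ah b) - e"
  have "lorentz a ?n = - lorentz ah w - lorentz a e" "lorentz b ?n = - lorentz bh w - lorentz b e"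
    unfolding w by (simp_all add: lorentz_def lorentz_cross_nth algebra_simps)
  then have "lorentz a ?n = 0" "lorentz b ?n = 0" using d by simp_all
  then obtain \<mu> where "?n = \<mu> *\<^sub>R lorentz_cross a b"
    by (rule lorentz_orthogonal_complement[OF N])
  then show thesis by (intro that[of \<mu>]) (simp add: algebra_simps)
qed

text \<open>The term with \<open>\<mu>\<close> comes from the normal component in \<open>shape_operator\<close>. Its
  contribution to the derivatives of the coefficients \<open>a\<close>, \<open>b\<close>, \<open>c\<close> is a multiple of the coefficients
  themselves, which vanish at an umbilic point.\<close>

lemma second_form_derivatives:
  fixes p :: "real^3"
  assumes x: "complexifiable_vec_at q x" and h: "h \<in> unit_directions"
    and N: "lorentz_cross (pd1 x q) (pd2 x q) \<noteq> 0" and w: "x q - p = \<rho> *\<^sub>R lorentz_cross (pd1 x q) (pd2 x q)"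
    and flat: "pd (pd1 (\<lambda>z. dist_sq (x z) p)) h q = 0" "pd (pd2 (\<lambda>z. dist_sq (x z) p)) h q = 0"
  obtains \<mu> where
    "\<rho> * pd (sf_l x) h q = pd (pd1 (pd1 (\<lambda>z. dist_sq (x z) p))) h q / 2 - pd (ff_E x) h q + \<mu> * sf_l x q"
    "\<rho> * pd (sf_m x) h q = pd (pd2 (pd1 (\<lambda>z. dist_sq (x z) p))) h q / 2 - pd (ff_F x) h q + \<mu> * sf_m x q"
    "\<rho> * pd (sf_n x) h q = pd (pd2 (pd2 (\<lambda>z. dist_sq (x z) p))) h q / 2 - pd (ff_G x) h q + \<mu> * sf_n x q"
proof -
  let ?a = "pd1 x q" and ?b = "pd2 x q" and ?N = "lorentz_cross (pd1 x q) (pd2 x q)"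
  let ?N' = "lorentz_cross ?a (pd (pd2 x) h q) + lorentz_cross (pd (pd1 x) h q) ?b"
  have u: "(1, 0) \<in> unit_directions" and v: "(0, 1) \<in> unit_directions" by auto
  note dx = complexifiable_vec_at_pd[OF x]
  have "lorentz (pd (pd1 x) h q) (x q - p) = - lorentz ?a (pd x h q)"
    "lorentz (pd (pd2 x) h q) (x q - p) = - lorentz ?b (pd x h q)"
    using flat dist_sq_pd(2)[OF x u h] dist_sq_pd(2)[OF x v h] by simp_all
  then obtain \<mu> where \<mu>: "\<rho> *\<^sub>R ?N' = pd x h q + \<mu> *\<^sub>R ?N"
    using shape_operator[OF N w] by blast
  have sf: "\<rho> * pd (\<lambda>z. lorentz (lorentz_cross (pd1 x z) (pd2 x z)) (y z)) h q
      = lorentz (pd y h q) (x q - p) + lorentz (y q) (pd x h q) + \<mu> * lorentz ?N (y q)" if y: "complexifiable_vec_at q y" for y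
  proof -
    have "\<rho> * pd (\<lambda>z. lorentz (lorentz_cross (pd1 x z) (pd2 x z)) (y z)) h q
      = lorentz (\<rho> *\<^sub>R ?N) (pd y h q) + lorentz (\<rho> *\<^sub>R ?N') (y q)"
      unfolding pd_lorentz_at[OF complexifiable_vec_at_cross[OF dx[OF u] dx[OF v]] y] pd_lorentz_cross[OF dx[OF u] dx[OF v]]
      by (simp add: lorentz_simps algebra_simps)
    also have "\<dots> = lorentz (x q - p) (pd y h q) + lorentz (pd x h q + \<mu> *\<^sub>R ?N) (y q)"
      unfolding \<mu> w ..
    finally show ?thesis by (simp add: lorentz_simps lorentz_commute algebra_simps)
  qed
  have uu: "complexifiable_vec_at q (pd1 (pd1 x))" and uv: "complexifiable_vec_at q (pd2 (pd1 x))"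
    and vv: "complexifiable_vec_at q (pd2 (pd2 x))"
    by (intro complexifiable_vec_at_pd x u v)+
  show thesis
  proof
    show "\<rho> * pd (sf_l x) h q = pd (pd1 (pd1 (\<lambda>z. dist_sq (x z) p))) h q / 2 - pd (ff_E x) h q + \<mu> * sf_l x q"
      unfolding dist_sq_pd(3)[OF x u u] ff_E_def[abs_def] pd_lorentz_at[OF dx[OF u] dx[OF u]] sf_l_def[abs_def] sf[OF uu]
      by (simp add: lorentz_commute field_simps)
    show "\<rho> * pd (sf_m x) h q = pd (pd2 (pd1 (\<lambda>z. dist_sq (x z) p))) h q / 2 - pd (ff_F x) h q + \<mu> * sf_m x q"
      unfolding dist_sq_pd(3)[OF x u v] ff_F_def[abs_def] pd_lorentz_at[OF dx[OF u] dx[OF v]] sf_m_def[abs_def] sf[OF uv]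
      by (simp add: lorentz_commute field_simps)
    show "\<rho> * pd (sf_n x) h q = pd (pd2 (pd2 (\<lambda>z. dist_sq (x z) p))) h q / 2 - pd (ff_G x) h q + \<mu> * sf_n x q"
      unfolding dist_sq_pd(3)[OF x v v] ff_G_def[abs_def] pd_lorentz_at[OF dx[OF v] dx[OF v]] sf_n_def[abs_def] sf[OF vv]
      by (simp add: lorentz_commute field_simps)
  qed
qed

text \<open>The coefficients \<open>a\<close>, \<open>b\<close>, \<open>c\<close> all have the form \<open>X * t - Y * s\<close> with \<open>X\<close>, \<open>Y\<close> from the first and \<open>s\<close>, \<open>t\<close> from
  the second fundamental form. At the umbilic point their derivatives only involve \<open>S\<close> and \<open>T\<close>, which
  are third derivatives of the distance squared function.\<close>

lemma two_by_two_minor_derivative: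
  fixes \<rho> :: real
  assumes "\<rho> * \<kappa> = -1" "s = \<kappa> * X" "t = \<kappa> * Y"
    and "\<rho> * s' = S / 2 - X' + \<mu> * s" "\<rho> * t' = T / 2 - Y' + \<mu> * t"
  shows "2 * \<rho> * ((X * t' + X' * t) - (Y * s' + Y' * s)) = X * T - Y * S"
proof -
  have "2 * \<rho> * ((X * t' + X' * t) - (Y * s' + Y' * s))
    = 2 * (X * (\<rho> * t') + X' * (\<rho> * \<kappa>) * Y - Y * (\<rho> * s') - Y' * (\<rho> * \<kappa>) * X)"
    by (simp add: assms(2,3) algebra_simps)
  then show ?thesis unfolding assms(1,4,5) by (simp add: assms(2,3) algebra_simps)
qed

text \<open>A vanishing gradient makes \<open>x q - p\<close> normal, and then a vanishing Hessian means that the first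
  fundamental form is \<open>- \<rho>\<close> times the second one. If \<open>E\<close>, \<open>F\<close>, \<open>G\<close> were all zero, both tangent vectors would
  be orthogonal to the tangent plane, hence on the normal line, and so dependent; therefore \<open>\<rho>\<close> is not
  zero.\<close>

lemma D4_point_data:
  fixes p :: "real^3"
  assumes x: "complexifiable_vec_at q x" and N: "lorentz_cross (pd1 x q) (pd2 x q) \<noteq> 0"
    and grad: "\<And>h. pd (\<lambda>z. dist_sq (x z) p) h q = 0"
    and hess: "\<And>h k. pd (pd (\<lambda>z. dist_sq (x z) p) h) k q = 0"
  obtains \<rho> \<kappa> where "x q - p = \<rho> *\<^sub>R lorentz_cross (pd1 x q) (pd2 x q)" "\<rho> * \<kappa> = -1"
    "sf_l x q = \<kappa> * ff_E x q" "sf_m x q = \<kappa> * ff_F x q" "sf_n x q = \<kappa> * ff_G x q"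
    "ff_E x q \<noteq> 0 \<or> ff_F x q \<noteq> 0 \<or> ff_G x q \<noteq> 0"
proof -
  let ?a = "pd1 x q" and ?b = "pd2 x q" and ?N = "lorentz_cross (pd1 x q) (pd2 x q)"
  have u: "(1, 0) \<in> unit_directions" and v: "(0, 1) \<in> unit_directions" by auto
  have ne: "ff_E x q \<noteq> 0 \<or> ff_F x q \<noteq> 0 \<or> ff_G x q \<noteq> 0"
  proof (rule ccontr)
    assume "\<not> ?thesis"
    then have "lorentz ?a ?a = 0" "lorentz ?b ?a = 0" "lorentz ?a ?b = 0" "lorentz ?b ?b = 0"
      by (auto simp: ff_E_def ff_F_def ff_G_def lorentz_commute)
    then obtain s t where st: "?a = s *\<^sub>R ?N" "?b = t *\<^sub>R ?N"
      using lorentz_orthogonal_complement[OF N] by metis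
    have "lorentz_cross (s *\<^sub>R n) (t *\<^sub>R n) = 0" for n
      by (simp add: vec_eq_iff forall_3 lorentz_cross_nth)
    then show False using N st by metis
  qed
  have "lorentz ?a (x q - p) = 0" "lorentz ?b (x q - p) = 0"
    using grad dist_sq_pd(1)[OF x u u, of p] dist_sq_pd(1)[OF x v u, of p] by simp_all
  then obtain \<rho> where w: "x q - p = \<rho> *\<^sub>R ?N" by (rule lorentz_orthogonal_complement[OF N])
  have "\<rho> * sf_l x q = - ff_E x q" "\<rho> * sf_m x q = - ff_F x q" "\<rho> * sf_n x q = - ff_G x q"
    using hess dist_sq_pd(2)[OF x u u, of p] dist_sq_pd(2)[OF x u v, of p] dist_sq_pd(2)[OF x v v, of p]
    unfolding w sf_l_def sf_m_def sf_n_def ff_E_def ff_F_def ff_G_def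
    by (simp_all add: lorentz_simps lorentz_commute[of ?N])
  moreover from this ne have "\<rho> \<noteq> 0" by auto
  ultimately show thesis
    using w ne by (intro that[of \<rho> "- 1 / \<rho>"]) (auto simp: field_simps)
qed

lemma third_derivative_symmetry:
  assumes F: "complexifiable_at q F"
  shows "pd1 (pd2 (pd1 F)) q = pd2 (pd1 (pd1 F)) q" "pd1 (pd1 (pd2 F)) q = pd2 (pd1 (pd1 F)) q"
    "pd2 (pd1 (pd2 F)) q = pd2 (pd2 (pd1 F)) q" "pd1 (pd2 (pd2 F)) q = pd2 (pd2 (pd1 F)) q"
    "pd1 (pd2 F) q = pd2 (pd1 F) q"
proof -
  have comm: "eventually (\<lambda>z. pd1 (pd2 f) z = pd2 (pd1 f) z) (nhds q)" if f: "complexifiable_at q f" for f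
  proof -
    obtain H where "H \<in> complexification q f" using f unfolding complexifiable_at_def by blast
    from complexification_pd_commute[OF this] show ?thesis by eventually_elim simp
  qed
  have F1: "complexifiable_at q (pd1 F)" "complexifiable_at q (pd2 F)"
    by (intro complexifiable_at_pd F; simp)+
  note at = comm[THEN eventually_nhds_x_imp_x]
  show "pd1 (pd2 F) q = pd2 (pd1 F) q" by (rule at[OF F])
  show B: "pd1 (pd2 (pd1 F)) q = pd2 (pd1 (pd1 F)) q" by (rule at[OF F1(1)])
  show "pd1 (pd1 (pd2 F)) q = pd2 (pd1 (pd1 F)) q" using pd_cong[OF comm[OF F]] B by simp
  show C: "pd2 (pd1 (pd2 F)) q = pd2 (pd2 (pd1 F)) q" by (rule pd_cong[OF comm[OF F]])
  show "pd1 (pd2 (pd2 F)) q = pd2 (pd2 (pd1 F)) q" using at[OF F1(2)] C by simp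
qed

text \<open>The determinant of the rows \<open>(E, F, G)\<close>, \<open>(A, B, C)\<close>, \<open>(B, C, D)\<close>, with the third
  derivatives \<open>A\<close>, \<open>B\<close>, \<open>C\<close>, \<open>D\<close> of the distance squared function. The last two rows represent the
  quadratic parts of its two partial derivatives.\<close>

definition D4_discriminant :: "(real \<times> real \<Rightarrow> real^3) \<Rightarrow> real \<times> real \<Rightarrow> real^3 \<Rightarrow> real" where
  "D4_discriminant x q p =
    (let F = (\<lambda>z. dist_sq (x z) p); A = pd1 (pd1 (pd1 F)) q; B = pd2 (pd1 (pd1 F)) q;
         C = pd2 (pd2 (pd1 F)) q; D = pd2 (pd2 (pd2 F)) q
     in ff_E x q * (B * D - C\<^sup>2) - ff_F x q * (A * D - B * C) + ff_G x q * (A * C - B\<^sup>2))"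

text \<open>The Jacobian determinants of the pairs \<open>(b, c)\<close>, \<open>(a, c)\<close>, \<open>(a, b)\<close>, multiplied by \<open>(2 * \<rho>)\<^sup>2\<close>, are
  \<open>- E\<close>, \<open>- F\<close>, \<open>- G\<close> times the discriminant. The pair in each clause of \<open>umbilic_multiplicity\<close> comes
  with the factor that the clause assumes to be nonzero.\<close>

lemma multiplicity_iff_discriminant:
  fixes p :: "real^3"
  assumes x: "complexifiable_vec_at q x" and N: "lorentz_cross (pd1 x q) (pd2 x q) \<noteq> 0"
    and grad: "\<And>h. pd (\<lambda>z. dist_sq (x z) p) h q = 0"
    and hess: "\<And>h k. pd (pd (\<lambda>z. dist_sq (x z) p) h) k q = 0"
  shows "umbilic_multiplicity x q = 1 \<longleftrightarrow> D4_discriminant x q p \<noteq> 0"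
proof -
  let ?F = "\<lambda>z. dist_sq (x z) p"
  obtain \<rho> \<kappa> where w: "x q - p = \<rho> *\<^sub>R lorentz_cross (pd1 x q) (pd2 x q)" and lk: "\<rho> * \<kappa> = -1"
    and sf: "sf_l x q = \<kappa> * ff_E x q" "sf_m x q = \<kappa> * ff_F x q" "sf_n x q = \<kappa> * ff_G x q"
    and ne: "ff_E x q \<noteq> 0 \<or> ff_F x q \<noteq> 0 \<or> ff_G x q \<noteq> 0"
    by (rule D4_point_data[OF x N grad hess])
  have u: "(1, 0) \<in> unit_directions" and v: "(0, 1) \<in> unit_directions" by auto
  have xp: "complexifiable_vec_at q (\<lambda>z. x z - p)" by (intro complexifiable_vec_at_diff x complexifiable_vec_at_const)
  have F: "complexifiable_at q ?F" unfolding dist_sq_def by (intro complexifiable_at_lorentz xp)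
  note sym = third_derivative_symmetry[OF F]
  note ff = complexifiable_fundamental_forms[OF x] and ffd = complexifiable_fundamental_forms[OF x, THEN complexifiable_at_differentiable]
  define E Fo G where "E = ff_E x q" and "Fo = ff_F x q" and "G = ff_G x q"
  define A B C D where "A = pd1 (pd1 (pd1 ?F)) q" and "B = pd2 (pd1 (pd1 ?F)) q"
    and "C = pd2 (pd2 (pd1 ?F)) q" and "D = pd2 (pd2 (pd2 ?F)) q"
  have pd_coeff: "2 * \<rho> * pd (coeff_a x) h q = Fo * pd (pd2 (pd2 ?F)) h q - G * pd (pd2 (pd1 ?F)) h q \<and>
      2 * \<rho> * pd (coeff_b x) h q = E * pd (pd2 (pd2 ?F)) h q - G * pd (pd1 (pd1 ?F)) h q \<and>
      2 * \<rho> * pd (coeff_c x) h q = E * pd (pd2 (pd1 ?F)) h q - Fo * pd (pd1 (pd1 ?F)) h q"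
    if h: "h \<in> unit_directions" for h
  proof -
    obtain \<mu> where m: "\<rho> * pd (sf_l x) h q = pd (pd1 (pd1 ?F)) h q / 2 - pd (ff_E x) h q + \<mu> * sf_l x q"
      "\<rho> * pd (sf_m x) h q = pd (pd2 (pd1 ?F)) h q / 2 - pd (ff_F x) h q + \<mu> * sf_m x q"
      "\<rho> * pd (sf_n x) h q = pd (pd2 (pd2 ?F)) h q / 2 - pd (ff_G x) h q + \<mu> * sf_n x q"
      by (rule second_form_derivatives[OF x h N w hess hess])
    have minor: "pd (\<lambda>z. X z * t z - Y z * s z) h q = (X q * pd t h q + pd X h q * t q) - (Y q * pd s h q + pd Y h q * s q)"
      if "X differentiable (at q)" "Y differentiable (at q)" "s differentiable (at q)" "t differentiable (at q)" for X Y s t :: "real \<times> real \<Rightarrow> real"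
      by (simp only: pd_diff[OF differentiable_mult[OF that(1,4)] differentiable_mult[OF that(2,3)]] pd_mult[OF that(1,4)] pd_mult[OF that(2,3)])
    show ?thesis
      unfolding coeff_a_def[abs_def] coeff_b_def[abs_def] coeff_c_def[abs_def] E_def Fo_def G_def
      by (intro conjI; subst minor; (rule ffd)?)
         (rule two_by_two_minor_derivative[OF lk sf(2,3) m(2,3)] two_by_two_minor_derivative[OF lk sf(1,3) m(1,3)]
           two_by_two_minor_derivative[OF lk sf(1,2) m(1,2)])+
  qed
  have l0: "2 * \<rho> \<noteq> 0" using lk by auto
  let ?\<Delta> = "D4_discriminant x q p"
  have \<Delta>: "?\<Delta> = E * (B * D - C\<^sup>2) - Fo * (A * D - B * C) + G * (A * C - B\<^sup>2)"
    by (simp add: D4_discriminant_def Let_def E_def Fo_def G_def A_def B_def C_def D_def)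
  note du = pd_coeff[OF u, unfolded sym, folded A_def B_def C_def D_def]
  note dv = pd_coeff[OF v, unfolded sym, folded A_def B_def C_def D_def]
  have umb: "coeff_a x q = 0" "coeff_b x q = 0" "coeff_c x q = 0"
    by (simp_all add: coeff_a_def coeff_b_def coeff_c_def sf)
  note cc = complexifiable_coefficients[OF x]
  obtain HE HF HG Ha Hb Hc where H: "HE \<in> complexification q (ff_E x)" "HF \<in> complexification q (ff_F x)"
    "HG \<in> complexification q (ff_G x)" "Ha \<in> complexification q (coeff_a x)" "Hb \<in> complexification q (coeff_b x)"
    "Hc \<in> complexification q (coeff_c x)"
    using ff cc unfolding complexifiable_at_def by blast
  have jac: "(2 * \<rho>)\<^sup>2 * (pd1 h q * pd2 k q - pd2 h q * pd1 k q) = (2 * \<rho> * pd1 h q) * (2 * \<rho> * pd2 k q) - (2 * \<rho> * pd2 h q) * (2 * \<rho> * pd1 k q)"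
    for h k :: "real \<times> real \<Rightarrow> real" by (simp add: power2_eq_square algebra_simps)
  have jac_bc: "(2 * \<rho>)\<^sup>2 * (pd1 (coeff_b x) q * pd2 (coeff_c x) q - pd2 (coeff_b x) q * pd1 (coeff_c x) q) = - E * ?\<Delta>"
    unfolding jac du[THEN conjunct2, THEN conjunct1] du[THEN conjunct2, THEN conjunct2]
      dv[THEN conjunct2, THEN conjunct1] dv[THEN conjunct2, THEN conjunct2] \<Delta>
    by (simp add: algebra_simps power2_eq_square)
  have jac_ac: "(2 * \<rho>)\<^sup>2 * (pd1 (coeff_a x) q * pd2 (coeff_c x) q - pd2 (coeff_a x) q * pd1 (coeff_c x) q) = - Fo * ?\<Delta>"
    unfolding jac du[THEN conjunct1] du[THEN conjunct2, THEN conjunct2]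
      dv[THEN conjunct1] dv[THEN conjunct2, THEN conjunct2] \<Delta>
    by (simp add: algebra_simps power2_eq_square)
  have jac_ab: "(2 * \<rho>)\<^sup>2 * (pd1 (coeff_a x) q * pd2 (coeff_b x) q - pd2 (coeff_a x) q * pd1 (coeff_b x) q) = - G * ?\<Delta>"
    unfolding jac du[THEN conjunct2, THEN conjunct1] du[THEN conjunct1]
      dv[THEN conjunct2, THEN conjunct1] dv[THEN conjunct1] \<Delta>
    by (simp add: algebra_simps power2_eq_square)
  have mbc: "multiplicity_at q (coeff_b x) (coeff_c x) = 1 \<longleftrightarrow> ?\<Delta> \<noteq> 0" if "E \<noteq> 0"
    unfolding multiplicity_one_iff_jacobian[OF H(5,6) umb(2,3)] using jac_bc l0 that by (metis mult_eq_0_iff neg_equal_0_iff_equal power_eq_0_iff zero_neq_numeral)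
  have mac: "multiplicity_at q (coeff_a x) (coeff_c x) = 1 \<longleftrightarrow> ?\<Delta> \<noteq> 0" if "Fo \<noteq> 0"
    unfolding multiplicity_one_iff_jacobian[OF H(4,6) umb(1,3)] using jac_ac l0 that by (metis mult_eq_0_iff neg_equal_0_iff_equal power_eq_0_iff zero_neq_numeral)
  have mab: "multiplicity_at q (coeff_a x) (coeff_b x) = 1 \<longleftrightarrow> ?\<Delta> \<noteq> 0" if "G \<noteq> 0"
    unfolding multiplicity_one_iff_jacobian[OF H(4,5) umb(1,2)] using jac_ab l0 that by (metis mult_eq_0_iff neg_equal_0_iff_equal power_eq_0_iff zero_neq_numeral)
  have neg: "(\<lambda>z. of_real 0 - K z) \<in> complexification q (\<lambda>z. 0 - k z)" if "K \<in> complexification q k" for K k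
    by (intro complexification_diff complexification_const that)
  have ac_bc: "multiplicity_at q (coeff_a x) (coeff_c x) = multiplicity_at q (coeff_b x) (coeff_c x)" if "E \<noteq> 0" "Fo \<noteq> 0"
    by (rule multiplicity_at_exchange[OF H(4,5,6) H(1,2) neg[OF H(3)]])
       (use that coeff_syzygy[of x] in \<open>auto simp: E_def Fo_def algebra_simps\<close>)
  have ca_ba: "multiplicity_at q (coeff_c x) (coeff_a x) = multiplicity_at q (coeff_b x) (coeff_a x)" if "G \<noteq> 0" "Fo \<noteq> 0"
    by (rule multiplicity_at_exchange[OF H(6,5,4) H(3,2) neg[OF H(1)]])
       (use that coeff_syzygy[of x] in \<open>auto simp: G_def Fo_def algebra_simps\<close>)
  have ab_cb: "multiplicity_at q (coeff_a x) (coeff_b x) = multiplicity_at q (coeff_c x) (coeff_b x)" if "E \<noteq> 0" "G \<noteq> 0"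
    by (rule multiplicity_at_exchange[OF H(4,6,5) H(1) neg[OF H(3)] H(2)])
       (use that coeff_syzygy[of x] in \<open>auto simp: E_def G_def algebra_simps\<close>)
  let ?P = "\<lambda>m. (ff_E x q \<noteq> 0 \<longrightarrow> m = multiplicity_at q (coeff_b x) (coeff_c x)) \<and>
      (ff_F x q \<noteq> 0 \<longrightarrow> m = multiplicity_at q (coeff_a x) (coeff_c x)) \<and>
      (ff_G x q \<noteq> 0 \<longrightarrow> m = multiplicity_at q (coeff_a x) (coeff_b x))"
  have "\<exists>m. ?P m \<and> (m = 1 \<longleftrightarrow> ?\<Delta> \<noteq> 0)"
  proof -
    consider "E \<noteq> 0" | "E = 0" "Fo \<noteq> 0" | "E = 0" "Fo = 0" "G \<noteq> 0" using ne by (auto simp: E_def Fo_def G_def)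
    then show ?thesis
    proof cases
      case 1 then show ?thesis
        using mbc ac_bc ab_cb multiplicity_at_commute[of q "coeff_c x" "coeff_b x"]
        by (intro exI[of _ "multiplicity_at q (coeff_b x) (coeff_c x)"]) (auto simp: E_def Fo_def G_def)
    next
      case 2 then show ?thesis
        using mac ca_ba multiplicity_at_commute[of q "coeff_c x" "coeff_a x"] multiplicity_at_commute[of q "coeff_b x" "coeff_a x"]
        by (intro exI[of _ "multiplicity_at q (coeff_a x) (coeff_c x)"]) (auto simp: E_def Fo_def G_def)
    next
      case 3 then show ?thesis
        using mab by (intro exI[of _ "multiplicity_at q (coeff_a x) (coeff_b x)"]) (auto simp: E_def Fo_def G_def)
    qed
  qed
  then obtain m where m: "?P m" "m = 1 \<longleftrightarrow> ?\<Delta> \<noteq> 0" by blast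
  have "umbilic_multiplicity x q = m"
    unfolding umbilic_multiplicity_def
  proof (rule the_equality)
    show "?P m" by (rule m(1))
    show "m' = m" if "?P m'" for m' using that m(1) ne by metis
  qed
  with m(2) show ?thesis by simp
qed

section \<open>Versality at a D4 point\<close>

lemma cubic_at_0_add_scaled:
  assumes "cubic_at_0 f" "cubic_at_0 g" shows "cubic_at_0 (\<lambda>z. f z + k * g z)"
proof -
  obtain a0 a1 a2 a3 where a: "smooth_at a0 0" "smooth_at a1 0" "smooth_at a2 0" "smooth_at a3 0"
    and f: "eventually (\<lambda>(u, v). f (u, v) = u^3 * a0 (u, v) + u^2 * v * a1 (u, v) + u * v^2 * a2 (u, v) + v^3 * a3 (u, v)) (nhds 0)"
    using assms(1) unfolding cubic_at_0_def by blast
  obtain b0 b1 b2 b3 where b: "smooth_at b0 0" "smooth_at b1 0" "smooth_at b2 0" "smooth_at b3 0"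
    and g: "eventually (\<lambda>(u, v). g (u, v) = u^3 * b0 (u, v) + u^2 * v * b1 (u, v) + u * v^2 * b2 (u, v) + v^3 * b3 (u, v)) (nhds 0)"
    using assms(2) unfolding cubic_at_0_def by blast
  have "eventually (\<lambda>(u, v). f (u, v) + k * g (u, v) = u^3 * (\<lambda>z. a0 z + k * b0 z) (u, v)
      + u^2 * v * (\<lambda>z. a1 z + k * b1 z) (u, v) + u * v^2 * (\<lambda>z. a2 z + k * b2 z) (u, v)
      + v^3 * (\<lambda>z. a3 z + k * b3 z) (u, v)) (nhds 0)"
    using f g by eventually_elim (auto simp: algebra_simps)
  moreover have "smooth_at (\<lambda>z. a0 z + k * b0 z) 0" "smooth_at (\<lambda>z. a1 z + k * b1 z) 0"
    "smooth_at (\<lambda>z. a2 z + k * b2 z) 0" "smooth_at (\<lambda>z. a3 z + k * b3 z) 0"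
    by (intro smooth_at_intros a b)+
  ultimately show ?thesis unfolding cubic_at_0_def by blast
qed

lemma pd_pd_add:
  fixes f g :: "real \<times> real \<Rightarrow> real"
  assumes "smooth_at f p" "smooth_at g p"
  shows "pd (\<lambda>z. f z + g z) h p = pd f h p + pd g h p"
    and "pd (pd (\<lambda>z. f z + g z) h) k p = pd (pd f h) k p + pd (pd g h) k p"
proof -
  have e: "eventually (\<lambda>z. pd (\<lambda>z. f z + g z) h z = pd f h z + pd g h z) (nhds p)"
    using assms[THEN smooth_at_imp_differentiable] by eventually_elim (rule pd_add)
  then show "pd (\<lambda>z. f z + g z) h p = pd f h p + pd g h p" by (rule eventually_nhds_x_imp_x)
  show "pd (pd (\<lambda>z. f z + g z) h) k p = pd (pd f h) k p + pd (pd g h) k p"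
    unfolding pd_cong[OF e] by (intro pd_add smooth_at_imp_differentiable_at smooth_at_pd assms)
qed

text \<open>Only the value of the coefficient \<open>\<alpha>\<close> at the point enters, so the quadratic parts of the
  elements of an ideal whose generators have zero 1-jet are linear combinations of those of the
  generators.\<close>

lemma pd_pd_mult_flat:
  fixes \<alpha> g :: "real \<times> real \<Rightarrow> real"
  assumes "smooth_at \<alpha> p" "smooth_at g p" and flat: "g p = 0" "\<And>h. pd g h p = 0"
  shows "pd (\<lambda>z. \<alpha> z * g z) h p = 0"
    and "pd (pd (\<lambda>z. \<alpha> z * g z) h) k p = \<alpha> p * pd (pd g h) k p"
proof -
  have e: "eventually (\<lambda>z. pd (\<lambda>z. \<alpha> z * g z) h z = \<alpha> z * pd g h z + pd \<alpha> h z * g z) (nhds p)"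
    using assms(1,2)[THEN smooth_at_imp_differentiable] by eventually_elim (rule pd_mult)
  from eventually_nhds_x_imp_x[OF this] show "pd (\<lambda>z. \<alpha> z * g z) h p = 0" by (simp add: flat)
  note d = smooth_at_imp_differentiable_at
  have "pd (pd (\<lambda>z. \<alpha> z * g z) h) k p = pd (\<lambda>z. \<alpha> z * pd g h z) k p + pd (\<lambda>z. pd \<alpha> h z * g z) k p"
    unfolding pd_cong[OF e] by (intro pd_add d smooth_at_intros assms)
  also have "\<dots> = \<alpha> p * pd (pd g h) k p"
    by (simp add: pd_mult d smooth_at_pd assms flat)
  finally show "pd (pd (\<lambda>z. \<alpha> z * g z) h) k p = \<alpha> p * pd (pd g h) k p" .
qed

lemma pd_quadratic_form:
  fixes r1 r2 r3 :: real
  defines "p \<equiv> \<lambda>z :: real \<times> real. r1 / 2 * fst z ^ 2 + r2 * (fst z * snd z) + r3 / 2 * snd z ^ 2"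
  shows "pd1 p 0 = 0" "pd2 p 0 = 0" "pd1 (pd1 p) 0 = r1" "pd2 (pd1 p) 0 = r2" "pd2 (pd2 p) 0 = r3" "smooth_at p 0"
proof -
  have "(p has_derivative (\<lambda>h. fst h * (r1 * fst z + r2 * snd z) + snd h * (r2 * fst z + r3 * snd z))) (at z)" for z
    unfolding p_def by (auto intro!: derivative_eq_intros simp: algebra_simps power2_eq_square)
  from pd_eqI[OF this] have p1: "pd1 p = (\<lambda>z. r1 * fst z + r2 * snd z)" "pd2 p = (\<lambda>z. r2 * fst z + r3 * snd z)"
    by (simp_all add: fun_eq_iff)
  have lin: "((\<lambda>z. a * fst z + b * snd z) has_derivative (\<lambda>h. a * fst h + b * snd h)) (at z)" for a b :: real and z
    by (auto intro!: derivative_eq_intros)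
  show "pd1 p 0 = 0" "pd2 p 0 = 0" by (simp_all add: p1)
  show "pd1 (pd1 p) 0 = r1" "pd2 (pd1 p) 0 = r2" "pd2 (pd2 p) 0 = r3"
    unfolding p1 pd_eqI[OF lin] by simp_all
  show "smooth_at p 0" unfolding p_def by (intro smooth_at_intros)
qed

lemma dist_sq_parameter_derivative:
  "frechet_derivative (dist_sq_family x q z) (at v0) e = - 2 * lorentz (x (q + z) - v0) e"
proof -
  have d: "((\<lambda>v. x (q + z) - v) has_derivative (\<lambda>h. - h)) (at v0)"
    by (auto intro!: derivative_eq_intros)
  have "(dist_sq_family x q z has_derivative
      (\<lambda>h. lorentz (x (q + z) - v0) (- h) + lorentz (- h) (x (q + z) - v0))) (at v0)"
    unfolding dist_sq_family_def[abs_def] dist_sq_def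
    by (rule bounded_bilinear.FDERIV[OF bounded_bilinear_lorentz d d])
  from frechet_derivative_at[OF this, symmetric] show ?thesis
    by (simp add: lorentz_def algebra_simps)
qed

text \<open>The three parameter derivatives span the functions \<open>lorentz (x (q + z) - v0) D\<close>.\<close>

lemma Rplus_versal_dist_sq_iff:
  fixes x :: "real \<times> real \<Rightarrow> real^3" and q :: "real \<times> real"
  defines "f \<equiv> \<lambda>v0 z. dist_sq (x (q + z)) v0"
  assumes f: "smooth_at (f v0) 0" and y: "\<And>D. smooth_at (\<lambda>z. lorentz (x (q + z) - v0) D) 0"
  shows "Rplus_versal (dist_sq_family x q) v0 \<longleftrightarrow>
    (\<forall>p. smooth_at p 0 \<longrightarrow> (\<exists>\<alpha> \<beta> c D. smooth_at \<alpha> 0 \<and> smooth_at \<beta> 0 \<and>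
      eventually (\<lambda>z. p z = \<alpha> z * pd1 (f v0) z + \<beta> z * pd2 (f v0) z + (c + lorentz (x (q + z) - v0) D)) (nhds 0)))"
proof -
  have fam: "(\<lambda>w. dist_sq_family x q w v0) = f v0" by (simp add: fun_eq_iff dist_sq_family_def f_def)
  let ?e = "\<lambda>\<alpha> \<beta> c D z. \<alpha> z * pd1 (f v0) z + \<beta> z * pd2 (f v0) z + (c + lorentz (x (q + z) - v0) D)"
  have param: "(\<Sum>i\<in>UNIV. d i * frechet_derivative (dist_sq_family x q z) (at v0) (axis i 1))
      = lorentz (x (q + z) - v0) (\<chi> i. - 2 * d i)" for d :: "3 \<Rightarrow> real" and z
    unfolding dist_sq_parameter_derivative by (simp add: sum_3 lorentz_def axis_def algebra_simps)
  let ?L = "{germ 0 (?e \<alpha> \<beta> c D) | \<alpha> \<beta> c D. smooth_at \<alpha> 0 \<and> smooth_at \<beta> 0}"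
  have L: "Rplus_versal (dist_sq_family x q) v0 \<longleftrightarrow> ?L = smooth_germs"
  proof -
    have "{germ 0 (?e \<alpha> \<beta> c (\<chi> i. - 2 * d i)) | \<alpha> \<beta> c d. smooth_at \<alpha> 0 \<and> smooth_at \<beta> 0} = ?L"
    proof (intro equalityI subsetI)
      fix g assume "g \<in> ?L"
      then obtain \<alpha> \<beta> c D where g: "g = germ 0 (?e \<alpha> \<beta> c D)" "smooth_at \<alpha> 0" "smooth_at \<beta> 0" by blast
      have "D = (\<chi> i. - 2 * (- (D $ i) / 2))" by (simp add: vec_eq_iff)
      then have "g = germ 0 (?e \<alpha> \<beta> c (\<chi> i. - 2 * (- (D $ i) / 2)))" using g(1) by simp
      then show "g \<in> {germ 0 (?e \<alpha> \<beta> c (\<chi> i. - 2 * d i)) | \<alpha> \<beta> c d. smooth_at \<alpha> 0 \<and> smooth_at \<beta> 0}"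
        using g(2,3) by (intro CollectI exI[of _ \<alpha>] exI[of _ \<beta>] exI[of _ c] exI[of _ "\<lambda>i. - (D $ i) / 2"]) simp
    qed blast
    then show ?thesis unfolding Rplus_versal_def fam param by simp
  qed
  have "?L \<subseteq> smooth_germs"
  proof
    fix g assume "g \<in> ?L"
    then obtain \<alpha> \<beta> c D where g: "g = germ 0 (?e \<alpha> \<beta> c D)" "smooth_at \<alpha> 0" "smooth_at \<beta> 0" by blast
    have "smooth_at (?e \<alpha> \<beta> c D) 0" by (intro smooth_at_intros g f y)
    then show "g \<in> smooth_germs" unfolding smooth_germs_def g(1) by blast
  qed
  then have "?L = smooth_germs \<longleftrightarrow> (\<forall>p. smooth_at p 0 \<longrightarrow> germ 0 p \<in> ?L)"
    unfolding smooth_germs_def by blast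
  also have "\<dots> \<longleftrightarrow> (\<forall>p. smooth_at p 0 \<longrightarrow> (\<exists>\<alpha> \<beta> c D. smooth_at \<alpha> 0 \<and> smooth_at \<beta> 0 \<and>
      eventually (\<lambda>z. p z = ?e \<alpha> \<beta> c D z) (nhds 0)))"
    unfolding mem_Collect_eq germ_eq_iff by (intro all_cong1 imp_cong refl) blast
  finally show ?thesis unfolding L .
qed

text \<open>Since all cubic germs lie in the ideal of the partial derivatives, versality is a statement about
  2-jets. Constants and the functions \<open>lorentz (x - v0) D\<close> account for all 1-jets. Once the 1-jet is
  prescribed, the vector \<open>D\<close> is free only in the direction of the normal \<open>N\<close>, which contributes the
  second fundamental form, a multiple of \<open>(E, F, G)\<close>. What remains is that this form and the
  quadratic parts of the two partial derivatives span the binary quadratic forms.\<close>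

lemma versal_iff_discriminant:
  fixes v0 :: "real^3"
  assumes x: "complexifiable_vec_at q x" and N: "lorentz_cross (pd1 x q) (pd2 x q) \<noteq> 0"
    and grad: "\<And>h. pd (\<lambda>z. dist_sq (x z) v0) h q = 0"
    and hess: "\<And>h k. pd (pd (\<lambda>z. dist_sq (x z) v0) h) k q = 0"
    and cubic: "\<And>p. cubic_at_0 p \<Longrightarrow> in_jacobian_ideal (\<lambda>z. dist_sq (x (q + z)) v0) p"
  shows "Rplus_versal (dist_sq_family x q) v0 \<longleftrightarrow> D4_discriminant x q v0 \<noteq> 0"
proof -
  let ?F = "\<lambda>z. dist_sq (x z) v0"
  let ?f = "\<lambda>z. dist_sq (x (q + z)) v0"
  let ?H = "\<lambda>D z. lorentz (x z - v0) D"
  let ?h = "\<lambda>D z. lorentz (x (q + z) - v0) D"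
  have u: "(1, 0) \<in> unit_directions" and v: "(0, 1) \<in> unit_directions" by auto
  obtain \<rho> \<kappa> where w: "x q - v0 = \<rho> *\<^sub>R lorentz_cross (pd1 x q) (pd2 x q)" and lk: "\<rho> * \<kappa> = -1"
    and sf: "sf_l x q = \<kappa> * ff_E x q" "sf_m x q = \<kappa> * ff_F x q" "sf_n x q = \<kappa> * ff_G x q"
    by (rule D4_point_data[OF x N grad hess])
  have k0: "\<kappa> \<noteq> 0" using lk by auto
  have xp: "complexifiable_vec_at q (\<lambda>z. x z - v0)" by (intro complexifiable_vec_at_diff x complexifiable_vec_at_const)
  have F: "complexifiable_at q ?F" unfolding dist_sq_def by (intro complexifiable_at_lorentz xp)
  have H: "complexifiable_at q (?H D)" for D by (intro complexifiable_at_lorentz xp complexifiable_vec_at_const)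
  have smooth_shift: "smooth_at (\<lambda>z. g (q + z)) 0" if "complexifiable_at q g" for g
    using complexifiable_at_smooth[OF that] by (intro smooth_at_translation) simp
  have f: "smooth_at ?f 0" by (rule smooth_shift[OF F])
  have h: "smooth_at (?h D) 0" for D by (rule smooth_shift[OF H])
  have tr: "pd (\<lambda>z. g (q + z)) h = (\<lambda>z. pd g h (q + z))" for g :: "real \<times> real \<Rightarrow> real" and h
    by (simp add: fun_eq_iff pd_translation)
  have tr_at: "pd (\<lambda>z. g (q + z)) h 0 = pd g h q" "pd (pd (\<lambda>z. g (q + z)) h) k 0 = pd (pd g h) k q"
    "pd (pd (pd (\<lambda>z. g (q + z)) h) k) j 0 = pd (pd (pd g h) k) j q" for g :: "real \<times> real \<Rightarrow> real" and h k j
    unfolding tr[of g] tr[of "pd g h"] tr[of "pd (pd g h) k"] by simp_all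
  note sym = third_derivative_symmetry[OF F]
  define E Fo G where "E = ff_E x q" and "Fo = ff_F x q" and "G = ff_G x q"
  define A B C D where "A = pd1 (pd1 (pd1 ?F)) q" and "B = pd2 (pd1 (pd1 ?F)) q"
    and "C = pd2 (pd2 (pd1 ?F)) q" and "D = pd2 (pd2 (pd2 ?F)) q"
  let ?\<Delta> = "D4_discriminant x q v0"
  have \<Delta>: "?\<Delta> = E * (B * D - C\<^sup>2) - Fo * (A * D - B * C) + G * (A * C - B\<^sup>2)"
    by (simp add: D4_discriminant_def Let_def E_def Fo_def G_def A_def B_def C_def D_def)
  have f3: "pd1 (pd1 (pd1 ?f)) 0 = A" "pd2 (pd1 (pd1 ?f)) 0 = B" "pd1 (pd2 (pd1 ?f)) 0 = B" "pd2 (pd2 (pd1 ?f)) 0 = C"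
    "pd1 (pd1 (pd2 ?f)) 0 = B" "pd2 (pd1 (pd2 ?f)) 0 = C" "pd1 (pd2 (pd2 ?f)) 0 = C" "pd2 (pd2 (pd2 ?f)) 0 = D"
    unfolding tr_at(3)[of ?F] A_def B_def C_def D_def sym by (rule refl)+
  have f12: "pd ?f h 0 = 0" "pd (pd ?f h) k 0 = 0" for h k
    unfolding tr_at(1,2)[of ?F] by (rule grad hess)+
  have h12: "pd1 (?h d) 0 = lorentz (pd1 x q) d" "pd2 (?h d) 0 = lorentz (pd2 x q) d"
    "pd1 (pd1 (?h d)) 0 = lorentz (pd1 (pd1 x) q) d" "pd2 (pd1 (?h d)) 0 = lorentz (pd2 (pd1 x) q) d"
    "pd1 (pd2 (?h d)) 0 = lorentz (pd1 (pd2 x) q) d"  "pd2 (pd2 (?h d)) 0 = lorentz (pd2 (pd2 x) q) d" for d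
    unfolding tr_at(1,2)[of "?H d"] using height_pd[OF x u, of v0 d] height_pd[OF x v, of v0 d] by simp_all
  have xuv: "pd1 (pd2 x) q = pd2 (pd1 x) q"
    by (rule complexifiable_vec_at_pd_commute[OF x, THEN eventually_nhds_x_imp_x])
  let ?N = "lorentz_cross (pd1 x q) (pd2 x q)"
  have norm_u: "lorentz (pd1 x q) ?N = 0" "lorentz (pd2 x q) ?N = 0"
    by (simp_all add: lorentz_def lorentz_cross_nth algebra_simps)
  have norm_uu: "lorentz (pd1 (pd1 x) q) ?N = \<kappa> * E" "lorentz (pd2 (pd1 x) q) ?N = \<kappa> * Fo" "lorentz (pd2 (pd2 x) q) ?N = \<kappa> * G"
    using sf by (simp_all add: sf_l_def sf_m_def sf_n_def E_def Fo_def G_def lorentz_commute)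
  have "Rplus_versal (dist_sq_family x q) v0 \<longleftrightarrow>
    (\<forall>p. smooth_at p 0 \<longrightarrow> (\<exists>\<alpha> \<beta> c d. smooth_at \<alpha> 0 \<and> smooth_at \<beta> 0 \<and>
      eventually (\<lambda>z. p z = \<alpha> z * pd1 ?f z + \<beta> z * pd2 ?f z + (c + ?h d z)) (nhds 0)))"
    (is "_ \<longleftrightarrow> ?versal") by (rule Rplus_versal_dist_sq_iff[OF f h])
  also have "?versal \<longleftrightarrow> (\<forall>r1 r2 r3. \<exists>\<alpha> \<beta> k. \<alpha> * A + \<beta> * B + k * E = r1 \<and> \<alpha> * B + \<beta> * C + k * Fo = r2 \<and> \<alpha> * C + \<beta> * D + k * G = r3)"
    (is "_ \<longleftrightarrow> ?surj")
  proof
    assume ?versal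
    show ?surj
    proof (intro allI)
      fix r1 r2 r3
      define p where "p = (\<lambda>z :: real \<times> real. r1 / 2 * fst z ^ 2 + r2 * (fst z * snd z) + r3 / 2 * snd z ^ 2)"
      note p = pd_quadratic_form[of r1 r2 r3, folded p_def]
      obtain \<alpha> \<beta> c d where ab: "smooth_at \<alpha> 0" "smooth_at \<beta> 0"
        and eq: "eventually (\<lambda>z. p z = \<alpha> z * pd1 ?f z + \<beta> z * pd2 ?f z + (c + ?h d z)) (nhds 0)"
        using \<open>?versal\<close> p(6) by blast
      have s: "smooth_at (\<lambda>z. \<alpha> z * pd1 ?f z) 0" "smooth_at (\<lambda>z. \<beta> z * pd2 ?f z) 0"
        "smooth_at (\<lambda>z. \<alpha> z * pd1 ?f z + \<beta> z * pd2 ?f z) 0" "smooth_at (\<lambda>z. c + ?h d z) 0" "smooth_at (\<lambda>_ :: real \<times> real. c) 0"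
        by (intro smooth_at_intros ab f h)+
      note flat = pd_pd_mult_flat[OF ab(1) smooth_at_pd[OF f] f12(1) f12(2)] pd_pd_mult_flat[OF ab(2) smooth_at_pd[OF f] f12(1) f12(2)]
      have c: "pd (pd (\<lambda>_ :: real \<times> real. c) h) k 0 = 0" for h k by (simp add: pd_const[abs_def])
      have d1: "pd p h 0 = pd (?h d) h 0" for h
        unfolding pd_cong[OF eq] pd_pd_add(1)[OF s(3,4)] pd_pd_add(1)[OF s(1,2)] pd_pd_add(1)[OF s(5) h]
        by (simp add: flat pd_const)
      have d2: "pd (pd p h) k 0 = \<alpha> 0 * pd (pd (pd1 ?f) h) k 0 + \<beta> 0 * pd (pd (pd2 ?f) h) k 0 + pd (pd (?h d) h) k 0" for h k
        unfolding pd_cong[OF pd_cong_eventually[OF eq]] pd_pd_add(2)[OF s(3,4)] pd_pd_add(2)[OF s(1,2)] pd_pd_add(2)[OF s(5) h]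
        by (simp add: flat c)
      have "lorentz (pd1 x q) d = 0" "lorentz (pd2 x q) d = 0" using d1 p(1,2) h12(1,2) by metis+
      then obtain t where t: "d = t *\<^sub>R ?N" by (rule lorentz_orthogonal_complement[OF N])
      have "\<alpha> 0 * A + \<beta> 0 * B + (t * \<kappa>) * E = r1" "\<alpha> 0 * B + \<beta> 0 * C + (t * \<kappa>) * Fo = r2" "\<alpha> 0 * C + \<beta> 0 * D + (t * \<kappa>) * G = r3"
        using d2[of "(1, 0)" "(1, 0)"] d2[of "(1, 0)" "(0, 1)"] d2[of "(0, 1)" "(0, 1)"]
        unfolding p f3 h12 by (simp_all add: t lorentz_simps norm_uu)
      then show "\<exists>\<alpha> \<beta> k. \<alpha> * A + \<beta> * B + k * E = r1 \<and> \<alpha> * B + \<beta> * C + k * Fo = r2 \<and> \<alpha> * C + \<beta> * D + k * G = r3"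
        by blast
    qed
  next
    assume ?surj
    show ?versal
    proof (intro allI impI)
      fix p :: "real \<times> real \<Rightarrow> real" assume p: "smooth_at p 0"
      obtain d0 where d0: "lorentz (pd1 x q) d0 = pd1 p 0" "lorentz (pd2 x q) d0 = pd2 p 0"
        by (rule lorentz_dual_basis[OF N])
      obtain a b k where abk: "a * A + b * B + k * E = pd1 (pd1 p) 0 - lorentz (pd1 (pd1 x) q) d0"
        "a * B + b * C + k * Fo = (pd2 (pd1 p) 0 + pd1 (pd2 p) 0) / 2 - lorentz (pd2 (pd1 x) q) d0"
        "a * C + b * D + k * G = pd2 (pd2 p) 0 - lorentz (pd2 (pd2 x) q) d0"
        using \<open>?surj\<close> by blast
      \<comment> \<open>the normal component of \<open>d\<close> adjusts the quadratic part and leaves the 1-jet fixed\<close>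
      define d where "d = d0 + (k / \<kappa>) *\<^sub>R ?N"
      define c where "c = p 0 - ?h d 0"
      let ?T = "\<lambda>g z. g z - taylor2 g z"
      have cub: "cubic_at_0 (\<lambda>z. ((?T p z + (- a) * ?T (pd1 ?f) z) + (- b) * ?T (pd2 ?f) z) + (-1) * ?T (?h d) z)"
        by (intro cubic_at_0_add_scaled cubic_at_0_minus_taylor2 p smooth_at_pd f h)
      have 1: "lorentz (pd1 x q) d = pd1 p 0" "lorentz (pd2 x q) d = pd2 p 0"
        by (simp_all add: d_def lorentz_simps norm_u d0)
      have kk: "k / \<kappa> * (\<kappa> * e) = k * e" for e using k0 by simp
      have 2: "pd1 (pd1 p) 0 = a * A + b * B + lorentz (pd1 (pd1 x) q) d"
        "(pd2 (pd1 p) 0 + pd1 (pd2 p) 0) / 2 = a * B + b * C + lorentz (pd2 (pd1 x) q) d"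
        "pd2 (pd2 p) 0 = a * C + b * D + lorentz (pd2 (pd2 x) q) d"
        unfolding d_def lorentz_simps norm_uu kk using abk[unfolded eq_diff_eq, symmetric] by (simp_all only: ac_simps)
      have "taylor2 p z - a * taylor2 (pd1 ?f) z - b * taylor2 (pd2 ?f) z - taylor2 (?h d) z = c" for z
        unfolding taylor2_def f3 f12 h12 1 2 xuv c_def by (simp add: algebra_simps add_divide_distrib)
      then have eqn: "((?T p z + (- a) * ?T (pd1 ?f) z) + (- b) * ?T (pd2 ?f) z) + (-1) * ?T (?h d) z
          = p z - a * pd1 ?f z - b * pd2 ?f z - c - ?h d z" for z
        by (simp add: algebra_simps)
      from cub have "cubic_at_0 (\<lambda>z. p z - a * pd1 ?f z - b * pd2 ?f z - c - ?h d z)" unfolding eqn .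
      from cubic[OF this] obtain \<alpha> \<beta> where ab: "smooth_at \<alpha> 0" "smooth_at \<beta> 0"
        and eq: "eventually (\<lambda>z. p z - a * pd1 ?f z - b * pd2 ?f z - c - ?h d z = \<alpha> z * pd1 ?f z + \<beta> z * pd2 ?f z) (nhds 0)"
        unfolding in_jacobian_ideal_def by blast
      have "eventually (\<lambda>z. p z = (a + \<alpha> z) * pd1 ?f z + (b + \<beta> z) * pd2 ?f z + (c + ?h d z)) (nhds 0)"
        using eq by eventually_elim (simp add: algebra_simps)
      moreover have "smooth_at (\<lambda>z. a + \<alpha> z) 0" "smooth_at (\<lambda>z. b + \<beta> z) 0" by (intro smooth_at_intros ab)+
      ultimately show "\<exists>\<alpha> \<beta> c d. smooth_at \<alpha> 0 \<and> smooth_at \<beta> 0 \<and>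
          eventually (\<lambda>z. p z = \<alpha> z * pd1 ?f z + \<beta> z * pd2 ?f z + (c + ?h d z)) (nhds 0)" by blast
    qed
  qed
  also have "?surj \<longleftrightarrow> ?\<Delta> \<noteq> 0" unfolding \<Delta> by (rule surjective_3x3_iff)
  finally show ?thesis .
qed

theorem theorem3p12:
  fixes M :: "(real^3) set" and U :: "(real \<times> real) set"
    and x :: "real \<times> real \<Rightarrow> real^3" and q :: "real \<times> real" and v0 :: "real^3"
  assumes "regular_analytic_surface M"
    and "analytic_parametrisation M U x" and "q \<in> U"
    and "umbilic x q"
    and "D4_plus (\<lambda>z. dist_sq_family x q z v0) \<or> D4_minus (\<lambda>z. dist_sq_family x q z v0)"
  shows "umbilic_multiplicity x q = 1 \<longleftrightarrow> Rplus_versal (dist_sq_family x q) v0"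
proof -
  let ?F = "\<lambda>z. dist_sq (x z) v0"
  let ?f = "\<lambda>z. dist_sq (x (q + z)) v0"
  have x: "complexifiable_vec_at q x" and N: "lorentz_cross (pd1 x q) (pd2 x q) \<noteq> 0"
    using analytic_parametrisation_complexifiable[OF assms(2,3)]
      analytic_parametrisation_normal_nonzero[OF assms(2,3)] .
  have "complexifiable_at q ?F"
    unfolding dist_sq_def by (intro complexifiable_at_lorentz complexifiable_vec_at_diff x complexifiable_vec_at_const)
  then have f: "smooth_at ?f 0"
    using complexifiable_at_smooth by (intro smooth_at_translation) simp
  obtain \<epsilon> where R: "R_equivalent (\<lambda>z. ?f z - ?f 0) (D4_germ \<epsilon>)" and \<epsilon>: "\<epsilon> \<noteq> 0"
  proof (rule disjE[OF assms(5)])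
    assume "D4_plus (\<lambda>z. dist_sq_family x q z v0)"
    then show thesis by (intro that[of 1]) (simp_all add: D4_plus_def D4_germ_def dist_sq_family_def)
  next
    assume "D4_minus (\<lambda>z. dist_sq_family x q z v0)"
    then show thesis by (intro that[of "-1"]) (simp_all add: D4_minus_def D4_germ_def dist_sq_family_def)
  qed
  have tr: "pd ?f h = (\<lambda>z. pd ?F h (q + z))" for h
    by (simp add: fun_eq_iff pd_translation[of ?F])
  have grad: "pd ?F h q = 0" and hess: "pd (pd ?F h) k q = 0" for h k
    using D4_two_jet_vanishes(1)[OF f R, of h] D4_two_jet_vanishes(2)[OF f R, of h k]
    by (simp_all add: tr pd_translation[of "pd ?F h"])
  have "Rplus_versal (dist_sq_family x q) v0 \<longleftrightarrow> D4_discriminant x q v0 \<noteq> 0"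
    by (rule versal_iff_discriminant[OF x N grad hess D4_jacobian_ideal_contains_cubic[OF f R \<epsilon>]])
  then show ?thesis
    using multiplicity_iff_discriminant[OF x N grad hess] by blast
qed

end
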